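(* Let $k$ be a field of characteristic $0$. The continuous Hochschild cohomology $HH^*_{\rm cts}(\mathbf{R}(L(\mathbb{Q}),\sim),k)$, with trivial coefficients, of the reduced incidence algebra $\mathbf{R}(L(\mathbb{Q}),\sim)$ of formal Dirichlet series over $k$ is a graded commutative algebra with countably many generators.
   Context: The reduced incidence algebra $\mathbf{R}(L(\mathbb{Q}),\sim)$ of formal Dirichlet series: let $L(\mathbb{Q})$ be the poset of finite subgroups of the additive group of rational numbers modulo $1$ (all of which are cyclic), ordered by inclusion, with $[X,Y]\sim[U,V]$ iff $Y/X\cong V/U$. The equivalence class (type) of $[X,Y]$ is identified with the positive integer $|Y/X|$. Then $\mathbf{R}(L(\mathbb{Q}),\sim)$ is the algebra of all functions $f:\{1,2,3,\dots\}\to k$ with product $(fg)(n)=\sum_{ij=n}f(i)g(j)$; $f$ corresponds to the formal Dirichlet series $\sum_{n\ge1}f(n)/n^s$. (Equivalently, it is the reduced incidence algebra of the positive integers ordered by divisibility, with $[x,y]\sim[u,v]$ iff $y/x=v/u$.) It is the convolution algebra dual to the Dirichlet coalgebra with basis $\{z_n\mid n\ge1\}$, $\Delta(z_n)=\sum_{ij=n}z_i\otimes z_j$, $\varepsilon(z_n)=\delta_{n,1}$. Continuous Hochschild cohomology: for a coalgebra $C$, the algebra $C^*$ is profinite (the inverse limit of the duals of the finite dimensional subcoalgebras of $C$) and carries the inverse limit topology, with $k$ and finite dimensional quotients discrete. $HH^*_{\rm cts}(\mathcal{A},M)$ is the cohomology of the subcomplex of continuous multilinear cochains $\mathcal{A}^{\times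 n}\to M$ of the Hochschild cochain complex. Trivial coefficients means $M=k$ with both actions through the augmentation $f\mapsto f(1)$. The graded algebra structure is the cup product induced by $(\phi\cup\psi)(a_1,\dots,a_{p+q})=\phi(a_1,\dots,a_p)\,\psi(a_{p+1},\dots,a_{p+q})$. *)

theory Defs
  imports
    "HOL-Analysis.Analysis"
    "HOL-Library.Function_Algebras"
    "HOL-Algebra.Algebra"
    "HOL-Algebra.Algebraic_Closure_Type"
begin

section \<open>The algebra of formal Dirichlet series and its pre-dual coalgebra\<close>

text \<open>
  The type of an interval \<open>[X, Y]\<close> of \<open>L(\<rat>)\<close> is the positive integer \<open>|Y/X|\<close>, and
  \<open>R(L(\<rat>), \<sim>)\<close> is the algebra of all functions on the types.  A function on
  \<open>{1, 2, 3, \<dots>}\<close> is encoded as a function on \<^typ>\<open>nat\<close> that vanishes at \<open>0\<close>.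
\<close>

definition dirichlet_algebra :: "('k::field, nat \<Rightarrow> 'k) module" where
  "dirichlet_algebra =
    \<lparr>carrier = {f. f 0 = 0},
     monoid.mult = (\<lambda>f g n. if n = 0 then 0 else \<Sum>(i, j)\<in>{(i, j). i * j = n}. f i * g j),
     monoid.one = (\<lambda>n. if n = 1 then 1 else 0),
     ring.zero = (\<lambda>n. 0),
     ring.add = (\<lambda>f g n. f n + g n),
     smult = (\<lambda>c f n. c * f n)\<rparr>"

definition dirichlet_augmentation :: "(nat \<Rightarrow> 'k::field) \<Rightarrow> 'k" where
  "dirichlet_augmentation f = f 1"

text \<open>
  The coalgebra with basis \<open>z\<^sub>n\<close> (\<open>n \<ge> 1\<close>): the element \<open>\<Sum> c\<^sub>n z\<^sub>n\<close> is encoded by its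
  finitely supported coefficient function \<open>c\<close>, and an element \<open>\<Sum> t\<^sub>i\<^sub>j z\<^sub>i \<otimes> z\<^sub>j\<close> of the
  tensor square by the function \<open>t\<close> on pairs.
\<close>

definition dirichlet_coalgebra :: "(nat \<Rightarrow> 'k::field) set" where
  "dirichlet_coalgebra = {c. c 0 = 0 \<and> finite {n. c n \<noteq> 0}}"

definition dirichlet_comult :: "(nat \<Rightarrow> 'k::field) \<Rightarrow> nat \<times> nat \<Rightarrow> 'k" where
  "dirichlet_comult c = (\<lambda>(i, j). if i = 0 \<or> j = 0 then 0 else c (i * j))"

definition tensor :: "(nat \<Rightarrow> 'k::field) \<Rightarrow> (nat \<Rightarrow> 'k) \<Rightarrow> nat \<times> nat \<Rightarrow> 'k" where
  "tensor c d = (\<lambda>(i, j). c i * d j)"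

abbreviation fun_scale :: "'k::field \<Rightarrow> ('a \<Rightarrow> 'k) \<Rightarrow> 'a \<Rightarrow> 'k" where
  "fun_scale r f \<equiv> (\<lambda>x. r * f x)"

definition fin_dim_subcoalgebra :: "(nat \<Rightarrow> 'k::field) set \<Rightarrow> bool" where
  "fin_dim_subcoalgebra D \<longleftrightarrow>
     D \<subseteq> dirichlet_coalgebra \<and>
     (\<exists>B. finite B \<and> D = Modules.module.span fun_scale B) \<and>
     (\<forall>c\<in>D. dirichlet_comult c
        \<in> Modules.module.span fun_scale {tensor d e |d e. d \<in> D \<and> e \<in> D})"

text \<open>The pairing identifying \<^const>\<open>dirichlet_algebra\<close> with the full linear dual of the coalgebra.\<close>

definition dirichlet_pairing :: "(nat \<Rightarrow> 'k::field) \<Rightarrow> (nat \<Rightarrow> 'k) \<Rightarrow> 'k" where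
  "dirichlet_pairing f c = (\<Sum>n\<in>{n. c n \<noteq> 0}. f n * c n)"

text \<open>
  The inverse limit topology: the coarsest topology for which every restriction map
  \<open>C\<^sup>* \<rightarrow> D\<^sup>*\<close> is continuous, where \<open>D\<close> ranges over the finite dimensional subcoalgebras and
  \<open>D\<^sup>*\<close> is discrete.  The generating sets are the fibres of these maps.
\<close>

definition dirichlet_topology :: "(nat \<Rightarrow> 'k::field) topology" where
  "dirichlet_topology = topology_generated_by
     {{g \<in> carrier dirichlet_algebra. \<forall>c\<in>D. dirichlet_pairing g c = dirichlet_pairing f c} |f D.
        f \<in> carrier dirichlet_algebra \<and> fin_dim_subcoalgebra D}"


section \<open>Continuous Hochschild cohomology with trivial coefficients\<close>

text \<open>
  In this section \<open>A\<close> is an algebra over the field \<open>'k\<close>, \<open>T\<close> a topology on its carrier and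
  \<open>\<epsilon>\<close> an augmentation, through which \<open>A\<close> acts on both sides of the coefficients \<open>'k\<close>.
  An \<open>n\<close>-tuple is an extensional function on \<open>{..<n}\<close> (so entries are numbered from \<open>0\<close>);
  cochains are normalised to vanish off the set of \<open>n\<close>-tuples of elements of \<open>A\<close>.
\<close>

definition args :: "('k::field, 'a) module \<Rightarrow> nat \<Rightarrow> (nat \<Rightarrow> 'a) set" where
  "args A n = {..<n} \<rightarrow>\<^sub>E carrier A"

definition on_args ::
    "('k::field, 'a) module \<Rightarrow> nat \<Rightarrow> ((nat \<Rightarrow> 'a) \<Rightarrow> 'k) \<Rightarrow> (nat \<Rightarrow> 'a) \<Rightarrow> 'k" where
  "on_args A n F = (\<lambda>a. if a \<in> args A n then F a else 0)"

definition multilinear :: "('k::field, 'a) module \<Rightarrow> nat \<Rightarrow> ((nat \<Rightarrow> 'a) \<Rightarrow> 'k) \<Rightarrow> bool" where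
  "multilinear A n \<phi> \<longleftrightarrow>
     (\<forall>a\<in>args A n. \<forall>i<n.
        (\<forall>x\<in>carrier A. \<forall>y\<in>carrier A.
           \<phi> (a(i := x \<oplus>\<^bsub>A\<^esub> y)) = \<phi> (a(i := x)) + \<phi> (a(i := y))) \<and>
        (\<forall>c. \<forall>x\<in>carrier A. \<phi> (a(i := c \<odot>\<^bsub>A\<^esub> x)) = c * \<phi> (a(i := x))))"

definition cts_cochains ::
    "('k::field, 'a) module \<Rightarrow> 'a topology \<Rightarrow> nat \<Rightarrow> ((nat \<Rightarrow> 'a) \<Rightarrow> 'k) set" where
  "cts_cochains A T n =
     {\<phi>. multilinear A n \<phi> \<and>
         continuous_map (product_topology (\<lambda>_. T) {..<n}) (discrete_topology UNIV) \<phi> \<and>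
         (\<forall>a. a \<notin> args A n \<longrightarrow> \<phi> a = 0)}"

text \<open>\<open>(a\<^sub>0, \<dots>, a\<^sub>n) \<mapsto> (a\<^sub>0, \<dots>, a\<^sub>i a\<^sub>i\<^sub>+\<^sub>1, \<dots>, a\<^sub>n)\<close>\<close>

definition contract :: "('k::field, 'a) module \<Rightarrow> nat \<Rightarrow> nat \<Rightarrow> (nat \<Rightarrow> 'a) \<Rightarrow> nat \<Rightarrow> 'a" where
  "contract A n i a =
     (\<lambda>j\<in>{..<n}. if j < i then a j else if j = i then a i \<otimes>\<^bsub>A\<^esub> a (Suc i) else a (Suc j))"

definition hochschild_d ::
    "('k::field, 'a) module \<Rightarrow> ('a \<Rightarrow> 'k) \<Rightarrow> nat \<Rightarrow> ((nat \<Rightarrow> 'a) \<Rightarrow> 'k) \<Rightarrow> (nat \<Rightarrow> 'a) \<Rightarrow> 'k" where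
  "hochschild_d A \<epsilon> n \<phi> = on_args A (Suc n) (\<lambda>a.
       \<epsilon> (a 0) * \<phi> (\<lambda>j\<in>{..<n}. a (Suc j))
     + (\<Sum>i<n. (-1) ^ Suc i * \<phi> (contract A n i a))
     + (-1) ^ Suc n * (\<phi> (restrict a {..<n}) * \<epsilon> (a n)))"

definition cup ::
    "('k::field, 'a) module \<Rightarrow> nat \<Rightarrow> nat \<Rightarrow> ((nat \<Rightarrow> 'a) \<Rightarrow> 'k) \<Rightarrow> ((nat \<Rightarrow> 'a) \<Rightarrow> 'k)
      \<Rightarrow> (nat \<Rightarrow> 'a) \<Rightarrow> 'k" where
  "cup A p q \<phi> \<psi> = on_args A (p + q) (\<lambda>a.
     \<phi> (restrict a {..<p}) * \<psi> (\<lambda>j\<in>{..<q}. a (p + j)))"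

text \<open>
  The total cochain algebra \<open>\<Oplus>\<^sub>n C\<^sup>n\<close>: its elements are the families \<open>\<Phi>\<close> with
  \<open>\<Phi> n \<in> C\<^sup>n\<close> and almost all \<open>\<Phi> n\<close> zero.
\<close>

definition cochain_algebra ::
    "('k::field, 'a) module \<Rightarrow> 'a topology \<Rightarrow> ('k, nat \<Rightarrow> (nat \<Rightarrow> 'a) \<Rightarrow> 'k) module" where
  "cochain_algebra A T =
    \<lparr>carrier = {\<Phi>. (\<forall>n. \<Phi> n \<in> cts_cochains A T n) \<and> finite {n. \<Phi> n \<noteq> (\<lambda>a. 0)}},
     monoid.mult = (\<lambda>\<Phi> \<Psi> n a. \<Sum>p\<le>n. cup A p (n - p) (\<Phi> p) (\<Psi> (n - p)) a),
     monoid.one = (\<lambda>n. if n = 0 then on_args A 0 (\<lambda>a. 1) else (\<lambda>a. 0)),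
     ring.zero = (\<lambda>n a. 0),
     ring.add = (\<lambda>\<Phi> \<Psi> n a. \<Phi> n a + \<Psi> n a),
     smult = (\<lambda>c \<Phi> n a. c * \<Phi> n a)\<rparr>"

definition total_d ::
    "('k::field, 'a) module \<Rightarrow> ('a \<Rightarrow> 'k) \<Rightarrow> (nat \<Rightarrow> (nat \<Rightarrow> 'a) \<Rightarrow> 'k)
      \<Rightarrow> nat \<Rightarrow> (nat \<Rightarrow> 'a) \<Rightarrow> 'k" where
  "total_d A \<epsilon> \<Phi> n = (case n of 0 \<Rightarrow> (\<lambda>a. 0) | Suc m \<Rightarrow> hochschild_d A \<epsilon> m (\<Phi> m))"

definition cocycle_algebra ::
    "('k::field, 'a) module \<Rightarrow> 'a topology \<Rightarrow> ('a \<Rightarrow> 'k)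
      \<Rightarrow> ('k, nat \<Rightarrow> (nat \<Rightarrow> 'a) \<Rightarrow> 'k) module" where
  "cocycle_algebra A T \<epsilon> = (cochain_algebra A T)
     \<lparr>carrier := {\<Phi> \<in> carrier (cochain_algebra A T). total_d A \<epsilon> \<Phi> = (\<lambda>n a. 0)}\<rparr>"

definition coboundaries ::
    "('k::field, 'a) module \<Rightarrow> 'a topology \<Rightarrow> ('a \<Rightarrow> 'k) \<Rightarrow> (nat \<Rightarrow> (nat \<Rightarrow> 'a) \<Rightarrow> 'k) set" where
  "coboundaries A T \<epsilon> = total_d A \<epsilon> ` carrier (cochain_algebra A T)"

text \<open>
  The cohomology algebra is the quotient ring of the cocycles by the coboundaries; the scalar
  multiplication on cosets is given on representatives, in the same way as
  \<^const>\<open>rcoset_mult\<close> gives the product.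
\<close>

definition HH_cts ::
    "('k::field, 'a) module \<Rightarrow> 'a topology \<Rightarrow> ('a \<Rightarrow> 'k)
      \<Rightarrow> ('k, (nat \<Rightarrow> (nat \<Rightarrow> 'a) \<Rightarrow> 'k) set) module" where
  "HH_cts A T \<epsilon> =
    (let Z = cocycle_algebra A T \<epsilon>; B = coboundaries A T \<epsilon> in
     ring.extend (Z Quot B)
       (module.fields (\<lambda>c U. \<Union>\<Phi>\<in>U. B +>\<^bsub>Z\<^esub> (c \<odot>\<^bsub>Z\<^esub> \<Phi>))))"

definition HH_cts_degree ::
    "('k::field, 'a) module \<Rightarrow> 'a topology \<Rightarrow> ('a \<Rightarrow> 'k)
      \<Rightarrow> nat \<Rightarrow> (nat \<Rightarrow> (nat \<Rightarrow> 'a) \<Rightarrow> 'k) set set" where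
  "HH_cts_degree A T \<epsilon> n =
    (let Z = cocycle_algebra A T \<epsilon> in
     {coboundaries A T \<epsilon> +>\<^bsub>Z\<^esub> \<Phi> |\<Phi>. \<Phi> \<in> carrier Z \<and> (\<forall>m. m \<noteq> n \<longrightarrow> \<Phi> m = (\<lambda>a. 0))})"


section \<open>Graded commutative algebras and generators\<close>

abbreviation scalars :: "'k::field ring" where
  "scalars \<equiv> ring_of_type_algebra"

text \<open>The library locale \<^locale>\<open>algebra\<close> cannot be used, as it asks for a commutative ring.\<close>

definition graded_algebra :: "('k::field, 'a) module \<Rightarrow> (nat \<Rightarrow> 'a set) \<Rightarrow> bool" where
  "graded_algebra H G \<longleftrightarrow>
     ring H \<and> Module.module scalars H \<and>
     (\<forall>c. \<forall>x\<in>carrier H. \<forall>y\<in>carrier H.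
        (c \<odot>\<^bsub>H\<^esub> x) \<otimes>\<^bsub>H\<^esub> y = c \<odot>\<^bsub>H\<^esub> (x \<otimes>\<^bsub>H\<^esub> y) \<and>
        x \<otimes>\<^bsub>H\<^esub> (c \<odot>\<^bsub>H\<^esub> y) = c \<odot>\<^bsub>H\<^esub> (x \<otimes>\<^bsub>H\<^esub> y)) \<and>
     (\<forall>n. submodule (G n) scalars H) \<and>
     (\<forall>x\<in>carrier H. \<exists>!h. (\<forall>n. h n \<in> G n) \<and> finite {n. h n \<noteq> \<zero>\<^bsub>H\<^esub>} \<and>
        x = finsum H h {n. h n \<noteq> \<zero>\<^bsub>H\<^esub>}) \<and>
     \<one>\<^bsub>H\<^esub> \<in> G 0 \<and>
     (\<forall>p q. \<forall>x\<in>G p. \<forall>y\<in>G q. x \<otimes>\<^bsub>H\<^esub> y \<in> G (p + q))"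

definition graded_commutative :: "('k::field, 'a) module \<Rightarrow> (nat \<Rightarrow> 'a set) \<Rightarrow> bool" where
  "graded_commutative H G \<longleftrightarrow>
     (\<forall>p q. \<forall>x\<in>G p. \<forall>y\<in>G q.
        x \<otimes>\<^bsub>H\<^esub> y = (\<ominus>\<^bsub>H\<^esub> \<one>\<^bsub>H\<^esub>) [^]\<^bsub>H\<^esub> (p * q) \<otimes>\<^bsub>H\<^esub> (y \<otimes>\<^bsub>H\<^esub> x))"

definition generates_algebra :: "('k::field, 'a) module \<Rightarrow> 'a set \<Rightarrow> bool" where
  "generates_algebra H S \<longleftrightarrow>
     S \<subseteq> carrier H \<and>
     (\<forall>B. subring B H \<and> submodule B scalars H \<and> S \<subseteq> B \<longrightarrow> B = carrier H)"

text \<open>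
  An infinite countable set of homogeneous generators none of which can be omitted.  Without
  the last condition every finitely generated algebra with infinite carrier could qualify,
  by adding redundant generators.
\<close>

definition countably_many_generators :: "('k::field, 'a) module \<Rightarrow> (nat \<Rightarrow> 'a set) \<Rightarrow> bool" where
  "countably_many_generators H G \<longleftrightarrow>
     (\<exists>S. countable S \<and> infinite S \<and> S \<subseteq> (\<Union>n. G n) \<and> generates_algebra H S \<and>
          (\<forall>S'. S' \<subset> S \<longrightarrow> \<not> generates_algebra H S'))"

end

theory Submission
  imports Defs
begin

text \<open>
  A continuous multilinear form on tuples of formal Dirichlet series depends on finitely many
  coefficients only, because the basic neighbourhoods of \<open>0\<close> are the series whose first \<open>N\<close>
  coefficients vanish.  It is therefore a finite linear combination of the monomials
  \<open>(a\<^sub>0, \<dots>, a\<^sub>n\<^sub>-\<^sub>1) \<mapsto> a\<^sub>0(m\<^sub>0) \<cdots> a\<^sub>n\<^sub>-\<^sub>1(m\<^sub>n\<^sub>-\<^sub>1)\<close>, which are indexed by the words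
  \<open>m\<^sub>0 \<dots> m\<^sub>n\<^sub>-\<^sub>1\<close> in the positive integers.  In these coordinates (\<open>cochain_of\<close>) the continuous
  Hochschild complex becomes the cobar complex of the Dirichlet coalgebra: finitely supported
  functions on words, the product dual to cutting words in two (\<open>conv\<close>), and a differential
  (\<open>cobar\<close>) that multiplies neighbouring letters.

  By unique factorisation the coalgebra is dual to a power series algebra in the primes, so the
  cohomology ought to be the exterior algebra on one class of degree \<open>1\<close> for each prime.  The
  theorem follows from three facts, none of which needs a basis of the cohomology.

  \<^item> Every cocycle is cohomologous to a combination of words whose letters are primes
    (\<open>cocycle_prime_words\<close>).  Hence the classes of the one-letter words \<open>[p]\<close> generate.

  \<^item> The sum of the words \<open>[p, q]\<close> and \<open>[q, p]\<close> is up to a factor the coboundary of \<open>[pq]\<close>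
    (\<open>prime_letters_anticommute\<close>).  So the generators anticommute, and graded commutativity of
    the whole algebra follows with the first fact (\<open>homogeneous_graded_commute\<close>).

  \<^item> Coboundaries vanish on one-letter words.  So the coefficient of \<open>[p]\<close> is an invariant of a
    cohomology class, and the classes for which it is \<open>0\<close> form a subalgebra that contains the
    classes of all other primes: no generator can be omitted (\<open>prime_class_needed\<close>).

  The first fact is the substantial one.  It is proved by an acyclic matching in the sense of
  discrete Morse theory.  Read a word from the left through strictly decreasing primes
  \<open>p\<^sub>1 > p\<^sub>2 > \<dots> > p\<^sub>j\<close> until a letter \<open>m\<close> breaks the pattern.  If \<open>m\<close> is composite and its least
  prime factor \<open>q\<close> is smaller than \<open>p\<^sub>j\<close> (no condition for \<open>j = 0\<close>),
  the word is matched with the longer word in which \<open>m\<close> is replaced by \<open>q, m/q\<close>; if \<open>m \<noteq> 1\<close> and \<open>q \<ge> p\<^sub>j\<close>, it is matched with the shorter word in which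
  \<open>p\<^sub>j, m\<close> is replaced by \<open>p\<^sub>j m\<close>; a run of letters \<open>1\<close> is lengthened or shortened by one according
  to the parity of its length.  Unmatched words consist of decreasing primes.  With respect to the
  lexicographic order the matrix of the differential between matched words is triangular with
  diagonal entries \<open>\<plusminus>1\<close> (\<open>cobar_at_mergeable\<close>).  Solving the triangular system removes all words
  that are matched with shorter ones from a given cochain; for a cocycle, uniqueness of the
  solution then shows that no word matched with a longer one is left either.
\<close>

section \<open>The cobar complex on words\<close>

text \<open>
  The Hochschild differential in coordinates.  The value at a word is the alternating sum over its
  faces, which delete a leading \<open>1\<close>, multiply two neighbouring letters, or delete a final \<open>1\<close>.  Apart
  from the faces of the first two letters the sum is minus the differential of \<open>\<lambda>w. f (x # w)\<close>, except
  that the latter also deletes a leading \<open>y = 1\<close>; the second term makes up for this.  On one-letter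
  words the two deletions cancel.
\<close>

fun cobar :: "(nat list \<Rightarrow> 'k::comm_ring_1) \<Rightarrow> nat list \<Rightarrow> 'k" where
  "cobar f [] = 0"
| "cobar f [x] = 0"
| "cobar f (x # y # r) =
     of_bool (x = 1) * f (y # r) + of_bool (y = 1) * f (x # r) - f (x * y # r)
       - cobar (\<lambda>w. f (x # w)) (y # r)"

text \<open>
  The cup product in coordinates, which cuts words in two.
\<close>

fun conv :: "(nat list \<Rightarrow> 'k::comm_ring_1) \<Rightarrow> (nat list \<Rightarrow> 'k) \<Rightarrow> nat list \<Rightarrow> 'k" where
  "conv f g [] = f [] * g []"
| "conv f g (x # r) = f [] * g (x # r) + conv (\<lambda>w. f (x # w)) g r"

lemma cobar_cong: "(\<And>v. v \<noteq> [] \<Longrightarrow> f v = g v) \<Longrightarrow> cobar f w = cobar g w"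
proof (induction f w arbitrary: g rule: cobar.induct)
  case (3 f x y r)
  have "cobar (\<lambda>w. f (x # w)) (y # r) = cobar (\<lambda>w. g (x # w)) (y # r)"
    by (rule "3.IH") (simp add: "3.prems")
  then show ?case by (simp add: "3.prems")
qed auto

lemma cobar_add: "cobar (\<lambda>w. f w + g w) w = cobar f w + cobar g w"
proof (induction w arbitrary: f g)
  case (Cons x w)
  show ?case
  proof (cases w)
    case (Cons y r)
    show ?thesis
      unfolding Cons cobar.simps Cons.IH[of "\<lambda>w. f (x # w)", unfolded Cons]
      by (simp add: algebra_simps)
  qed simp
qed simp

lemma cobar_scale: "cobar (\<lambda>w. c * f w) w = c * cobar f w"
  by (induction f w rule: cobar.induct) (simp_all add: algebra_simps)

lemma cobar_diff: "cobar (\<lambda>w. f w - g w) w = cobar f w - cobar g w"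
  using cobar_add[of f "\<lambda>w. - 1 * g w" w] by (simp only: cobar_scale) simp

lemma cobar_zero [simp]: "cobar (\<lambda>w. 0) w = 0"
  using cobar_scale[of 0 "\<lambda>w. 0" w] by simp

text \<open>
  The section \<open>\<lambda>u. cobar f (x # u)\<close> is itself a sum of sections of \<open>f\<close> and of the differential of a
  section.  Induction disposes of the latter, and the faces of the first three letters cancel.
\<close>

lemma cobar_cobar: "cobar (cobar f) w = 0"
proof (induction w arbitrary: f)
  case (Cons x w)
  show ?case
  proof (cases w)
    case Nil then show ?thesis by simp
  next
    case (Cons y v)
    show ?thesis
    proof (cases v)
      case Nil then show ?thesis using Cons by simp
    next
      case (Cons z r)
      have w: "w = y # z # r" using Cons \<open>w = y # v\<close> by simp
      \<comment> \<open>the recursion for non-empty \<open>u\<close>; by \<open>cobar_cong\<close> the value at the empty word does not matter\<close>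
      let ?g = "\<lambda>u. of_bool (x = 1) * f u + of_bool (hd u = 1) * f (x # tl u)
                  - f (x * hd u # tl u) - cobar (\<lambda>v. f (x # v)) u"
      have "cobar (\<lambda>u. cobar f (x # u)) w = cobar ?g w"
      proof (rule cobar_cong)
        fix u :: "nat list" assume "u \<noteq> []"
        then show "cobar f (x # u) = ?g u" by (cases u) auto
      qed
      also have "\<dots> = of_bool (x = 1) * cobar f w + cobar (\<lambda>u. of_bool (hd u = 1) * f (x # tl u)) w
                  - cobar (\<lambda>u. f (x * hd u # tl u)) w - cobar (cobar (\<lambda>v. f (x # v))) w"
        by (simp add: cobar_add cobar_diff cobar_scale)
      finally have "cobar (\<lambda>u. cobar f (x # u)) w = of_bool (x = 1) * cobar f w
                  + cobar (\<lambda>u. of_bool (hd u = 1) * f (x # tl u)) w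
                  - cobar (\<lambda>u. f (x * hd u # tl u)) w" using Cons.IH by simp
      then show ?thesis
        by (auto simp: w cobar_scale algebra_simps)
    qed
  qed
qed simp

lemma conv_add_left: "conv (\<lambda>w. f w + g w) h w = conv f h w + conv g h w"
  by (induction w arbitrary: f g) (simp_all add: algebra_simps)

lemma conv_add_right: "conv h (\<lambda>w. f w + g w) w = conv h f w + conv h g w"
  by (induction w arbitrary: h) (simp_all add: algebra_simps)

lemma conv_diff_left: "conv (\<lambda>w. f w - g w) h w = conv f h w - conv g h w"
  by (induction w arbitrary: f g) (simp_all add: algebra_simps)

lemma conv_diff_right: "conv h (\<lambda>w. f w - g w) w = conv h f w - conv h g w"
  by (induction w arbitrary: h) (simp_all add: algebra_simps)

lemma conv_scale_left: "conv (\<lambda>w. c * f w) h w = c * conv f h w"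
  by (induction w arbitrary: f) (simp_all add: algebra_simps)

lemma conv_scale_right: "conv h (\<lambda>w. c * f w) w = c * conv h f w"
  by (induction w arbitrary: h) (simp_all add: algebra_simps)

lemma conv_zero_left [simp]: "conv (\<lambda>w. 0) h w = 0"
  by (induction w) simp_all

lemma conv_zero_right [simp]: "conv h (\<lambda>w. 0) w = 0"
  by (induction w arbitrary: h) simp_all

lemma conv_assoc: "conv (conv f g) h w = conv f (conv g h) w"
  by (induction w arbitrary: f)
    (simp_all add: conv_add_left conv_scale_left algebra_simps)

definition unit_word_fun :: "nat list \<Rightarrow> 'k::comm_ring_1" where
  "unit_word_fun w = of_bool (w = [])"

lemma conv_unit_left: "conv unit_word_fun f w = f w"
  by (cases w) (simp_all add: unit_word_fun_def)

lemma conv_unit_right: "conv f unit_word_fun w = f w"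
  by (induction w arbitrary: f) (simp_all add: unit_word_fun_def)

definition sign_twist :: "(nat list \<Rightarrow> 'k::comm_ring_1) \<Rightarrow> nat list \<Rightarrow> 'k" where
  "sign_twist f w = (-1) ^ length w * f w"

lemma sign_twist_Cons: "(\<lambda>w. sign_twist f (x # w)) = (\<lambda>w. - 1 * sign_twist (\<lambda>w. f (x # w)) w)"
  by (simp add: sign_twist_def fun_eq_iff)

text \<open>
  The Leibniz rule: the sign in the second term is the parity of the length of the left factor.
\<close>

lemma cobar_conv: "cobar (conv f g) w = conv (cobar f) g w + conv (sign_twist f) (cobar g) w"
proof (induction w arbitrary: f)
  case (Cons x w)
  show ?case
  proof (cases w)
    case Nil then show ?thesis by simp
  next
    case (Cons y r)
    let ?fx = "\<lambda>w. f (x # w)"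
    let ?fxy = "\<lambda>w. f (x * y # w)"
    have 1: "cobar (\<lambda>w. conv f g (x # w)) (y # r) =
       f [] * cobar (\<lambda>w. g (x # w)) (y # r) + (conv (cobar ?fx) g (y # r)
         + conv (sign_twist ?fx) (cobar g) (y # r))"
      using Cons.IH[of ?fx] by (simp add: cobar_add cobar_scale Cons)
    have 2: "conv (\<lambda>w. cobar f (x # y # w)) g r =
        of_bool (x = 1) * conv (\<lambda>w. f (y # w)) g r + of_bool (y = 1) * conv ?fx g r - conv ?fxy g r
        - conv (\<lambda>w. cobar ?fx (y # w)) g r"
      by (simp add: conv_add_left conv_diff_left conv_scale_left)
    have 3: "conv (\<lambda>w. sign_twist f (x # w)) (cobar g) (y # r) = - conv (sign_twist ?fx) (cobar g) (y # r)"
      by (simp only: sign_twist_Cons conv_scale_left) simp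
    have "cobar (conv f g) (x # w) = of_bool (x = 1) * conv f g (y # r) + of_bool (y = 1) * conv f g (x # r)
       - conv f g (x * y # r) - cobar (\<lambda>w. conv f g (x # w)) (y # r)"
      by (simp only: cobar.simps Cons)
    also have "\<dots> = f [] * cobar g (x # y # r) + conv (\<lambda>w. cobar f (x # y # w)) g r
       - conv (sign_twist ?fx) (cobar g) (y # r)"
      unfolding 1 2 by (simp add: algebra_simps)
    also have "\<dots> = conv (cobar f) g (x # w) + conv (sign_twist f) (cobar g) (x # w)"
    proof -
      have "conv (cobar f) g (x # w) = conv (\<lambda>w. cobar f (x # y # w)) g r" by (simp add: Cons)
      moreover have "conv (sign_twist f) (cobar g) (x # w)
         = f [] * cobar g (x # y # r) - conv (sign_twist ?fx) (cobar g) (y # r)"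
        unfolding Cons by (subst conv.simps, subst 3) (simp add: sign_twist_def)
      ultimately show ?thesis by simp
    qed
    finally show ?thesis .
  qed
qed simp

section \<open>An acyclic matching on words\<close>

abbreviation is_prime :: "nat \<Rightarrow> bool" where "is_prime \<equiv> Factorial_Ring.prime"

text \<open>
  With \<open>p\<close> prime this says that \<open>p\<close> is the least prime factor of \<open>p * m\<close>, so that \<open>p * m\<close>
  splits back into \<open>p\<close> and \<open>m\<close>.
\<close>

definition rough :: "nat \<Rightarrow> nat \<Rightarrow> bool" where
  "rough p m \<longleftrightarrow> (\<forall>q. is_prime q \<longrightarrow> q dvd m \<longrightarrow> p \<le> q)"

definition least_prime :: "nat \<Rightarrow> nat" where
  "least_prime m = (LEAST p. is_prime p \<and> p dvd m)"

text \<open>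
  The maximal initial run of letters \<open>1\<close> has odd length.
\<close>

fun odd_ones :: "nat list \<Rightarrow> bool" where
  "odd_ones [] = False"
| "odd_ones (x # r) = (x = 1 \<and> \<not> odd_ones r)"

text \<open>
  Words that are matched with a shorter word.  The recursion finds the letter that breaks the pattern
  of decreasing primes: \<open>y\<close> is merged into a prime \<open>x\<close> in front of it if this can be undone by
  splitting off the least prime factor, and otherwise the word from \<open>y\<close> on decides.  The letter \<open>1\<close> is
  excluded from merging because runs of ones are matched among themselves, odd runs with the next
  longer even ones.
\<close>

fun mergeable :: "nat list \<Rightarrow> bool" where
  "mergeable [] = False"
| "mergeable [x] = False"
| "mergeable (x # y # r) = (if x = 1 then odd_ones (y # r)
     else is_prime x \<and> (y \<noteq> 1 \<and> rough x y \<or> mergeable (y # r)))"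

text \<open>
  Words that are matched with a longer word, found by the same recursion.
\<close>

fun splittable :: "nat list \<Rightarrow> bool" where
  "splittable [] = False"
| "splittable [x] = (\<not> is_prime x)"
| "splittable (x # y # r) = (if x = 1 then \<not> odd_ones (y # r)
     else \<not> is_prime x \<or> \<not> (y \<noteq> 1 \<and> rough x y) \<and> splittable (y # r))"

fun merge_word :: "nat list \<Rightarrow> nat list" where
  "merge_word (x # y # r) = (if x = 1 then y # r
     else if y \<noteq> 1 \<and> rough x y then x * y # r else x # merge_word (y # r))"
| "merge_word w = w"

fun split_word :: "nat list \<Rightarrow> nat list" where
  "split_word [] = []"
| "split_word (x # r) = (if x = 1 then 1 # 1 # r
     else if is_prime x then x # split_word r else least_prime x # x div least_prime x # r)"

lemma least_prime:
  assumes "m \<noteq> 1" shows "is_prime (least_prime m)" "least_prime m dvd m"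
    "\<And>q. is_prime q \<Longrightarrow> q dvd m \<Longrightarrow> least_prime m \<le> q"
proof -
  from assms obtain p where "is_prime p \<and> p dvd m" using prime_factor_nat by blast
  from LeastI[of "\<lambda>p. is_prime p \<and> p dvd m", OF this]
  show "is_prime (least_prime m)" "least_prime m dvd m" unfolding least_prime_def by auto
  show "least_prime m \<le> q" if "is_prime q" "q dvd m" for q
    unfolding least_prime_def using that by (intro Least_le) auto
qed

text \<open>
  This is what makes splitting inverse to merging.
\<close>

lemma least_prime_mult:
  assumes "is_prime x" "rough x y" shows "least_prime (x * y) = x"
proof -
  have ne: "x * y \<noteq> 1" using assms by auto
  note L = least_prime[OF ne]
  have "least_prime (x * y) \<le> x" using L(3)[of x] assms by simp
  moreover have "least_prime (x * y) dvd x \<or> least_prime (x * y) dvd y"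
    using L(1,2) prime_dvd_mult_iff by blast
  then have "x \<le> least_prime (x * y)"
    using assms L(1) unfolding rough_def by (metis order_refl primes_dvd_imp_eq)
  ultimately show ?thesis by simp
qed

lemma not_prime_mult: "is_prime x \<Longrightarrow> y \<noteq> 1 \<Longrightarrow> \<not> is_prime (x * y)"
  using prime_product[of x y] by auto

text \<open>
  Unmatched words even have strictly decreasing letters, but only their primality matters below.
\<close>

lemma mergeable_or_splittable_or_primes:
  "mergeable w \<or> splittable w \<or> (\<forall>x\<in>set w. is_prime x)"
  by (induction w rule: mergeable.induct) auto

lemma not_mergeable_and_splittable: "mergeable w \<Longrightarrow> \<not> splittable w"
  by (induction w rule: mergeable.induct) (auto split: if_splits)

text \<open>
  A merge deep inside the word may change the letter next to an earlier prime, but only to a multiple;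
  so the earlier prime still cannot absorb it.
\<close>

lemma merge_mergeable_hd:
  assumes "mergeable (y # r)"
  obtains h t where "merge_word (y # r) = h # t" "y dvd h" "y = 1 \<Longrightarrow> h = 1"
proof (cases r)
  case Nil then show ?thesis using assms by simp
next
  case (Cons z r')
  show ?thesis
  proof (cases "y = 1")
    case True
    then have "merge_word (y # r) = z # r'" "z = 1" using assms Cons by auto
    then show ?thesis using True that by simp
  next
    case False then show ?thesis using that Cons by (cases "z \<noteq> 1 \<and> rough y z") auto
  qed
qed

lemma rough_dvd: "rough x h \<Longrightarrow> y dvd h \<Longrightarrow> rough x y"
  unfolding rough_def by (meson dvd_trans)

lemma merge_mergeable:
  assumes "mergeable b" "0 \<notin> set b"
  shows "splittable (merge_word b) \<and> split_word (merge_word b) = b"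
  using assms
proof (induction b rule: mergeable.induct)
  case (3 x y r)
  consider "x = 1" | "x \<noteq> 1" "y \<noteq> 1" "rough x y" | "x \<noteq> 1" "\<not> (y \<noteq> 1 \<and> rough x y)" by blast
  then show ?case
  proof cases
    case 1
    then have "y = 1" "\<not> odd_ones r" using "3.prems" by auto
    then show ?thesis using 1 by (cases r) auto
  next
    case 2
    then have p: "is_prime x" using "3.prems" by auto
    have np: "\<not> is_prime (x * y)" using not_prime_mult[OF p 2(2)] .
    have "x * y \<noteq> 1" using 2 by simp
    then show ?thesis using 2 p np "3.prems" least_prime_mult[OF p 2(3)]
      by (cases r) (auto simp: prime_gt_0_nat)
  next
    case 3
    then have p: "is_prime x" and u: "mergeable (y # r)" using "3.prems" by auto
    have IH: "splittable (merge_word (y # r)) \<and> split_word (merge_word (y # r)) = y # r"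
      using "3.IH"[OF 3(1)] "3.prems" u by auto
    obtain h t where ht: "merge_word (y # r) = h # t" "y dvd h" "y = 1 \<Longrightarrow> h = 1"
      using merge_mergeable_hd[OF u] by metis
    have "\<not> (h \<noteq> 1 \<and> rough x h)" using 3(2) ht rough_dvd by blast
    moreover have m: "merge_word (x # y # r) = x # h # t" using 3 ht by auto
    ultimately show ?thesis using 3(1) p IH unfolding m by (auto simp: ht(1))
  qed
qed auto

lemma split_word_splittable:
  assumes "splittable a" "0 \<notin> set a"
  shows "mergeable (split_word a) \<and> merge_word (split_word a) = a \<and> 0 \<notin> set (split_word a)"
  using assms
proof (induction a)
  case (Cons x a)
  consider "x = 1" | "x \<noteq> 1" "\<not> is_prime x" | "x \<noteq> 1" "is_prime x" by blast
  then show ?case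
  proof cases
    case 1
    then have "\<not> odd_ones a" using Cons.prems by (cases a) auto
    then show ?thesis using 1 Cons.prems by auto
  next
    case 2
    note L = least_prime[OF 2(1)]
    define q where "q = least_prime x"
    define y where "y = x div q"
    have x: "x = q * y" using L(2) by (simp add: q_def y_def)
    have q: "is_prime q" "q \<noteq> 1" "q \<noteq> 0" using L(1) unfolding q_def by auto
    have y1: "y \<noteq> 1" proof
      assume "y = 1"
      then have "x = q" using x by simp
      then show False using 2 q by simp
    qed
    have y0: "y \<noteq> 0" proof
      assume "y = 0"
      then have "x = 0" using x by simp
      then show False using Cons.prems by simp
    qed
    have "y dvd x" by (subst x) simp
    then have r: "rough q y" unfolding rough_def q_def using L(3) dvd_trans by blast
    have s: "split_word (x # a) = q # y # a" using 2 by (simp add: q_def y_def)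
    show ?thesis unfolding s using y1 r q y0 Cons.prems by (simp add: x[symmetric])
  next
    case 3
    obtain h t where a: "a = h # t" using 3 Cons.prems by (cases a) auto
    have la: "splittable a" and nr: "\<not> (h \<noteq> 1 \<and> rough x h)" using 3 Cons.prems a by auto
    have IH: "mergeable (split_word a)" "merge_word (split_word a) = a" "0 \<notin> set (split_word a)"
      using Cons la by auto
    have "\<exists>q t'. split_word a = q # t' \<and> \<not> (q \<noteq> 1 \<and> rough x q)"
    proof (cases "h = 1 \<or> is_prime h")
      case True then show ?thesis using nr a by auto
    next
      case False
      then have h: "h \<noteq> 1" "\<not> is_prime h" by auto
      then obtain p where p: "is_prime p" "p dvd h" "p < x"
        using nr unfolding rough_def not_le[symmetric] by blast
      have "least_prime h < x" using least_prime(3)[OF h(1) p(1,2)] p by simp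
      then have "\<not> rough x (least_prime h)"
        unfolding rough_def using least_prime(1)[OF h(1)] by (metis dvd_refl not_le)
      then show ?thesis using h a by auto
    qed
    then obtain q t' where q: "split_word a = q # t'" "\<not> (q \<noteq> 1 \<and> rough x q)" by blast
    then show ?thesis using 3 IH Cons.prems q by (cases t') auto
  qed
qed auto

lemma cobar_vanish_off_one:
  assumes "\<And>v. v \<noteq> [] \<Longrightarrow> hd v \<noteq> 1 \<Longrightarrow> k v = 0" "w \<noteq> []" "hd w \<noteq> 1"
  shows "cobar k w = 0"
proof (cases w rule: mergeable.cases)
  case (3 x y r)
  then have "(\<lambda>v. k (x # v)) = (\<lambda>v. 0)" using assms by auto
  then show ?thesis using 3 assms by simp
qed auto

text \<open>
  All faces that multiply or delete within the initial run of ones are the same word, and as the run is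
  odd their signs cancel.  The other faces keep the run, where \<open>h\<close> vanishes.
\<close>

lemma cobar_odd_ones:
  assumes "\<And>u. odd_ones u \<Longrightarrow> h u = 0" "odd_ones w"
  shows "cobar h w = 0"
  using assms
proof (induction w arbitrary: h rule: length_induct)
  case (1 w)
  obtain v where w: "w = 1 # v" "\<not> odd_ones v" using "1.prems"(2) by (cases w) auto
  show ?case
  proof (cases v)
    case (Cons y r)
    show ?thesis
    proof (cases "y = 1")
      case False
      have "cobar (\<lambda>u. h (1 # u)) (y # r) = 0"
      proof (rule cobar_vanish_off_one)
        fix u :: "nat list" assume "u \<noteq> []" "hd u \<noteq> 1"
        then show "h (1 # u) = 0" by (intro "1.prems"(1)) (cases u; simp)
      qed (use False in auto)
      then show ?thesis using w Cons False by simp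
    next
      case True
      then have r: "odd_ones r" using w Cons by simp
      then obtain s where s: "r = 1 # s" by (cases r) auto
      have "cobar (\<lambda>u. h (1 # 1 # u)) r = 0"
        by (rule "1.IH"[rule_format]) (use r w Cons "1.prems"(1) in auto)
      then show ?thesis using w Cons True s by simp
    qed
  qed (use w in simp)
qed

text \<open>
  Triangularity of the matching.  Suppose that \<open>f\<close> vanishes on mergeable words and consider the faces of
  \<open>b\<close>.  The face \<open>merge_word b\<close> contributes the right-hand side; if a run of ones is
  shortened, it occurs an odd number of times with alternating signs.  A face that multiplies two primes
  \<open>p > q\<close> further left, or that multiplies the letters after the merged pair so that the product gets a
  smaller prime factor, is splittable, and splitting it brings a smaller letter to an earlier position
  than in \<open>b\<close>: its partner precedes \<open>b\<close> lexicographically.  Every other face is mergeable.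
\<close>

lemma cobar_at_mergeable:
  assumes "mergeable b" "0 \<notin> set b"
    and "\<And>u. mergeable u \<Longrightarrow> f u = 0"
    and "\<And>a. splittable a \<Longrightarrow> (split_word a, b) \<in> lex less_than \<Longrightarrow> f a = 0"
  shows "\<exists>s. s * s = 1 \<and> cobar f b = s * f (merge_word b)"
  using assms
proof (induction b arbitrary: f rule: mergeable.induct)
  case (3 x y r)
  note f0 = "3.prems"(3) and f1 = "3.prems"(4)
  consider "x = 1" | "x \<noteq> 1" "y \<noteq> 1" "rough x y" | "x \<noteq> 1" "\<not> (y \<noteq> 1 \<and> rough x y)" by blast
  then show ?case
  proof cases
    case 1
    then have o: "odd_ones (y # r)" and y: "y = 1" using "3.prems" by auto
    \<comment> \<open>the faces of the first two letters are \<open>y # r\<close> three times, and one copy survives\<close>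
    have "cobar (\<lambda>w. f (1 # w)) (y # r) = 0"
    proof (rule cobar_odd_ones)
      fix u assume "odd_ones u" then show "f (1 # u) = 0" by (intro f0) (cases u; simp)
    qed (rule o)
    then show ?thesis using 1 y by (intro exI[of _ 1]) simp
  next
    case 2
    then have p: "is_prime x" using "3.prems" by auto
    have "cobar (\<lambda>w. f (x # w)) (y # r) = 0"
    proof (cases r)
      case (Cons z r')
      have 0: "f (x # y # v) = 0" for v by (rule f0) (use 2 p in auto)
      have "f (x # y * z # r') = 0"
      proof (cases "rough x (y * z)")
        case True then show ?thesis by (intro f0) (use 2 p in auto)
      next
        case False
        then have z: "z \<noteq> 1" using 2 by auto
        have yz: "\<not> is_prime (y * z)" "y * z \<noteq> 1" using 2 z prime_product by auto
        obtain q where q: "is_prime q" "q dvd y * z" "q < x" using False unfolding rough_def not_le[symmetric] by blast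
        have "x \<le> y"
          using 2 "3.prems"(2) least_prime[of y] unfolding rough_def
          by (metis dvd_imp_le le_trans list.set_intros(1,2) neq0_conv)
        then have lt: "least_prime (y * z) < y" using least_prime(3)[OF yz(2) q(1,2)] q by simp
        have "splittable (x # y * z # r')" using 2 p yz False by (cases r') auto
        then show ?thesis by (rule f1) (use 2 p yz lt Cons in auto)
      qed
      then show ?thesis using Cons 0 2 by simp
    qed simp
    then show ?thesis using 2 by (intro exI[of _ "-1"]) simp
  next
    case 3
    then have p: "is_prime x" and u: "mergeable (y # r)" using "3.prems" by auto
    have "\<exists>s. s * s = 1 \<and> cobar (\<lambda>w. f (x # w)) (y # r) = s * f (x # merge_word (y # r))"
    proof (rule "3.IH"[OF 3(1)])
      show "mergeable (y # r)" "0 \<notin> set (y # r)" using u "3.prems" by auto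
      fix v assume "mergeable v" then show "f (x # v) = 0"
        by (intro f0) (cases v; use 3 p in auto)
    next
      fix a assume a: "splittable a" "(split_word a, y # r) \<in> lex less_than"
      then obtain h t where h: "a = h # t" by (cases a) auto
      show "f (x # a) = 0"
      proof (cases "h \<noteq> 1 \<and> rough x h")
        case True then show ?thesis by (intro f0) (use h 3 p in auto)
      next
        case False
        have "splittable (x # a)" using False h a 3 p by auto
        then show ?thesis by (rule f1) (use 3 p a in auto)
      qed
    qed
    then obtain s where s: "s * s = 1" "cobar (\<lambda>w. f (x # w)) (y # r) = s * f (x # merge_word (y # r))"
      by blast
    have "of_bool (y = 1) * f (x # r) - f (x * y # r) = 0"
    proof (cases "y = 1")
      case False
      then have y: "is_prime y" "\<not> rough x y" using u 3 by (cases r; auto)+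
      then have yx: "y < x" unfolding rough_def by (metis not_le prime_nat_iff primes_dvd_imp_eq)
      have np: "\<not> is_prime (x * y)" and n1: "x * y \<noteq> 1" using not_prime_mult[OF p False] p by auto
      have "least_prime (x * y) < x" using least_prime(3)[OF n1, of y] y yx by simp
      moreover have "splittable (x * y # r)" using np n1 by (cases r) auto
      ultimately have "f (x * y # r) = 0" by (intro f1) (use np n1 in auto)
      then show ?thesis using False by simp
    qed simp
    then have "cobar f (x # y # r) = - cobar (\<lambda>w. f (x # w)) (y # r)" using 3 by simp
    moreover have "merge_word (x # y # r) = x # merge_word (y # r)" using 3 by auto
    ultimately show ?thesis using s by (intro exI[of _ "- s"]) simp
  qed
qed auto

text \<open>
  A finite set of words that contains with a word all words of the same product and of no greater
  length, as long as the letters are positive.  The differential preserves the product of the letters, so supports stay bounded.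
\<close>

definition pos_words :: "nat \<Rightarrow> nat list set" where
  "pos_words N = {w. 0 \<notin> set w \<and> prod_list w \<le> N \<and> length w \<le> N}"

definition supported :: "nat \<Rightarrow> (nat list \<Rightarrow> 'k::comm_ring_1) \<Rightarrow> bool" where
  "supported N f \<longleftrightarrow> (\<forall>w. f w \<noteq> 0 \<longrightarrow> w \<in> pos_words N)"

definition word_cochains :: "(nat list \<Rightarrow> 'k::comm_ring_1) set" where
  "word_cochains = {f. \<exists>N. supported N f}"

lemma pos_words_mono: "M \<le> N \<Longrightarrow> pos_words M \<subseteq> pos_words N"
  unfolding pos_words_def by auto

lemma supported_mono: "supported M f \<Longrightarrow> M \<le> N \<Longrightarrow> supported N f"
  using pos_words_mono unfolding supported_def by blast

lemma entry_le_prod_list: "0 \<notin> set w \<Longrightarrow> x \<in> set w \<Longrightarrow> x \<le> prod_list (w :: nat list)"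
proof (induction w)
  case (Cons y w)
  have "prod_list w \<noteq> 0" using Cons.prems by (simp add: prod_list_zero_iff)
  then have "1 \<le> prod_list w" "1 \<le> y" using Cons.prems by auto
  then show ?case using Cons
    by (auto intro: le_trans[OF _ mult_le_mono[of 1 y]] simp del: One_nat_def)
qed simp

lemma finite_pos_words: "finite (pos_words N)"
proof (rule finite_subset)
  show "pos_words N \<subseteq> {w. set w \<subseteq> {..N} \<and> length w \<le> N}"
    unfolding pos_words_def using entry_le_prod_list le_trans by blast
qed (simp add: finite_lists_length_le)

lemma word_cochainsI:
  assumes "finite {w. f w \<noteq> 0}" "\<And>w. f w \<noteq> 0 \<Longrightarrow> 0 \<notin> set w"
  shows "f \<in> word_cochains"
proof -
  define N where "N = Max ((\<lambda>w. max (prod_list w) (length w)) ` {w. f w \<noteq> 0})"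
  have "max (prod_list w) (length w) \<le> N" if "f w \<noteq> 0" for w
    unfolding N_def using assms(1) that by (intro Max_ge) auto
  then have "supported N f" unfolding supported_def pos_words_def using assms(2) by fastforce
  then show ?thesis unfolding word_cochains_def by blast
qed

lemma word_cochains_finite: "f \<in> word_cochains \<Longrightarrow> finite {w. f w \<noteq> 0}"
  unfolding word_cochains_def supported_def
  by (auto intro: finite_subset[OF _ finite_pos_words])

lemma word_cochains_pos: "f \<in> word_cochains \<Longrightarrow> f w \<noteq> 0 \<Longrightarrow> 0 \<notin> set w"
  unfolding word_cochains_def supported_def pos_words_def by auto

lemma word_cochains_common:
  assumes "f \<in> word_cochains" "g \<in> word_cochains"
  obtains N where "supported N f" "supported N g"
proof -
  from assms obtain M N where "supported M f" "supported N g" unfolding word_cochains_def by blast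
  then have "supported (max M N) f" "supported (max M N) g" by (auto intro: supported_mono)
  then show ?thesis by (rule that)
qed

lemma word_cochains_add: "f \<in> word_cochains \<Longrightarrow> g \<in> word_cochains \<Longrightarrow> (\<lambda>w. f w + g w) \<in> word_cochains"
proof -
  assume "f \<in> word_cochains" "g \<in> word_cochains"
  then obtain N where "supported N f" "supported N g" by (rule word_cochains_common)
  then have "w \<in> pos_words N" if "f w + g w \<noteq> 0" for w
    using that unfolding supported_def by (cases "f w = 0") auto
  then have "supported N (\<lambda>w. f w + g w)" unfolding supported_def by blast
  then show ?thesis unfolding word_cochains_def by blast
qed

lemma word_cochains_scale: "f \<in> word_cochains \<Longrightarrow> (\<lambda>w. c * f w) \<in> word_cochains"
proof -
  assume "f \<in> word_cochains"
  then obtain N where N: "\<And>w. f w \<noteq> 0 \<Longrightarrow> w \<in> pos_words N" unfolding word_cochains_def supported_def by blast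
  have "w \<in> pos_words N" if "c * f w \<noteq> 0" for w using N[of w] that by (cases "f w = 0") auto
  then show ?thesis unfolding word_cochains_def supported_def by blast
qed

lemma word_cochains_diff: "f \<in> word_cochains \<Longrightarrow> g \<in> word_cochains \<Longrightarrow> (\<lambda>w. f w - g w) \<in> word_cochains"
  using word_cochains_add[of f "\<lambda>w. - 1 * g w"] word_cochains_scale[of g "-1"] by simp

lemma word_cochains_zero: "(\<lambda>w. 0) \<in> word_cochains"
  unfolding word_cochains_def supported_def by auto

lemma word_cochains_unit: "unit_word_fun \<in> word_cochains"
  by (rule word_cochainsI) (auto simp: unit_word_fun_def)

text \<open>
  Faces preserve the product of a word and shorten it by one letter; a face of a word with a letter
  \<open>0\<close> has a letter \<open>0\<close>, as only letters \<open>1\<close> are deleted.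
\<close>

lemma cobar_support:
  assumes "cobar f w \<noteq> 0"
  shows "\<exists>v. f v \<noteq> 0 \<and> prod_list v = prod_list w \<and> length w = Suc (length v)
           \<and> (0 \<in> set v \<longleftrightarrow> 0 \<in> set w)"
  using assms
proof (induction f w rule: cobar.induct)
  case (3 f x y r)
  from "3.prems" consider "x = 1" "f (y # r) \<noteq> 0" | "y = 1" "f (x # r) \<noteq> 0"
    | "f (x * y # r) \<noteq> 0" | "cobar (\<lambda>w. f (x # w)) (y # r) \<noteq> 0"
    by (cases "x = 1"; cases "y = 1"; force)
  then show ?case
  proof cases
    case 4
    then obtain v where "f (x # v) \<noteq> 0" "prod_list v = prod_list (y # r)"
      "length (y # r) = Suc (length v)" "0 \<in> set v \<longleftrightarrow> 0 \<in> set (y # r)" using "3.IH" by blast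
    then show ?thesis by (intro exI[of _ "x # v"]) auto
  next
    case 1 then show ?thesis by (intro exI[of _ "y # r"]) auto
  next
    case 2 then show ?thesis by (intro exI[of _ "x # r"]) auto
  next
    case 3 then show ?thesis by (intro exI[of _ "x * y # r"]) auto
  qed
qed auto

lemma supported_cobar: "supported N f \<Longrightarrow> supported (Suc N) (cobar f)"
  unfolding supported_def pos_words_def using cobar_support by fastforce

lemma word_cochains_cobar: "f \<in> word_cochains \<Longrightarrow> cobar f \<in> word_cochains"
  unfolding word_cochains_def using supported_cobar by blast

lemma conv_support:
  assumes "conv f g w \<noteq> 0"
  shows "\<exists>u v. w = u @ v \<and> f u \<noteq> 0 \<and> g v \<noteq> 0"
  using assms
proof (induction w arbitrary: f)
  case (Cons x w)
  from Cons.prems consider "f [] \<noteq> 0" "g (x # w) \<noteq> 0" | "conv (\<lambda>v. f (x # v)) g w \<noteq> 0"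
    by fastforce
  then show ?case
  proof cases
    case 2
    from Cons.IH[OF this] show ?thesis by (metis append_Cons)
  qed fastforce
qed auto

lemma word_cochains_conv:
  assumes "f \<in> word_cochains" "g \<in> word_cochains" shows "conv f g \<in> word_cochains"
proof (rule word_cochainsI)
  have "{w. conv f g w \<noteq> 0} \<subseteq> (\<lambda>(u, v). u @ v) ` ({w. f w \<noteq> 0} \<times> {w. g w \<noteq> 0})"
    using conv_support by fastforce
  then show "finite {w. conv f g w \<noteq> 0}"
    using assms by (auto intro: finite_subset simp: word_cochains_finite)
  show "0 \<notin> set w" if "conv f g w \<noteq> 0" for w
    using conv_support[OF that] assms word_cochains_pos by fastforce
qed

definition word_fun :: "nat list \<Rightarrow> nat list \<Rightarrow> 'k::comm_ring_1" where
  "word_fun v w = of_bool (w = v)"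

lemma word_cochains_word_fun: "0 \<notin> set v \<Longrightarrow> word_fun v \<in> word_cochains"
  by (rule word_cochainsI) (auto simp: word_fun_def)

lemma trans_lex_less: "trans (lex (less_than :: (nat \<times> nat) set))"
  by (rule lex_transI) simp

lemma not_sym_lex: "(u, v) \<in> lex less_than \<Longrightarrow> (v, u) \<notin> lex (less_than :: (nat \<times> nat) set)"
  by (meson wf_less_than wf_lex wf_not_sym)

section \<open>Cocycles are cohomologous to combinations of prime words\<close>

text \<open>
  Elimination along the triangular system.  Let \<open>b\<close> be a lexicographically minimal mergeable word in the
  support.  Subtracting a multiple of the coboundary of its partner removes \<open>b\<close>, and by triangularity
  it changes the values at other mergeable words only if they come after \<open>b\<close>.  The set of mergeable words
  that are not before the support shrinks, and it is finite since \<open>pos_words N\<close> is.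
\<close>

lemma clear_mergeable_within:
  fixes f :: "nat list \<Rightarrow> 'k::comm_ring_1"
  assumes "supported N f"
  shows "\<exists>h\<in>word_cochains. \<forall>b. mergeable b \<longrightarrow> f b = cobar h b"
  using assms
proof (induction "card {b \<in> pos_words N. mergeable b \<and>
    (\<exists>c. mergeable c \<and> f c \<noteq> 0 \<and> (c = b \<or> (c, b) \<in> lex less_than))}"
    arbitrary: f rule: less_induct)
  case less
  let ?M = "\<lambda>f. {b \<in> pos_words N. mergeable b \<and>
    (\<exists>c. mergeable c \<and> f c \<noteq> 0 \<and> (c = b \<or> (c, b) \<in> lex less_than))}"
  show ?case
  proof (cases "\<exists>b. mergeable b \<and> f b \<noteq> 0")
    case False
    then show ?thesis by (intro bexI[of _ "\<lambda>w. 0"]) (auto simp: word_cochains_zero)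
  next
    case True
    then obtain b0 where b0: "b0 \<in> {b. mergeable b \<and> f b \<noteq> 0}" by blast
    obtain b where "b \<in> {b. mergeable b \<and> f b \<noteq> 0}"
      and min': "\<And>c. (c, b) \<in> lex less_than \<Longrightarrow> c \<notin> {b. mergeable b \<and> f b \<noteq> 0}"
      by (rule wfE_min[OF wf_lex[OF wf_less_than] b0]) blast
    then have b: "mergeable b" "f b \<noteq> 0"
      and min: "\<And>c. (c, b) \<in> lex less_than \<Longrightarrow> \<not> (mergeable c \<and> f c \<noteq> 0)" by auto
    have bN: "b \<in> pos_words N" using b less.prems unfolding supported_def by blast
    then have b0: "0 \<notin> set b" unfolding pos_words_def by simp
    define a where "a = merge_word b"
    have a: "splittable a" "split_word a = b" using merge_mergeable[OF b(1) b0] unfolding a_def by auto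
    \<comment> \<open>the coboundary of this cochain is used for the elimination\<close>
    let ?d = "word_fun a :: nat list \<Rightarrow> 'k"
    have d0: "?d u = 0" if "mergeable u" for u
      using a not_mergeable_and_splittable that unfolding word_fun_def by auto
    have "\<exists>s. s * s = 1 \<and> cobar ?d b = s * ?d (merge_word b)"
    proof (rule cobar_at_mergeable[OF b(1) b0 d0])
      fix u assume "(split_word u, b) \<in> lex less_than"
      then have "u \<noteq> a" using a not_sym_lex[of b b] by auto
      then show "?d u = 0" by (simp add: word_fun_def)
    qed
    then obtain s where s: "s * s = 1" "cobar ?d b = s" by (auto simp: word_fun_def a_def)
    have other: "cobar ?d c = 0" if c: "mergeable c" "0 \<notin> set c" "c \<noteq> b" "(b, c) \<notin> lex less_than" for c
    proof -
      have "\<exists>s. s * s = 1 \<and> cobar ?d c = s * ?d (merge_word c)"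
      proof (rule cobar_at_mergeable[OF c(1,2) d0])
        fix u assume "(split_word u, c) \<in> lex less_than"
        then have "u \<noteq> a" using a c by auto
        then show "?d u = 0" by (simp add: word_fun_def)
      qed
      moreover have "merge_word c \<noteq> a" using merge_mergeable[OF c(1,2)] a c by auto
      ultimately show ?thesis by (auto simp: word_fun_def)
    qed
    define g where "g = (\<lambda>w. f w - f b * s * cobar ?d w)"
    have a0: "0 \<notin> set a" and ap: "prod_list a = prod_list b" "length b = Suc (length a)"
    proof -
      have "cobar ?d b \<noteq> 0" using s by auto
      then have "prod_list a = prod_list b \<and> length b = Suc (length a) \<and> (0 \<in> set a \<longleftrightarrow> 0 \<in> set b)"
        using cobar_support[of ?d b] by (auto simp: word_fun_def)
      then show "0 \<notin> set a" "prod_list a = prod_list b" "length b = Suc (length a)" using b0 by auto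
    qed
    have dN: "w \<in> pos_words N" if "cobar ?d w \<noteq> 0" for w
      using cobar_support[OF that] bN a0 ap unfolding pos_words_def by (auto simp: word_fun_def)
    have gN: "supported N g"
      unfolding supported_def
    proof (intro allI impI)
      fix w assume "g w \<noteq> 0"
      then have "f w \<noteq> 0 \<or> cobar ?d w \<noteq> 0" unfolding g_def by auto
      then show "w \<in> pos_words N" using less.prems dN unfolding supported_def by blast
    qed
    have gb: "g b = 0" unfolding g_def s(2) using s(1) by (simp add: mult.assoc)
    have g: "f c \<noteq> 0 \<or> (b, c) \<in> lex less_than" "c \<noteq> b" if c: "mergeable c" "g c \<noteq> 0" for c
    proof -
      show cb: "c \<noteq> b" using c gb by auto
      have "0 \<notin> set c" using gN c unfolding supported_def pos_words_def by blast
      then show "f c \<noteq> 0 \<or> (b, c) \<in> lex less_than" using other[of c] c cb unfolding g_def by (cases "(b, c) \<in> lex less_than") auto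
    qed
    have "?M g \<subseteq> ?M f"
    proof safe
      fix c x assume "mergeable c" "g c \<noteq> 0"
      then show "\<exists>e. mergeable e \<and> f e \<noteq> 0 \<and> (e = c \<or> (e, c) \<in> lex less_than)" using g b by blast
    next
      fix c x assume "mergeable c" "g c \<noteq> 0" "(c, x) \<in> lex less_than"
      then show "\<exists>e. mergeable e \<and> f e \<noteq> 0 \<and> (e = x \<or> (e, x) \<in> lex less_than)"
        using g b transD[OF trans_lex_less] by blast
    qed
    moreover have "b \<in> ?M f" using b bN by blast
    moreover have "b \<notin> ?M g" using g min not_sym_lex by blast
    ultimately have "?M g \<subset> ?M f" by blast
    then have "card (?M g) < card (?M f)"
      by (intro psubset_card_mono) (auto intro: finite_subset[OF _ finite_pos_words])
    from less.hyps[OF this gN] obtain h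
      where h: "h \<in> word_cochains" "\<And>b. mergeable b \<Longrightarrow> g b = cobar h b" by blast
    let ?h = "\<lambda>w. h w + f b * s * ?d w"
    have "?h \<in> word_cochains" by (intro word_cochains_add h word_cochains_scale word_cochains_word_fun a0)
    moreover have "f c = cobar ?h c" if "mergeable c" for c
      using h(2)[OF that] unfolding g_def cobar_add cobar_scale by (simp add: algebra_simps)
    ultimately show ?thesis by blast
  qed
qed

text \<open>
  The homogeneous triangular system has only the zero solution: at the partner of \<open>a\<close> the cocycle
  condition reads \<open>f a = 0\<close> once \<open>f\<close> vanishes at all splittable words with an earlier partner.
\<close>

lemma cocycle_clear_splittable:
  fixes f :: "nat list \<Rightarrow> 'k::comm_ring_1"
  assumes f: "f \<in> word_cochains" "\<And>w. cobar f w = 0" "\<And>b. mergeable b \<Longrightarrow> f b = 0" and a: "splittable a"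
  shows "f a = 0"
  using wf_lex[OF wf_less_than] a
proof (induction "split_word a" arbitrary: a rule: wf_induct_rule)
  case (less a)
  show ?case
  proof (cases "0 \<in> set a")
    case True then show ?thesis using word_cochains_pos f by blast
  next
    case False
    note S = split_word_splittable[OF less.prems False]
    have "\<exists>s. s * s = 1 \<and> cobar f (split_word a) = s * f (merge_word (split_word a))"
      by (rule cobar_at_mergeable) (use S f less.hyps in auto)
    then obtain s where s: "s * s = 1" "s * f a = 0" using S f by auto
    have "f a = s * (s * f a)" using s(1) by (simp add: mult.assoc[symmetric])
    then show ?thesis using s(2) by simp
  qed
qed

theorem cocycle_prime_words:
  fixes f :: "nat list \<Rightarrow> 'k::comm_ring_1"
  assumes f: "f \<in> word_cochains" "\<And>w. cobar f w = 0"
  obtains h where "h \<in> word_cochains" "\<And>w. f w - cobar h w \<noteq> 0 \<Longrightarrow> \<forall>x\<in>set w. is_prime x"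
proof -
  obtain N where "supported N f" using f unfolding word_cochains_def by blast
  from clear_mergeable_within[OF this] obtain h
    where h: "h \<in> word_cochains" "\<And>b. mergeable b \<Longrightarrow> f b = cobar h b" by blast
  let ?g = "\<lambda>w. f w - cobar h w"
  have "?g w = 0" if "splittable w" for w
    by (rule cocycle_clear_splittable[OF _ _ _ that])
      (simp_all add: h f word_cochains_diff word_cochains_cobar cobar_diff cobar_cobar)
  moreover have "?g w = 0" if "mergeable w" for w using h(2)[OF that] by simp
  ultimately have "\<forall>x\<in>set w. is_prime x" if "?g w \<noteq> 0" for w
    using mergeable_or_splittable_or_primes that by blast
  then show ?thesis using that h by blast
qed

section \<open>The topology of the algebra of Dirichlet series\<close>

lemma dirichlet_algebra_simps:
  "carrier dirichlet_algebra = {f. f 0 = 0}"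
  "x \<oplus>\<^bsub>dirichlet_algebra\<^esub> y = (\<lambda>n. x n + y n)"
  "c \<odot>\<^bsub>dirichlet_algebra\<^esub> x = (\<lambda>n. c * x n)"
  "x \<otimes>\<^bsub>dirichlet_algebra\<^esub> y = (\<lambda>n. if n = 0 then 0 else \<Sum>(i, j)\<in>{(i, j). i * j = n}. x i * y j)"
  by (simp_all add: dirichlet_algebra_def)

definition indicator_at :: "nat \<Rightarrow> nat \<Rightarrow> 'k::comm_ring_1" where
  "indicator_at m = (\<lambda>n. of_bool (n = m))"

lemma sum_pointwise: "(\<Sum>i\<in>S. F i) x = (\<Sum>i\<in>S. F i x)"
  by (induction S rule: infinite_finite_induct) simp_all

lemma module_fun_scale: "Modules.module (fun_scale :: 'k::field \<Rightarrow> ('a \<Rightarrow> 'k) \<Rightarrow> 'a \<Rightarrow> 'k)"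
  by unfold_locales (auto simp: fun_eq_iff algebra_simps)

text \<open>
  Together with the next lemma: the spans of \<open>z\<^sub>1, \<dots>, z\<^sub>N\<close> are cofinal among the finite dimensional
  subcoalgebras.  So the topology is that of agreement of the first \<open>N\<close> coefficients.
\<close>

lemma fin_dim_subcoalgebra_bounded:
  assumes "fin_dim_subcoalgebra D"
  obtains N where "\<And>c n. c \<in> D \<Longrightarrow> n > N \<Longrightarrow> c n = (0 :: 'k::field)"
proof -
  interpret V: Modules.module "fun_scale :: 'k \<Rightarrow> (nat \<Rightarrow> 'k) \<Rightarrow> nat \<Rightarrow> 'k" by (rule module_fun_scale)
  obtain B where B: "finite B" "D = V.span B" and D: "D \<subseteq> dirichlet_coalgebra"
    using assms unfolding fin_dim_subcoalgebra_def by blast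
  have "finite (\<Union>c\<in>B. {n. c n \<noteq> 0})"
    using B D V.span_base[of _ B] unfolding dirichlet_coalgebra_def by blast
  then obtain N where N: "\<And>n. n \<in> (\<Union>c\<in>B. {n. c n \<noteq> 0}) \<Longrightarrow> n \<le> N"
    using finite_nat_set_iff_bounded_le by metis
  have "c n = 0" if "c \<in> V.span B" "n > N" for c n
    using that
  proof (induction rule: V.span_induct_alt)
    case (step d x y)
    then have "x n = 0" using N[of n] by (meson UN_I mem_Collect_eq not_le)
    then show ?case using step by simp
  qed simp
  then show ?thesis using that B(2) by blast
qed

text \<open>
  The factors of a number up to \<open>N\<close> are themselves at most \<open>N\<close>.
\<close>

lemma truncated_subcoalgebra:
  "fin_dim_subcoalgebra {c :: nat \<Rightarrow> 'k::field. c 0 = 0 \<and> (\<forall>n>N. c n = 0)}" (is "fin_dim_subcoalgebra ?D")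
proof -
  interpret V: Modules.module "fun_scale :: 'k \<Rightarrow> (nat \<Rightarrow> 'k) \<Rightarrow> nat \<Rightarrow> 'k" by (rule module_fun_scale)
  interpret W: Modules.module "fun_scale :: 'k \<Rightarrow> (nat \<times> nat \<Rightarrow> 'k) \<Rightarrow> nat \<times> nat \<Rightarrow> 'k"
    by (rule module_fun_scale)
  let ?B = "indicator_at ` {1..N} :: (nat \<Rightarrow> 'k) set"
  have "?D \<subseteq> dirichlet_coalgebra"
    unfolding dirichlet_coalgebra_def by (auto intro: finite_subset[of _ "{..N}"] simp: not_le[symmetric])
  moreover have "?D = V.span ?B"
  proof
    show "V.span ?B \<subseteq> ?D"
      by (rule V.span_minimal) (auto simp: indicator_at_def V.subspace_def)
    show "?D \<subseteq> V.span ?B"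
    proof
      fix c assume c: "c \<in> ?D"
      have "c = (\<Sum>m\<in>{1..N}. fun_scale (c m) (indicator_at m))"
      proof
        fix n
        have "(\<Sum>m\<in>{1..N}. fun_scale (c m) (indicator_at m)) n = (\<Sum>m\<in>{1..N}. c m * of_bool (n = m))"
          by (simp add: sum_pointwise indicator_at_def)
        also have "\<dots> = c n" using c by (cases "n \<in> {1..N}") (auto simp: not_less_eq_eq Suc_le_eq)
        finally show "c n = (\<Sum>m\<in>{1..N}. fun_scale (c m) (indicator_at m)) n" by simp
      qed
      also have "\<dots> \<in> V.span ?B" by (intro V.span_sum V.span_scale V.span_base) auto
      finally show "c \<in> V.span ?B" .
    qed
  qed
  moreover have "dirichlet_comult c \<in> W.span {tensor d e |d e. d \<in> ?D \<and> e \<in> ?D}" if c: "c \<in> ?D" for c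
  proof -
    let ?S = "{1..N} \<times> {1..N}"
    have "dirichlet_comult c
        = (\<Sum>p\<in>?S. fun_scale (c (fst p * snd p)) (tensor (indicator_at (fst p)) (indicator_at (snd p))))"
    proof
      fix q :: "nat \<times> nat"
      obtain i j where q: "q = (i, j)" by (cases q)
      have "(\<Sum>p\<in>?S. fun_scale (c (fst p * snd p)) (tensor (indicator_at (fst p)) (indicator_at (snd p)))) q
          = (\<Sum>p\<in>?S. if p = q then c (fst p * snd p) else 0)"
        unfolding sum_pointwise by (rule sum.cong) (auto simp: tensor_def indicator_at_def q)
      also have "\<dots> = (if q \<in> ?S then c (i * j) else 0)" using q by (simp add: sum.delta)
      also have "\<dots> = dirichlet_comult c q"
      proof (cases "q \<in> ?S \<or> i = 0 \<or> j = 0")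
        case False
        then have "i > N \<or> j > N" "i \<ge> 1" "j \<ge> 1" using q by auto
        then have "i * j > N"
          using mult_le_mono[of i i 1 j] mult_le_mono[of 1 i j j] by linarith
        then show ?thesis using c q False by (auto simp: dirichlet_comult_def)
      qed (auto simp: q dirichlet_comult_def)
      finally show "dirichlet_comult c q = (\<Sum>p\<in>?S. fun_scale (c (fst p * snd p))
        (tensor (indicator_at (fst p)) (indicator_at (snd p)))) q" by simp
    qed
    also have "\<dots> \<in> W.span {tensor d e |d e. d \<in> ?D \<and> e \<in> ?D}"
    proof (intro W.span_sum W.span_scale W.span_base)
      fix p assume "p \<in> ?S"
      then have "indicator_at (fst p) \<in> ?D" "indicator_at (snd p) \<in> ?D" by (auto simp: indicator_at_def)
      then show "tensor (indicator_at (fst p)) (indicator_at (snd p)) \<in> {tensor d e |d e. d \<in> ?D \<and> e \<in> ?D}"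
        by blast
    qed
    finally show ?thesis .
  qed
  moreover have "finite ?B" by simp
  ultimately show ?thesis unfolding fin_dim_subcoalgebra_def by blast
qed

lemma pairing_indicator: "dirichlet_pairing f (indicator_at m :: nat \<Rightarrow> 'k::field) = f m"
proof -
  have "{n. (indicator_at m :: nat \<Rightarrow> 'k) n \<noteq> 0} = {m}" by (auto simp: indicator_at_def)
  then show ?thesis unfolding dirichlet_pairing_def by (simp add: indicator_at_def)
qed

lemma openin_dirichlet_topology:
  "openin dirichlet_topology (U :: (nat \<Rightarrow> 'k::field) set) \<longleftrightarrow>
     U \<subseteq> {f. f 0 = 0} \<and> (\<forall>f\<in>U. \<exists>N. \<forall>g. g 0 = 0 \<longrightarrow> (\<forall>m\<le>N. g m = f m) \<longrightarrow> g \<in> U)"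
  (is "_ \<longleftrightarrow> ?R U")
proof
  assume "openin dirichlet_topology U"
  then have "generate_topology_on {{g \<in> carrier dirichlet_algebra. \<forall>c\<in>D. dirichlet_pairing g c = dirichlet_pairing f c} |f D.
        f \<in> carrier dirichlet_algebra \<and> fin_dim_subcoalgebra D} U"
    unfolding dirichlet_topology_def openin_topology_generated_by_iff .
  then show "?R U"
  proof induction
    case (Int a b)
    show ?case
    proof (intro conjI ballI)
      fix f assume "f \<in> a \<inter> b"
      then obtain M N where "\<And>g. g 0 = 0 \<Longrightarrow> (\<forall>m\<le>M. g m = f m) \<Longrightarrow> g \<in> a"
        "\<And>g. g 0 = 0 \<Longrightarrow> (\<forall>m\<le>N. g m = f m) \<Longrightarrow> g \<in> b" using Int by blast
      then show "\<exists>N. \<forall>g. g 0 = 0 \<longrightarrow> (\<forall>m\<le>N. g m = f m) \<longrightarrow> g \<in> a \<inter> b"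
        by (intro exI[of _ "max M N"]) auto
    qed (use Int in blast)
  next
    case (UN K) then show ?case by (meson Union_iff Union_least)
  next
    case (Basis s)
    then obtain f0 D where s: "s = {g \<in> carrier dirichlet_algebra. \<forall>c\<in>D. dirichlet_pairing g c = dirichlet_pairing f0 c}"
      and D: "fin_dim_subcoalgebra D" by blast
    obtain N where N: "\<And>c n. c \<in> D \<Longrightarrow> n > N \<Longrightarrow> c n = 0" using fin_dim_subcoalgebra_bounded[OF D] by metis
    have eq: "dirichlet_pairing g c = dirichlet_pairing f c" if "\<forall>m\<le>N. g m = f m" "c \<in> D" for f g c
      unfolding dirichlet_pairing_def
      by (rule sum.cong) (use that N in \<open>auto simp: not_le[symmetric]\<close>)
    show ?case
    proof (intro conjI ballI exI[of _ N] allI impI)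
      fix f g assume "f \<in> s" "g 0 = 0" "\<forall>m\<le>N. g m = f m"
      then show "g \<in> s" using eq[of g f] by (auto simp: s dirichlet_algebra_simps)
    qed (auto simp: s dirichlet_algebra_simps)
  qed auto
next
  assume R: "?R U"
  show "openin dirichlet_topology U"
  proof (subst openin_subopen, intro ballI)
    fix f assume f: "f \<in> U"
    then obtain N where N: "\<And>g. g 0 = 0 \<Longrightarrow> (\<forall>m\<le>N. g m = f m) \<Longrightarrow> g \<in> U" using R by blast
    let ?D = "{c :: nat \<Rightarrow> 'k. c 0 = 0 \<and> (\<forall>n>N. c n = 0)}"
    let ?T = "{g \<in> carrier dirichlet_algebra. \<forall>c\<in>?D. dirichlet_pairing g c = dirichlet_pairing f c}"
    have f0: "f \<in> carrier dirichlet_algebra" using f R by (auto simp: dirichlet_algebra_simps)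
    have "openin dirichlet_topology ?T"
      unfolding dirichlet_topology_def
      by (rule topology_generated_by_Basis) (use f0 truncated_subcoalgebra in blast)
    moreover have "?T \<subseteq> U"
    proof
      fix g assume g: "g \<in> ?T"
      have "g m = f m" if "m \<le> N" for m
      proof (cases "m = 0")
        case True then show ?thesis using g f0 by (simp add: dirichlet_algebra_simps)
      next
        case False
        then have "indicator_at m \<in> ?D" using that by (auto simp: indicator_at_def)
        then show ?thesis using g pairing_indicator[of g m] pairing_indicator[of f m] by auto
      qed
      then show "g \<in> U" using N g by (auto simp: dirichlet_algebra_simps)
    qed
    ultimately show "\<exists>T. openin dirichlet_topology T \<and> f \<in> T \<and> T \<subseteq> U" using f0 by blast
  qed
qed

lemma topspace_dirichlet_topology: "topspace dirichlet_topology = {f. f 0 = 0}"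
proof -
  have "openin dirichlet_topology {f. f 0 = 0}" unfolding openin_dirichlet_topology by auto
  moreover have "topspace dirichlet_topology \<subseteq> {f. f 0 = 0}"
    using openin_topspace[of dirichlet_topology] unfolding openin_dirichlet_topology by blast
  ultimately show ?thesis using openin_subset by blast
qed

lemma args_dirichlet: "args dirichlet_algebra n = {..<n} \<rightarrow>\<^sub>E {f. f 0 = 0}"
  unfolding args_def dirichlet_algebra_simps ..

lemma continuous_imp_locally_constant:
  assumes "continuous_map (product_topology (\<lambda>_. dirichlet_topology) {..<n}) (discrete_topology UNIV) \<phi>"
    and a: "a \<in> args dirichlet_algebra n"
  obtains N where "\<And>b. b \<in> args dirichlet_algebra n \<Longrightarrow> (\<And>i m. i < n \<Longrightarrow> m \<le> N \<Longrightarrow> b i m = a i m) \<Longrightarrow> \<phi> b = \<phi> a"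
proof -
  have top: "topspace (product_topology (\<lambda>_. dirichlet_topology) {..<n}) = args dirichlet_algebra n"
    by (simp add: topspace_dirichlet_topology args_dirichlet)
  have "openin (product_topology (\<lambda>_. dirichlet_topology) {..<n}) {b \<in> args dirichlet_algebra n. \<phi> b \<in> {\<phi> a}}"
    using assms(1) unfolding continuous_map_def top openin_discrete_topology by blast
  then obtain U where U: "\<And>i. i < n \<Longrightarrow> openin dirichlet_topology (U i)" "a \<in> PiE {..<n} U"
    "PiE {..<n} U \<subseteq> {b \<in> args dirichlet_algebra n. \<phi> b \<in> {\<phi> a}}"
    unfolding openin_product_topology_alt using a
    by (smt (verit, best) insertI1 lessThan_iff mem_Collect_eq)
  have "\<exists>N. \<forall>i<n. \<forall>g. g 0 = 0 \<longrightarrow> (\<forall>m\<le>N i. g m = a i m) \<longrightarrow> g \<in> U i"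
  proof -
    have "\<forall>i. \<exists>N. i < n \<longrightarrow> (\<forall>g. g 0 = 0 \<longrightarrow> (\<forall>m\<le>N. g m = a i m) \<longrightarrow> g \<in> U i)"
      using U(1,2) unfolding openin_dirichlet_topology by (metis PiE_mem lessThan_iff)
    then show ?thesis by (metis (no_types))
  qed
  then obtain N where N: "\<And>i g. i < n \<Longrightarrow> g 0 = 0 \<Longrightarrow> (\<forall>m\<le>N i. g m = a i m) \<Longrightarrow> g \<in> U i" by blast
  show ?thesis
  proof (rule that[of "\<Sum>i<n. N i"])
    fix b assume b: "b \<in> args dirichlet_algebra n" "\<And>i m. i < n \<Longrightarrow> m \<le> (\<Sum>i<n. N i) \<Longrightarrow> b i m = a i m"
    have "b i \<in> U i" if "i < n" for i
    proof (rule N[OF that])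
      show "b i 0 = 0" using PiE_mem[OF b(1)[unfolded args_dirichlet], of i] that by simp
      have "N i \<le> (\<Sum>i<n. N i)" using that by (intro member_le_sum) auto
      then show "\<forall>m\<le>N i. b i m = a i m" using b(2) that by auto
    qed
    then have "b \<in> PiE {..<n} U" using b(1) by (auto simp: args_dirichlet PiE_iff)
    then show "\<phi> b = \<phi> a" using U(3) by blast
  qed
qed

lemma finitely_determined_imp_continuous:
  assumes "\<And>a b. a \<in> args dirichlet_algebra n \<Longrightarrow> b \<in> args dirichlet_algebra n \<Longrightarrow>
     (\<And>i m. i < n \<Longrightarrow> m \<le> N \<Longrightarrow> b i m = a i m) \<Longrightarrow> \<phi> b = \<phi> a"
  shows "continuous_map (product_topology (\<lambda>_. dirichlet_topology) {..<n}) (discrete_topology UNIV) \<phi>"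
proof -
  have top: "topspace (product_topology (\<lambda>_. dirichlet_topology) {..<n}) = args dirichlet_algebra n"
    by (simp add: topspace_dirichlet_topology args_dirichlet)
  have "openin (product_topology (\<lambda>_. dirichlet_topology) {..<n}) {b \<in> args dirichlet_algebra n. \<phi> b \<in> V}" for V
    unfolding openin_product_topology_alt
  proof (intro ballI)
    fix a assume a: "a \<in> {b \<in> args dirichlet_algebra n. \<phi> b \<in> V}"
    let ?U = "\<lambda>i. {g. g 0 = 0 \<and> (\<forall>m\<le>N. g m = a i m)}"
    have 1: "finite {i \<in> {..<n}. ?U i \<noteq> topspace dirichlet_topology}" by simp
    have 2: "openin dirichlet_topology (?U i)" for i
      unfolding openin_dirichlet_topology by (auto intro!: exI[of _ N])
    have 3: "a \<in> PiE {..<n} ?U" using a by (auto simp: args_dirichlet PiE_iff)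
    have 4: "PiE {..<n} ?U \<subseteq> {b \<in> args dirichlet_algebra n. \<phi> b \<in> V}"
    proof
      fix b assume b: "b \<in> PiE {..<n} ?U"
      have "PiE {..<n} ?U \<subseteq> args dirichlet_algebra n"
        unfolding args_dirichlet by (rule PiE_mono) auto
      then have args: "b \<in> args dirichlet_algebra n" using b by (rule subsetD)
      have "b i m = a i m" if "i < n" "m \<le> N" for i m
        using PiE_mem[OF b, of i] that by simp
      then have "\<phi> b = \<phi> a" using a args by (intro assms[of a b]) simp_all
      then show "b \<in> {b \<in> args dirichlet_algebra n. \<phi> b \<in> V}" using a args by simp
    qed
    show "\<exists>U. finite {i \<in> {..<n}. U i \<noteq> topspace dirichlet_topology} \<and>
      (\<forall>i\<in>{..<n}. openin dirichlet_topology (U i)) \<and> a \<in> PiE {..<n} U \<and>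
      PiE {..<n} U \<subseteq> {b \<in> args dirichlet_algebra n. \<phi> b \<in> V}"
      by (rule exI[of _ ?U]) (intro conjI ballI 1 2 3 4)
  qed
  then show ?thesis unfolding continuous_map_def top by simp
qed

section \<open>Continuous multilinear forms\<close>

lemma args_upd: "a \<in> args dirichlet_algebra n \<Longrightarrow> i < n \<Longrightarrow> x 0 = 0 \<Longrightarrow> a(i := x) \<in> args dirichlet_algebra n"
  unfolding args_dirichlet by (auto simp: PiE_iff extensional_def)

lemma args_zero: "a \<in> args dirichlet_algebra n \<Longrightarrow> i < n \<Longrightarrow> a i 0 = 0"
  unfolding args_dirichlet by (auto simp: PiE_iff)

lemma multilinear_add:
  "multilinear dirichlet_algebra n \<phi> \<Longrightarrow> a \<in> args dirichlet_algebra n \<Longrightarrow> i < n \<Longrightarrow> x 0 = 0 \<Longrightarrow> y 0 = 0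
    \<Longrightarrow> \<phi> (a(i := \<lambda>k. x k + y k)) = \<phi> (a(i := x)) + \<phi> (a(i := y))"
  unfolding multilinear_def dirichlet_algebra_simps by blast

lemma multilinear_scale:
  "multilinear dirichlet_algebra n \<phi> \<Longrightarrow> a \<in> args dirichlet_algebra n \<Longrightarrow> i < n \<Longrightarrow> x 0 = 0
    \<Longrightarrow> \<phi> (a(i := \<lambda>k. c * x k)) = c * \<phi> (a(i := x))"
  unfolding multilinear_def dirichlet_algebra_simps by blast

lemma multilinear_slot_zero:
  assumes "multilinear dirichlet_algebra n \<phi>" "a \<in> args dirichlet_algebra n" "i < n" "\<And>m. a i m = 0"
  shows "\<phi> a = 0"
proof -
  have "(\<lambda>k. 0 * a i k) = a i" by (rule ext) (simp add: assms(4))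
  then have "\<phi> (a(i := a i)) = 0 * \<phi> (a(i := a i))"
    using multilinear_scale[OF assms(1,2,3), of "a i" 0] assms(4) by (simp only:)
  then show ?thesis by simp
qed

text \<open>
  The part of a series in the basic neighbourhood of \<open>0\<close> given by \<open>N\<close>.
\<close>

definition tail_above :: "nat \<Rightarrow> (nat \<Rightarrow> 'k::comm_ring_1) \<Rightarrow> nat \<Rightarrow> 'k" where
  "tail_above N x = (\<lambda>k. if k \<le> N then 0 else x k)"

lemma multilinear_expand_slot:
  assumes "multilinear dirichlet_algebra n \<phi>" "a \<in> args dirichlet_algebra n" "i < n"
  shows "\<phi> a = (\<Sum>m\<in>{1..N}. a i m * \<phi> (a(i := indicator_at m))) + \<phi> (a(i := tail_above N (a i)))"
proof (induction N)
  case 0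
  have "tail_above 0 (a i) = a i" using args_zero[OF assms(2,3)] by (auto simp: tail_above_def fun_eq_iff)
  then show ?case by simp
next
  case (Suc N)
  let ?m = "Suc N"
  have "tail_above N (a i) = (\<lambda>k. (a i ?m * indicator_at ?m k) + tail_above ?m (a i) k)"
    by (auto simp: tail_above_def indicator_at_def fun_eq_iff le_Suc_eq)
  moreover have "\<phi> (a(i := (\<lambda>k. (a i ?m * indicator_at ?m k) + tail_above ?m (a i) k)))
      = a i ?m * \<phi> (a(i := indicator_at ?m)) + \<phi> (a(i := tail_above ?m (a i)))"
  proof -
    have "\<phi> (a(i := (\<lambda>k. (a i ?m * indicator_at ?m k) + tail_above ?m (a i) k)))
        = \<phi> (a(i := \<lambda>k. a i ?m * indicator_at ?m k)) + \<phi> (a(i := tail_above ?m (a i)))"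
      by (rule multilinear_add[OF assms]) (simp_all add: indicator_at_def tail_above_def)
    moreover have "\<phi> (a(i := \<lambda>k. a i ?m * indicator_at ?m k)) = a i ?m * \<phi> (a(i := indicator_at ?m))"
      by (rule multilinear_scale[OF assms]) (simp add: indicator_at_def)
    ultimately show ?thesis by (simp only:)
  qed
  ultimately have "\<phi> (a(i := tail_above N (a i)))
      = a i ?m * \<phi> (a(i := indicator_at ?m)) + \<phi> (a(i := tail_above ?m (a i)))" by (simp only:)
  moreover have "(\<Sum>m\<in>{1..?m}. a i m * \<phi> (a(i := indicator_at m)))
      = (\<Sum>m\<in>{1..N}. a i m * \<phi> (a(i := indicator_at m))) + a i ?m * \<phi> (a(i := indicator_at ?m))"
    by simp
  ultimately show ?case using Suc by (simp only: add.assoc)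
qed

text \<open>
  A continuous form vanishes as soon as one of its arguments lies in a suitable neighbourhood of \<open>0\<close>,
  whatever the other arguments are.  Continuity itself only gives this if all arguments are close to
  \<open>0\<close>.  To get rid of the other arguments they are split into finitely many coordinates and a rest close
  to \<open>0\<close>; a coordinate is a fixed argument, which leaves a form in fewer variables.  The set \<open>J\<close> of
  variables makes this induction possible without reindexing tuples.
\<close>

lemma cts_multilinear_slot_tail:
  fixes \<phi> :: "(nat \<Rightarrow> nat \<Rightarrow> 'k::field) \<Rightarrow> 'k"
  assumes ml: "multilinear dirichlet_algebra n \<phi>"
    and cts: "continuous_map (product_topology (\<lambda>_. dirichlet_topology) {..<n}) (discrete_topology UNIV) \<phi>"
    and J: "J \<subseteq> {..<n}" "J \<noteq> {}" and a: "a \<in> args dirichlet_algebra n"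
  shows "\<exists>N. \<forall>b\<in>args dirichlet_algebra n. (\<forall>i<n. i \<notin> J \<longrightarrow> b i = a i) \<longrightarrow>
     (\<exists>i\<in>J. \<forall>m\<le>N. b i m = 0) \<longrightarrow> \<phi> b = 0"
  using J a
proof (induction "card J" arbitrary: J a rule: less_induct)
  case less
  have fin: "finite J" using less.prems finite_subset by blast
  let ?z = "\<lambda>i. if i \<in> J then (\<lambda>k. 0) else a i"
  have z: "?z \<in> args dirichlet_algebra n"
    using less.prems unfolding args_dirichlet by (auto simp: PiE_iff extensional_def)
  from continuous_imp_locally_constant[OF cts this] obtain N0 where
    N0: "\<And>b. b \<in> args dirichlet_algebra n \<Longrightarrow> (\<And>i m. i < n \<Longrightarrow> m \<le> N0 \<Longrightarrow> b i m = ?z i m) \<Longrightarrow> \<phi> b = \<phi> ?z"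
    by blast
  have z0: "\<phi> ?z = 0"
  proof -
    obtain i where "i \<in> J" using less.prems by blast
    then show ?thesis using multilinear_slot_zero[OF ml z, of i] less.prems by auto
  qed
  \<comment> \<open>\<open>N\<close> is good enough after the variable \<open>i\<close> has been fixed to be the indicator of \<open>m\<close>\<close>
  define P where "P = (\<lambda>i m N. \<forall>b\<in>args dirichlet_algebra n.
     (\<forall>j<n. j \<notin> J - {i} \<longrightarrow> b j = (a(i := indicator_at m)) j) \<longrightarrow>
     (\<exists>j\<in>J - {i}. \<forall>k\<le>N. b j k = 0) \<longrightarrow> \<phi> b = 0)"
  have exP: "\<exists>N. P i m N" if i: "i \<in> J" and m: "m \<ge> 1" for i m
  proof (cases "J - {i} = {}")
    case False
    have "card (J - {i}) < card J" using i fin by (metis card_Diff1_less)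
    moreover have "J - {i} \<subseteq> {..<n}" "i < n" using less.prems(1) i by auto
    moreover have "a(i := indicator_at m) \<in> args dirichlet_algebra n"
      using less.prems(1) i m by (intro args_upd[OF less.prems(3)]) (auto simp: indicator_at_def)
    ultimately show ?thesis unfolding P_def using False by (intro less.hyps)
  next
    case True then show ?thesis unfolding P_def by (simp only: True bex_empty simp_thms) blast
  qed
  define M where "M = (\<lambda>i m. SOME N. P i m N)"
  have PM: "P i m (M i m)" if "i \<in> J" "m \<ge> 1" for i m
    unfolding M_def by (rule someI_ex[OF exP[OF that]])
  have M: "\<phi> b = 0" if "i \<in> J" "m \<ge> 1" "b \<in> args dirichlet_algebra n"
      "\<forall>j<n. j \<notin> J - {i} \<longrightarrow> b j = (a(i := indicator_at m)) j"
      "\<exists>j\<in>J - {i}. \<forall>k\<le>M i m. b j k = 0" for i m b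
    using PM[OF that(1,2)] that(3-) unfolding P_def by blast
  define N where "N = N0 + (\<Sum>i\<in>J. \<Sum>m\<in>{1..N0}. M i m)"
  have MN: "M i m \<le> N" if "i \<in> J" "m \<in> {1..N0}" for i m
  proof -
    have "M i m \<le> (\<Sum>m\<in>{1..N0}. M i m)" using that by (intro member_le_sum) auto
    also have "\<dots> \<le> (\<Sum>i\<in>J. \<Sum>m\<in>{1..N0}. M i m)"
      using that fin by (intro member_le_sum[of i J "\<lambda>i. \<Sum>m\<in>{1..N0}. M i m"]) auto
    finally show ?thesis unfolding N_def by simp
  qed
  show ?case
  proof (intro exI[of _ N] ballI impI)
    fix b assume b: "b \<in> args dirichlet_algebra n" "\<forall>i<n. i \<notin> J \<longrightarrow> b i = a i" "\<exists>i\<in>J. \<forall>m\<le>N. b i m = 0"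
    then obtain i0 where i0: "i0 \<in> J" "\<And>m. m \<le> N \<Longrightarrow> b i0 m = 0" by blast
    \<comment> \<open>the arguments in \<open>J\<close> are replaced by their tails one at a time\<close>
    define c where "c = (\<lambda>I i. if i \<in> I then tail_above N0 (b i) else b i)"
    have c_args: "c I \<in> args dirichlet_algebra n" if "I \<subseteq> J" for I
      using b(1) that less.prems unfolding args_dirichlet c_def
      by (auto simp: PiE_iff extensional_def tail_above_def)
    have ci0: "c I i0 m = 0" if "m \<le> N" for I m using i0 that by (simp add: c_def tail_above_def)
    have "\<phi> b = \<phi> (c I)" if "I \<subseteq> J" for I
    proof -
      have "finite I" using fin that finite_subset by blast
      then show ?thesis using that
      proof (induction I)
        case (insert i I)
        have iJ: "i \<in> J" "i < n" "I \<subseteq> J" using insert.prems less.prems by auto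
        have cI: "c I i = b i" using insert.hyps by (simp add: c_def)
        have ins: "(c I)(i := tail_above N0 (c I i)) = c (insert i I)"
          using insert.hyps by (auto simp: c_def fun_eq_iff)
        have van: "c I i m * \<phi> ((c I)(i := indicator_at m)) = 0" if m: "m \<in> {1..N0}" for m
        proof (cases "i = i0")
          case True
          then show ?thesis using ci0[of m I] m by (simp add: N_def)
        next
          case False
          have "\<phi> ((c I)(i := indicator_at m)) = 0"
          proof (rule M[OF iJ(1)])
            show "(c I)(i := indicator_at m) \<in> args dirichlet_algebra n"
              by (rule args_upd[OF c_args[OF iJ(3)] iJ(2)]) (use m in \<open>auto simp: indicator_at_def\<close>)
            show "\<forall>j<n. j \<notin> J - {i} \<longrightarrow> ((c I)(i := indicator_at m)) j = (a(i := indicator_at m)) j"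
              using b(2) iJ by (auto simp: c_def)
            show "\<exists>j\<in>J - {i}. \<forall>k\<le>M i m. ((c I)(i := indicator_at m)) j k = 0"
              using False i0(1) ci0 MN[OF iJ(1) m] by (intro bexI[of _ i0]) auto
          qed (use m in auto)
          then show ?thesis by simp
        qed
        have "\<phi> (c I) = \<phi> (c (insert i I))"
          using multilinear_expand_slot[OF ml c_args[OF iJ(3)] iJ(2), of N0] van
          unfolding ins by simp
        then show ?case using insert iJ by simp
      qed (simp add: c_def)
    qed
    then have "\<phi> b = \<phi> (c J)" by blast
    also have "\<dots> = \<phi> ?z"
      by (rule N0[OF c_args]) (use b(2) in \<open>auto simp: c_def tail_above_def\<close>)
    finally show "\<phi> b = 0" using z0 by simp
  qed
qed

text \<open>
  The coefficient function \<open>f\<close> of a combination of monomials in \<open>n\<close> variables, evaluated at a tuple of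
  series.  All words in question have letters at most \<open>N\<close>, so that the sum is finite; the choice of \<open>N\<close>
  does not matter by \<open>word_pairing_enlarge\<close>.
\<close>

fun word_pairing :: "nat \<Rightarrow> nat \<Rightarrow> (nat list \<Rightarrow> 'k::comm_ring_1) \<Rightarrow> (nat \<Rightarrow> nat \<Rightarrow> 'k) \<Rightarrow> 'k" where
  "word_pairing N 0 f a = f []"
| "word_pairing N (Suc n) f a = (\<Sum>x\<le>N. a 0 x * word_pairing N n (\<lambda>w. f (x # w)) (\<lambda>j. a (Suc j)))"

lemma word_pairing_cong_fun: "(\<And>w. length w = n \<Longrightarrow> f w = g w) \<Longrightarrow> word_pairing N n f a = word_pairing N n g a"
proof (induction n arbitrary: f g a)
  case (Suc n)
  have "word_pairing N n (\<lambda>w. f (x # w)) b = word_pairing N n (\<lambda>w. g (x # w)) b" for x b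
    by (rule Suc.IH) (simp add: Suc.prems)
  then show ?case by simp
qed simp

lemma word_pairing_cong_arg:
  "(\<And>j m. j < n \<Longrightarrow> m \<le> N \<Longrightarrow> a j m = b j m) \<Longrightarrow> word_pairing N n f a = word_pairing N n f b"
proof (induction n arbitrary: f a b)
  case (Suc n)
  have "word_pairing N n g (\<lambda>j. a (Suc j)) = word_pairing N n g (\<lambda>j. b (Suc j))" for g
    by (rule Suc.IH) (simp add: Suc.prems)
  then show ?case using Suc.prems by simp
qed simp

lemma word_pairing_zero [simp]: "word_pairing N n (\<lambda>w. 0) a = 0"
  by (induction n arbitrary: a) simp_all

lemma word_pairing_add: "word_pairing N n (\<lambda>w. f w + g w) a = word_pairing N n f a + word_pairing N n g a"
proof (induction n arbitrary: f g a)
  case (Suc n)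
  show ?case unfolding word_pairing.simps Suc.IH by (simp add: distrib_left sum.distrib)
qed simp

lemma word_pairing_scale: "word_pairing N n (\<lambda>w. c * f w) a = c * word_pairing N n f a"
proof (induction n arbitrary: f a)
  case (Suc n)
  show ?case unfolding word_pairing.simps Suc.IH by (simp add: sum_distrib_left mult.left_commute)
qed simp

lemma word_pairing_diff: "word_pairing N n (\<lambda>w. f w - g w) a = word_pairing N n f a - word_pairing N n g a"
  using word_pairing_add[of N n f "\<lambda>w. - 1 * g w" a] by (simp only: word_pairing_scale) simp

lemma word_pairing_enlarge:
  assumes "\<And>w. f w \<noteq> 0 \<Longrightarrow> set w \<subseteq> {..N}" "N \<le> M"
  shows "word_pairing M n f a = word_pairing N n f a"
  using assms(1)
proof (induction n arbitrary: f a)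
  case (Suc n)
  have "word_pairing M (Suc n) f a = (\<Sum>x\<le>N. a 0 x * word_pairing M n (\<lambda>w. f (x # w)) (\<lambda>j. a (Suc j)))"
    unfolding word_pairing.simps
  proof (rule sum.mono_neutral_right)
    show "\<forall>x\<in>{..M} - {..N}. a 0 x * word_pairing M n (\<lambda>w. f (x # w)) (\<lambda>j. a (Suc j)) = 0"
    proof
      fix x assume "x \<in> {..M} - {..N}"
      then have "(\<lambda>w. f (x # w)) = (\<lambda>w. 0)" using Suc.prems by fastforce
      then show "a 0 x * word_pairing M n (\<lambda>w. f (x # w)) (\<lambda>j. a (Suc j)) = 0" by simp
    qed
  qed (use assms(2) in auto)
  also have "\<dots> = (\<Sum>x\<le>N. a 0 x * word_pairing N n (\<lambda>w. f (x # w)) (\<lambda>j. a (Suc j)))"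
  proof (rule sum.cong)
    fix x
    have "word_pairing M n (\<lambda>w. f (x # w)) b = word_pairing N n (\<lambda>w. f (x # w)) b" for b
      by (rule Suc.IH) (use Suc.prems in fastforce)
    then show "a 0 x * word_pairing M n (\<lambda>w. f (x # w)) (\<lambda>j. a (Suc j)) = a 0 x * word_pairing N n (\<lambda>w. f (x # w)) (\<lambda>j. a (Suc j))"
      by simp
  qed simp
  finally show ?case by simp
qed simp

lemma shift_upd_Suc: "(\<lambda>j. (a(Suc i := x)) (Suc j)) = (\<lambda>j. a (Suc j))(i := x)"
  by auto

lemma word_pairing_arg_add:
  "i < n \<Longrightarrow> word_pairing N n f (a(i := \<lambda>k. x k + y k)) = word_pairing N n f (a(i := x)) + word_pairing N n f (a(i := y))"
proof (induction n arbitrary: i f a)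
  case (Suc n)
  show ?case
  proof (cases i)
    case 0 then show ?thesis by (simp add: distrib_right sum.distrib)
  next
    case (Suc i')
    have "i' < n" using Suc Suc.prems by simp
    show ?thesis unfolding Suc word_pairing.simps shift_upd_Suc Suc.IH[OF \<open>i' < n\<close>]
      by (simp add: distrib_left sum.distrib)
  qed
qed simp

lemma word_pairing_arg_scale:
  "i < n \<Longrightarrow> word_pairing N n f (a(i := \<lambda>k. c * x k)) = c * word_pairing N n f (a(i := x))"
proof (induction n arbitrary: i f a)
  case (Suc n)
  show ?case
  proof (cases i)
    case 0 then show ?thesis by (simp add: sum_distrib_left mult.assoc)
  next
    case (Suc i')
    have "i' < n" using Suc Suc.prems by simp
    show ?thesis unfolding Suc word_pairing.simps shift_upd_Suc Suc.IH[OF \<open>i' < n\<close>]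
      by (simp add: sum_distrib_left mult.left_commute)
  qed
qed simp

lemma word_pairing_indicators:
  assumes "\<And>v. f v \<noteq> 0 \<Longrightarrow> set v \<subseteq> {..N}" "\<And>j. j < length w \<Longrightarrow> a j = indicator_at (w ! j)"
  shows "word_pairing N (length w) f a = f w"
  using assms
proof (induction w arbitrary: f a)
  case (Cons x w)
  have a0: "a 0 = indicator_at x" using Cons.prems(2)[of 0] by simp
  have IH: "word_pairing N (length w) (\<lambda>v. f (y # v)) (\<lambda>j. a (Suc j)) = f (y # w)" for y
  proof (rule Cons.IH)
    show "set v \<subseteq> {..N}" if "f (y # v) \<noteq> 0" for v using Cons.prems(1)[OF that] by simp
    show "a (Suc j) = indicator_at (w ! j)" if "j < length w" for j
      using Cons.prems(2)[of "Suc j"] that by simp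
  qed
  have "word_pairing N (length (x # w)) f a = (\<Sum>y\<le>N. if y = x then f (y # w) else 0)"
    by (simp add: IH a0 indicator_at_def if_distrib cong: if_cong)
  also have "\<dots> = f (x # w)"
  proof (cases "x \<le> N")
    case False
    then have "f (x # w) = 0" using Cons.prems(1)[of "x # w"] by auto
    then show ?thesis using False by simp
  qed simp
  finally show ?case .
qed simp

lemma word_pairing_conv:
  "word_pairing N n (conv f g) a = (\<Sum>p\<le>n. word_pairing N p f a * word_pairing N (n - p) g (\<lambda>j. a (p + j)))"
proof (induction n arbitrary: f a)
  case (Suc n)
  have "word_pairing N (Suc n) (conv f g) a
      = (\<Sum>x\<le>N. a 0 x * (f [] * word_pairing N n (\<lambda>w. g (x # w)) (\<lambda>j. a (Suc j))
          + (\<Sum>p\<le>n. word_pairing N p (\<lambda>w. f (x # w)) (\<lambda>j. a (Suc j)) * word_pairing N (n - p) g (\<lambda>j. a (Suc (p + j))))))"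
    by (simp add: word_pairing_add word_pairing_scale Suc.IH)
  also have "\<dots> = f [] * word_pairing N (Suc n) g a
     + (\<Sum>p\<le>n. word_pairing N (Suc p) f a * word_pairing N (n - p) g (\<lambda>j. a (Suc (p + j))))"
    by (simp add: distrib_left sum.distrib sum_distrib_left sum_distrib_right mult.assoc mult.left_commute
        sum.swap[of _ "{..N}" "{..n}"])
  also have "\<dots> = (\<Sum>p\<le>Suc n. word_pairing N p f a * word_pairing N (Suc n - p) g (\<lambda>j. a (p + j)))"
    by (subst sum.atMost_Suc_shift) simp
  finally show ?case .
qed simp

section \<open>Continuous cochains as finitely supported functions on words\<close>

text \<open>
  The Dirichlet product paired with \<open>F\<close>.  The square on the right contains pairs with product beyond
  \<open>N\<close>, which is harmless as \<open>F\<close> vanishes there.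
\<close>

lemma sum_dirichlet_mult:
  fixes x y :: "nat \<Rightarrow> 'k::field"
  assumes "x 0 = 0" "y 0 = 0" "\<And>z. z > N \<Longrightarrow> F z = 0"
  shows "(\<Sum>z\<le>N. (x \<otimes>\<^bsub>dirichlet_algebra\<^esub> y) z * F z) = (\<Sum>i\<le>N. \<Sum>j\<le>N. x i * y j * F (i * j))"
proof -
  let ?h = "\<lambda>(i, j). x i * y j * F (i * j)"
  let ?S = "{p. fst p * snd p \<in> {1..N}}"
  have S: "?S \<subseteq> {..N} \<times> {..N}"
  proof
    fix p :: "nat \<times> nat" assume p: "p \<in> ?S"
    obtain i j where ij: "p = (i, j)" by (cases p)
    have "i \<noteq> 0" "j \<noteq> 0" using p ij by (auto intro: ccontr)
    then have "i \<le> i * j" "j \<le> i * j" "i * j \<le> N" using p ij by auto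
    then have "i \<le> N" "j \<le> N" by linarith+
    then show "p \<in> {..N} \<times> {..N}" using ij by auto
  qed
  have fin: "finite ?S" using S by (rule finite_subset) simp
  have "(\<Sum>z\<le>N. (x \<otimes>\<^bsub>dirichlet_algebra\<^esub> y) z * F z)
      = (\<Sum>z\<in>{1..N}. (x \<otimes>\<^bsub>dirichlet_algebra\<^esub> y) z * F z)"
    by (rule sum.mono_neutral_right) (auto simp: dirichlet_algebra_simps not_less_eq_eq)
  also have "\<dots> = (\<Sum>z\<in>{1..N}. sum ?h {p \<in> ?S. fst p * snd p = z})"
  proof (rule sum.cong)
    fix z assume z: "z \<in> {1..N}"
    then have "{p \<in> ?S. fst p * snd p = z} = {(i, j). i * j = z}" by auto
    moreover have "(x \<otimes>\<^bsub>dirichlet_algebra\<^esub> y) z * F z = (\<Sum>(i, j)\<in>{(i, j). i * j = z}. x i * y j * F z)"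
      using z by (simp add: dirichlet_algebra_simps sum_distrib_right case_prod_unfold)
    moreover have "\<dots> = sum ?h {(i, j). i * j = z}"
      by (rule sum.cong) auto
    ultimately show "(x \<otimes>\<^bsub>dirichlet_algebra\<^esub> y) z * F z = sum ?h {p \<in> ?S. fst p * snd p = z}"
      by simp
  qed simp
  also have "\<dots> = sum ?h ?S"
    by (rule sum.group[OF fin]) auto
  also have "\<dots> = sum ?h ({..N} \<times> {..N})"
  proof (rule sum.mono_neutral_left[OF _ S])
    show "\<forall>p\<in>{..N} \<times> {..N} - ?S. ?h p = 0"
    proof
      fix p assume p: "p \<in> {..N} \<times> {..N} - ?S"
      obtain i j where ij: "p = (i, j)" by (cases p)
      have "i = 0 \<or> j = 0 \<or> i * j > N" using p ij by (cases "i = 0"; cases "j = 0") auto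
      then show "?h p = 0" using assms ij by auto
    qed
  qed simp
  finally show ?thesis by (simp add: sum.cartesian_product)
qed

text \<open>
  \<open>contract\<close> without the restriction to tuples of a fixed length, which would get in the way of shifting
  the arguments.
\<close>

definition merge_args :: "nat \<Rightarrow> (nat \<Rightarrow> nat \<Rightarrow> 'k::field) \<Rightarrow> nat \<Rightarrow> nat \<Rightarrow> 'k" where
  "merge_args i a j = (if j < i then a j
     else if j = i then a i \<otimes>\<^bsub>dirichlet_algebra\<^esub> a (Suc i) else a (Suc j))"

text \<open>
  The Hochschild differential of a combination of monomials is given by \<open>cobar\<close>.  Peeling off the first
  argument turns the faces from the second one on into the differential of the section
  \<open>\<lambda>w. f (x # w)\<close> at the remaining arguments, up to its first term; this is the recursion that
  defines \<open>cobar\<close>.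
\<close>

lemma word_pairing_cobar:
  fixes f :: "nat list \<Rightarrow> 'k::field"
  assumes "\<And>w. f w \<noteq> 0 \<Longrightarrow> 0 \<notin> set w \<and> prod_list w \<le> N" "1 \<le> N" "\<And>j. j \<le> n \<Longrightarrow> a j 0 = 0"
  shows "a 0 1 * word_pairing N n f (\<lambda>j. a (Suc j)) + (\<Sum>i<n. (-1) ^ Suc i * word_pairing N n f (merge_args i a))
     + (-1) ^ Suc n * (word_pairing N n f a * a n 1) = word_pairing N (Suc n) (cobar f) a"
  using assms(1,3)
proof (induction n arbitrary: f a)
  case (Suc m)
  let ?a1 = "\<lambda>j. a (Suc j)" let ?a2 = "\<lambda>j. a (Suc (Suc j))"
  let ?f = "\<lambda>x w. f (x # w)"
  let ?Q = "\<lambda>x. word_pairing N (Suc m) (cobar (?f x)) ?a1"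
  let ?R = "\<lambda>x. (\<Sum>i<m. (-1) ^ Suc i * word_pairing N m (?f x) (merge_args i ?a1))
       + (-1) ^ Suc m * (word_pairing N m (?f x) ?a1 * a (Suc m) 1)"
  have IH: "a 1 1 * word_pairing N m (?f x) ?a2 + ?R x = ?Q x" for x
  proof -
    have "0 \<notin> set w \<and> prod_list w \<le> N" if "f (x # w) \<noteq> 0" for w
    proof -
      have "x \<noteq> 0" "0 \<notin> set w" "x * prod_list w \<le> N" using Suc.prems(1)[OF that] by auto
      moreover from this have "prod_list w \<le> x * prod_list w" by simp
      ultimately show ?thesis by linarith
    qed
    moreover have "a (Suc j) 0 = 0" if "j \<le> m" for j using Suc.prems(2)[of "Suc j"] that by simp
    ultimately have "a (Suc 0) 1 * word_pairing N m (?f x) ?a2 + (\<Sum>i<m. (-1) ^ Suc i * word_pairing N m (?f x) (merge_args i ?a1))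
       + (-1) ^ Suc m * (word_pairing N m (?f x) ?a1 * a (Suc m) 1) = ?Q x" by (rule Suc.IH)
    then show ?thesis by (simp only: add.assoc One_nat_def)
  qed
  have m0: "merge_args 0 a 0 = a 0 \<otimes>\<^bsub>dirichlet_algebra\<^esub> a 1" "(\<lambda>j. merge_args 0 a (Suc j)) = ?a2"
    by (auto simp: merge_args_def)
  have mS: "merge_args (Suc i) a 0 = a 0" "(\<lambda>j. merge_args (Suc i) a (Suc j)) = merge_args i ?a1" for i
    by (auto simp: merge_args_def)
  have A: "word_pairing N (Suc m) f (merge_args 0 a) = (\<Sum>x\<le>N. \<Sum>y\<le>N. a 0 x * a 1 y * word_pairing N m (?f (x * y)) ?a2)"
  proof -
    have "word_pairing N m (?f z) ?a2 = 0" if "z > N" for z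
    proof -
      have "?f z = (\<lambda>w. 0)"
      proof (rule ext, rule ccontr)
        fix w assume "f (z # w) \<noteq> 0"
        then have w: "0 \<notin> set (z # w)" "prod_list (z # w) \<le> N" using Suc.prems(1) by blast+
        have "z \<le> prod_list (z # w)" by (rule entry_le_prod_list[OF w(1)]) simp
        then show False using w(2) that by linarith
      qed
      then show ?thesis by simp
    qed
    then show ?thesis
      unfolding word_pairing.simps m0 by (intro sum_dirichlet_mult) (use Suc.prems(2) in auto)
  qed
  have "a 0 1 * word_pairing N (Suc m) f ?a1 + (\<Sum>i<Suc m. (-1) ^ Suc i * word_pairing N (Suc m) f (merge_args i a))
     + (-1) ^ Suc (Suc m) * (word_pairing N (Suc m) f a * a (Suc m) 1)
    = a 0 1 * (\<Sum>y\<le>N. a 1 y * word_pairing N m (?f y) ?a2) - word_pairing N (Suc m) f (merge_args 0 a)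
      - (\<Sum>x\<le>N. a 0 x * ?R x)"
  proof -
    have "(\<Sum>i<Suc m. (-1) ^ Suc i * word_pairing N (Suc m) f (merge_args i a))
      = - word_pairing N (Suc m) f (merge_args 0 a)
        + (\<Sum>i<m. (-1) ^ Suc (Suc i) * word_pairing N (Suc m) f (merge_args (Suc i) a))"
      by (subst sum.lessThan_Suc_shift) simp
    moreover have "(\<Sum>i<m. (-1) ^ Suc (Suc i) * word_pairing N (Suc m) f (merge_args (Suc i) a))
      = - (\<Sum>x\<le>N. a 0 x * (\<Sum>i<m. (-1) ^ Suc i * word_pairing N m (?f x) (merge_args i ?a1)))"
    proof -
      have "(\<Sum>i<m. (-1) ^ Suc (Suc i) * word_pairing N (Suc m) f (merge_args (Suc i) a))
        = (\<Sum>i<m. \<Sum>x\<le>N. - (a 0 x * ((-1) ^ Suc i * word_pairing N m (?f x) (merge_args i ?a1))))"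
        by (rule sum.cong) (simp_all add: mS sum_distrib_left mult.left_commute)
      also have "\<dots> = (\<Sum>x\<le>N. \<Sum>i<m. - (a 0 x * ((-1) ^ Suc i * word_pairing N m (?f x) (merge_args i ?a1))))"
        by (rule sum.swap)
      finally show ?thesis by (simp only: sum_negf sum_distrib_left)
    qed
    moreover have "(-1) ^ Suc (Suc m) * (word_pairing N (Suc m) f a * a (Suc m) 1)
      = - (\<Sum>x\<le>N. a 0 x * ((-1) ^ Suc m * (word_pairing N m (?f x) ?a1 * a (Suc m) 1)))"
      by (simp add: sum_distrib_left sum_distrib_right sum_negf[symmetric] mult_ac)
    moreover have "(\<Sum>x\<le>N. a 0 x * ?R x)
      = (\<Sum>x\<le>N. a 0 x * (\<Sum>i<m. (-1) ^ Suc i * word_pairing N m (?f x) (merge_args i ?a1)))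
       + (\<Sum>x\<le>N. a 0 x * ((-1) ^ Suc m * (word_pairing N m (?f x) ?a1 * a (Suc m) 1)))"
      by (simp only: distrib_left sum.distrib)
    moreover have "word_pairing N (Suc m) f ?a1 = (\<Sum>y\<le>N. a 1 y * word_pairing N m (?f y) ?a2)" by simp
    ultimately show ?thesis by (simp only: diff_conv_add_uminus minus_add_distrib add.assoc)
  qed
  also have "\<dots> = a 0 1 * (\<Sum>y\<le>N. a 1 y * word_pairing N m (?f y) ?a2) + a 1 1 * (\<Sum>x\<le>N. a 0 x * word_pairing N m (?f x) ?a2)
      - (\<Sum>x\<le>N. \<Sum>y\<le>N. a 0 x * a 1 y * word_pairing N m (?f (x * y)) ?a2) - (\<Sum>x\<le>N. a 0 x * ?Q x)"
    unfolding A IH[symmetric] by (simp add: distrib_left sum.distrib sum_distrib_left mult.left_commute)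
  also have "\<dots> = word_pairing N (Suc (Suc m)) (cobar f) a"
  proof -
    have E: "word_pairing N m (\<lambda>w. cobar f (x # y # w)) ?a2
      = of_bool (x = 1) * word_pairing N m (?f y) ?a2 + of_bool (y = 1) * word_pairing N m (?f x) ?a2
        - word_pairing N m (?f (x * y)) ?a2 - word_pairing N m (\<lambda>w. cobar (?f x) (y # w)) ?a2" for x y
      by (simp only: cobar.simps word_pairing_add word_pairing_diff word_pairing_scale)
    have "word_pairing N (Suc (Suc m)) (cobar f) a
      = (\<Sum>x\<le>N. \<Sum>y\<le>N. a 0 x * (a 1 y * word_pairing N m (\<lambda>w. cobar f (x # y # w)) ?a2))"
      by (simp only: word_pairing.simps sum_distrib_left One_nat_def)
    also have "\<dots> = (\<Sum>x\<le>N. \<Sum>y\<le>N. of_bool (x = 1) * (a 0 x * (a 1 y * word_pairing N m (?f y) ?a2)))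
       + (\<Sum>x\<le>N. \<Sum>y\<le>N. of_bool (y = 1) * (a 0 x * (a 1 y * word_pairing N m (?f x) ?a2)))
       - (\<Sum>x\<le>N. \<Sum>y\<le>N. a 0 x * a 1 y * word_pairing N m (?f (x * y)) ?a2)
       - (\<Sum>x\<le>N. \<Sum>y\<le>N. a 0 x * (a 1 y * word_pairing N m (\<lambda>w. cobar (?f x) (y # w)) ?a2))"
      unfolding E by (simp add: algebra_simps sum.distrib sum_subtractf)
    also have "(\<Sum>x\<le>N. \<Sum>y\<le>N. of_bool (x = 1) * (a 0 x * (a 1 y * word_pairing N m (?f y) ?a2)))
       = a 0 1 * (\<Sum>y\<le>N. a 1 y * word_pairing N m (?f y) ?a2)"
    proof -
      have "(\<Sum>x\<le>N. \<Sum>y\<le>N. of_bool (x = 1) * (a 0 x * (a 1 y * word_pairing N m (?f y) ?a2)))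
         = (\<Sum>x\<le>N. if x = 1 then a 0 1 * (\<Sum>y\<le>N. a 1 y * word_pairing N m (?f y) ?a2) else 0)"
        by (rule sum.cong) (auto simp: sum_distrib_left)
      then show ?thesis using assms(2) by simp
    qed
    also have "(\<Sum>x\<le>N. \<Sum>y\<le>N. of_bool (y = 1) * (a 0 x * (a 1 y * word_pairing N m (?f x) ?a2)))
       = a 1 1 * (\<Sum>x\<le>N. a 0 x * word_pairing N m (?f x) ?a2)"
    proof -
      have "(\<Sum>y\<le>N. of_bool (y = 1) * (a 0 x * (a 1 y * word_pairing N m (?f x) ?a2)))
         = a 1 1 * (a 0 x * word_pairing N m (?f x) ?a2)" for x
      proof -
        have "(\<Sum>y\<le>N. of_bool (y = 1) * (a 0 x * (a 1 y * word_pairing N m (?f x) ?a2)))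
          = (\<Sum>y\<le>N. if y = 1 then a 1 1 * (a 0 x * word_pairing N m (?f x) ?a2) else 0)"
          by (rule sum.cong) (auto simp: mult.left_commute)
        then show ?thesis using assms(2) by simp
      qed
      then show ?thesis by (simp add: sum_distrib_left)
    qed
    also have "(\<Sum>x\<le>N. \<Sum>y\<le>N. a 0 x * (a 1 y * word_pairing N m (\<lambda>w. cobar (?f x) (y # w)) ?a2))
       = (\<Sum>x\<le>N. a 0 x * ?Q x)"
      by (simp add: sum_distrib_left)
    finally show ?thesis by simp
  qed
  finally show ?case .
qed (simp add: mult.commute)

definition letter_bound :: "(nat list \<Rightarrow> 'k::comm_ring_1) \<Rightarrow> nat" where
  "letter_bound f = (LEAST N. supported N f)"

definition cochain_of :: "(nat list \<Rightarrow> 'k::field) \<Rightarrow> nat \<Rightarrow> (nat \<Rightarrow> nat \<Rightarrow> 'k) \<Rightarrow> 'k" where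
  "cochain_of f n = on_args dirichlet_algebra n (word_pairing (letter_bound f) n f)"

lemma supported_letters: "supported N f \<Longrightarrow> f w \<noteq> 0 \<Longrightarrow> set w \<subseteq> {..N}"
  unfolding supported_def pos_words_def using entry_le_prod_list le_trans by blast

lemma cochain_of_eq:
  assumes "supported N f"
  shows "cochain_of f n = on_args dirichlet_algebra n (word_pairing N n f)"
proof -
  have "supported (letter_bound f) f" "letter_bound f \<le> N"
    unfolding letter_bound_def using assms by (auto intro: LeastI Least_le)
  then have "word_pairing N n f a = word_pairing (letter_bound f) n f a" for a
    by (intro word_pairing_enlarge supported_letters)
  then show ?thesis unfolding cochain_of_def on_args_def by (intro ext) simp
qed

lemma word_cochains_supported:
  assumes "f \<in> word_cochains" obtains N where "supported N f" "1 \<le> N"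
proof -
  obtain N where "supported N f" using assms unfolding word_cochains_def by blast
  then show ?thesis using that[of "Suc N"] supported_mono[of N f "Suc N"] by simp
qed

lemma cochain_of_in_cts_cochains:
  assumes "f \<in> word_cochains"
  shows "cochain_of f n \<in> cts_cochains dirichlet_algebra dirichlet_topology n"
proof -
  obtain N where N: "supported N f" "1 \<le> N" using assms by (rule word_cochains_supported)
  note eq = cochain_of_eq[OF N(1)]
  have ev: "cochain_of f n a = word_pairing N n f a" if "a \<in> args dirichlet_algebra n" for a
    using that by (simp add: eq on_args_def)
  have "multilinear dirichlet_algebra n (cochain_of f n)"
    unfolding multilinear_def dirichlet_algebra_simps
    by (auto simp: ev args_upd word_pairing_arg_add word_pairing_arg_scale)
  moreover have "continuous_map (product_topology (\<lambda>_. dirichlet_topology) {..<n}) (discrete_topology UNIV) (cochain_of f n)"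
  proof (rule finitely_determined_imp_continuous)
    fix a b :: "nat \<Rightarrow> nat \<Rightarrow> 'a"
    assume "a \<in> args dirichlet_algebra n" "b \<in> args dirichlet_algebra n"
      "\<And>i m. i < n \<Longrightarrow> m \<le> N \<Longrightarrow> b i m = a i m"
    then show "cochain_of f n b = cochain_of f n a"
      unfolding ev by (simp add: ev) (rule word_pairing_cong_arg)
  qed
  ultimately show ?thesis unfolding cts_cochains_def by (simp add: eq on_args_def)
qed

lemma cochain_of_high_degree:
  assumes "supported N f" "N < n" shows "cochain_of f n = (\<lambda>a. 0)"
proof -
  have "word_pairing N n f a = word_pairing N n (\<lambda>w. 0) a" for a
    using assms unfolding supported_def pos_words_def by (intro word_pairing_cong_fun) fastforce
  then show ?thesis by (intro ext) (simp add: cochain_of_eq[OF assms(1)] on_args_def)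
qed

lemma cochain_algebra_simps:
  "carrier (cochain_algebra A T) = {\<Phi>. (\<forall>n. \<Phi> n \<in> cts_cochains A T n) \<and> finite {n. \<Phi> n \<noteq> (\<lambda>a. 0)}}"
  "\<Phi> \<otimes>\<^bsub>cochain_algebra A T\<^esub> \<Psi> = (\<lambda>n a. \<Sum>p\<le>n. cup A p (n - p) (\<Phi> p) (\<Psi> (n - p)) a)"
  "\<one>\<^bsub>cochain_algebra A T\<^esub> = (\<lambda>n. if n = 0 then on_args A 0 (\<lambda>a. 1) else (\<lambda>a. 0))"
  "\<zero>\<^bsub>cochain_algebra A T\<^esub> = (\<lambda>n a. 0)"
  "\<Phi> \<oplus>\<^bsub>cochain_algebra A T\<^esub> \<Psi> = (\<lambda>n a. \<Phi> n a + \<Psi> n a)"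
  "c \<odot>\<^bsub>cochain_algebra A T\<^esub> \<Phi> = (\<lambda>n a. c * \<Phi> n a)"
  by (simp_all add: cochain_algebra_def)

lemma cochain_of_carrier:
  assumes "f \<in> word_cochains"
  shows "cochain_of f \<in> carrier (cochain_algebra dirichlet_algebra dirichlet_topology)"
proof -
  obtain N where N: "supported N f" "1 \<le> N" using assms by (rule word_cochains_supported)
  have "finite {n. cochain_of f n \<noteq> (\<lambda>a. 0)}"
    by (rule finite_subset[of _ "{..N}"]) (use cochain_of_high_degree[OF N(1)] not_le in auto)
  then show ?thesis unfolding cochain_algebra_simps using cochain_of_in_cts_cochains[OF assms] by blast
qed

definition word_args :: "nat list \<Rightarrow> nat \<Rightarrow> nat \<Rightarrow> 'k::comm_ring_1" where
  "word_args w = (\<lambda>j\<in>{..<length w}. indicator_at (w ! j))"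

lemma word_args_in_args: "0 \<notin> set w \<Longrightarrow> word_args w \<in> args dirichlet_algebra (length w)"
  unfolding args_dirichlet word_args_def by (auto simp: indicator_at_def PiE_iff in_set_conv_nth)

lemma cochain_of_word_args:
  assumes "f \<in> word_cochains" "0 \<notin> set w"
  shows "cochain_of f (length w) (word_args w) = f w"
proof -
  obtain N where N: "supported N f" "1 \<le> N" using assms(1) by (rule word_cochains_supported)
  show ?thesis
    unfolding cochain_of_eq[OF N(1)] on_args_def using word_args_in_args[OF assms(2)]
    by (subst if_P) (auto intro!: word_pairing_indicators supported_letters[OF N(1)] simp: word_args_def)
qed

lemma cochain_of_inj: "inj_on cochain_of word_cochains"
proof (rule inj_onI)
  fix f g :: "nat list \<Rightarrow> 'a" assume fg: "f \<in> word_cochains" "g \<in> word_cochains" "cochain_of f = cochain_of g"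
  show "f = g"
  proof
    fix w show "f w = g w"
    proof (cases "0 \<in> set w")
      case True then show ?thesis using word_cochains_pos fg by metis
    next
      case False then show ?thesis using cochain_of_word_args fg by metis
    qed
  qed
qed

lemma cochain_of_add:
  assumes "f \<in> word_cochains" "g \<in> word_cochains"
  shows "cochain_of (\<lambda>w. f w + g w) = (\<lambda>n a. cochain_of f n a + cochain_of g n a)"
proof -
  obtain N where N: "supported N f" "supported N g" using assms by (rule word_cochains_common)
  have "supported N (\<lambda>w. f w + g w)" using N unfolding supported_def by (metis add.right_neutral)
  from cochain_of_eq[OF this] show ?thesis
    by (simp add: cochain_of_eq[OF N(1)] cochain_of_eq[OF N(2)] on_args_def word_pairing_add fun_eq_iff)
qed

lemma cochain_of_scale:
  assumes "f \<in> word_cochains"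
  shows "cochain_of (\<lambda>w. c * f w) = (\<lambda>n a. c * cochain_of f n a)"
proof -
  obtain N where N: "supported N f" "1 \<le> N" using assms by (rule word_cochains_supported)
  have "supported N (\<lambda>w. c * f w)" using N unfolding supported_def by (metis mult_zero_right)
  from cochain_of_eq[OF this] show ?thesis
    by (simp add: cochain_of_eq[OF N(1)] on_args_def word_pairing_scale fun_eq_iff)
qed

lemma cochain_of_unit: "cochain_of unit_word_fun = \<one>\<^bsub>cochain_algebra dirichlet_algebra dirichlet_topology\<^esub>"
proof -
  have N: "supported 1 unit_word_fun" by (auto simp: supported_def pos_words_def unit_word_fun_def)
  have "word_pairing 1 n unit_word_fun a = of_bool (n = 0)" for n and a :: "nat \<Rightarrow> nat \<Rightarrow> 'a"
    by (cases n) (simp_all add: unit_word_fun_def)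
  moreover have "unit_word_fun [] = (1 :: 'a)" by (simp add: unit_word_fun_def)
  ultimately show ?thesis by (auto simp: cochain_of_eq[OF N] cochain_algebra_simps on_args_def fun_eq_iff)
qed

lemma cochain_of_conv:
  assumes "f \<in> word_cochains" "g \<in> word_cochains"
  shows "cochain_of (conv f g)
    = cochain_of f \<otimes>\<^bsub>cochain_algebra dirichlet_algebra dirichlet_topology\<^esub> cochain_of g"
proof (intro ext)
  fix n a
  obtain M where M: "supported M f" "supported M g" using assms by (rule word_cochains_common)
  obtain L where L: "supported L (conv f g)" using word_cochains_conv[OF assms] unfolding word_cochains_def by blast
  define N where "N = max M L"
  have N: "supported N f" "supported N g" "supported N (conv f g)"
    using M L supported_mono unfolding N_def by (metis max.cobounded1 max.cobounded2)+
  show "cochain_of (conv f g) n a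
    = (cochain_of f \<otimes>\<^bsub>cochain_algebra dirichlet_algebra dirichlet_topology\<^esub> cochain_of g) n a"
  proof (cases "a \<in> args dirichlet_algebra n")
    case False
    then show ?thesis by (simp add: cochain_algebra_simps cup_def on_args_def cochain_of_eq[OF N(3)])
  next
    case True
    have "cup dirichlet_algebra p (n - p) (cochain_of f p) (cochain_of g (n - p)) a
       = word_pairing N p f a * word_pairing N (n - p) g (\<lambda>j. a (p + j))" if "p \<le> n" for p
    proof -
      have r: "restrict a {..<p} \<in> args dirichlet_algebra p"
        "(\<lambda>j\<in>{..<n - p}. a (p + j)) \<in> args dirichlet_algebra (n - p)"
        using True that unfolding args_dirichlet by (auto simp: PiE_iff)
      have "word_pairing N p f (restrict a {..<p}) = word_pairing N p f a" by (rule word_pairing_cong_arg) simp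
      moreover have "word_pairing N (n - p) g (\<lambda>j\<in>{..<n - p}. a (p + j)) = word_pairing N (n - p) g (\<lambda>j. a (p + j))"
        by (rule word_pairing_cong_arg) simp
      ultimately show ?thesis
        using True that r by (simp add: cup_def on_args_def cochain_of_eq[OF N(1)] cochain_of_eq[OF N(2)])
    qed
    then show ?thesis
      using True by (simp add: cochain_algebra_simps cochain_of_eq[OF N(3)] on_args_def word_pairing_conv)
  qed
qed

lemma total_d_cochain_of:
  assumes "f \<in> word_cochains"
  shows "total_d dirichlet_algebra dirichlet_augmentation (cochain_of f) = cochain_of (cobar f)"
proof
  fix n
  obtain M where M: "supported M f" "1 \<le> M" using assms by (rule word_cochains_supported)
  have "supported (Suc M) f" using M(1) by (rule supported_mono) simp
  moreover have "supported (Suc M) (cobar f)" using M(1) by (rule supported_cobar)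
  ultimately obtain N where N: "supported N f" "supported N (cobar f)" "1 \<le> N" by fastforce
  show "total_d dirichlet_algebra dirichlet_augmentation (cochain_of f) n = cochain_of (cobar f) n"
  proof (cases n)
    case 0 then show ?thesis by (simp add: total_d_def cochain_of_eq[OF N(2)] on_args_def fun_eq_iff)
  next
    case (Suc m)
    have "hochschild_d dirichlet_algebra dirichlet_augmentation m (cochain_of f m) a
        = cochain_of (cobar f) (Suc m) a" for a
    proof (cases "a \<in> args dirichlet_algebra (Suc m)")
      case False then show ?thesis by (simp add: hochschild_d_def cochain_of_eq[OF N(2)] on_args_def)
    next
      case True
      then have a0: "a j 0 = 0" if "j \<le> m" for j using args_zero[OF True, of j] that by simp
      have r: "(\<lambda>j\<in>{..<m}. a (Suc j)) \<in> args dirichlet_algebra m"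
        "restrict a {..<m} \<in> args dirichlet_algebra m"
        using a0 unfolding args_dirichlet by auto
      have c: "contract dirichlet_algebra m i a \<in> args dirichlet_algebra m" if "i < m" for i
        using a0 that unfolding args_dirichlet contract_def by (auto simp: dirichlet_algebra_simps)
      have 1: "word_pairing N m f (\<lambda>j\<in>{..<m}. a (Suc j)) = word_pairing N m f (\<lambda>j. a (Suc j))"
        by (rule word_pairing_cong_arg) simp
      have 2: "word_pairing N m f (restrict a {..<m}) = word_pairing N m f a" by (rule word_pairing_cong_arg) simp
      have 3: "word_pairing N m f (contract dirichlet_algebra m i a) = word_pairing N m f (merge_args i a)" for i
        by (rule word_pairing_cong_arg) (simp add: contract_def merge_args_def)
      have "hochschild_d dirichlet_algebra dirichlet_augmentation m (cochain_of f m) a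
        = a 0 1 * word_pairing N m f (\<lambda>j. a (Suc j)) + (\<Sum>i<m. (-1) ^ Suc i * word_pairing N m f (merge_args i a))
          + (-1) ^ Suc m * (word_pairing N m f a * a m 1)"
        using True r c by (simp add: hochschild_d_def on_args_def dirichlet_augmentation_def
            cochain_of_eq[OF N(1)] 1 2 3)
      also have "\<dots> = word_pairing N (Suc m) (cobar f) a"
        by (rule word_pairing_cobar) (use N a0 in \<open>auto simp: supported_def pos_words_def\<close>)
      finally show ?thesis using True by (simp add: cochain_of_eq[OF N(2)] on_args_def)
    qed
    then show ?thesis unfolding Suc total_d_def by auto
  qed
qed

text \<open>
  Every continuous cochain comes from its values on tuples of indicators.  A single \<open>N\<close> bounds the
  letters in all degrees because only finitely many degrees are non-zero.  Then one argument after the other is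
  expanded in its first \<open>N\<close> coordinates; the rest does not contribute.
\<close>

lemma cochain_of_surj:
  fixes \<Phi> :: "nat \<Rightarrow> (nat \<Rightarrow> nat \<Rightarrow> 'k::field) \<Rightarrow> 'k"
  assumes "\<Phi> \<in> carrier (cochain_algebra dirichlet_algebra dirichlet_topology)"
  obtains f where "f \<in> word_cochains" "\<Phi> = cochain_of f"
proof -
  have cts: "\<Phi> n \<in> cts_cochains dirichlet_algebra dirichlet_topology n" for n
    using assms unfolding cochain_algebra_simps by auto
  have fin: "finite {n. \<Phi> n \<noteq> (\<lambda>a. 0)}"
    using assms unfolding cochain_algebra_simps by auto
  have ml: "multilinear dirichlet_algebra n (\<Phi> n)" for n using cts[of n] unfolding cts_cochains_def by simp
  define Q where "Q = (\<lambda>n N. \<forall>b\<in>args dirichlet_algebra n. (\<exists>i<n. \<forall>m\<le>N. b i m = 0) \<longrightarrow> \<Phi> n b = 0)"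
  have "\<exists>N. Q n N" for n
  proof (cases "n = 0")
    case False
    let ?a = "\<lambda>j\<in>{..<n}. (\<lambda>k. 0)"
    have a: "?a \<in> args dirichlet_algebra n" unfolding args_dirichlet by auto
    have ne: "{..<n} \<noteq> {}" using False by auto
    have ct: "continuous_map (product_topology (\<lambda>_. dirichlet_topology) {..<n}) (discrete_topology UNIV) (\<Phi> n)"
      using cts[of n] unfolding cts_cochains_def by simp
    have "\<exists>N. \<forall>b\<in>args dirichlet_algebra n. (\<forall>i<n. i \<notin> {..<n} \<longrightarrow> b i = ?a i) \<longrightarrow>
     (\<exists>i\<in>{..<n}. \<forall>m\<le>N. b i m = 0) \<longrightarrow> \<Phi> n b = 0"
      by (rule cts_multilinear_slot_tail[OF ml ct subset_refl ne a])
    then show ?thesis unfolding Q_def by auto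
  qed (simp add: Q_def)
  then obtain M where M: "\<And>n. Q n (M n)" by metis
  define N where "N = (\<Sum>n | \<Phi> n \<noteq> (\<lambda>a. 0). M n)"
  have Q: "\<Phi> n b = 0" if "b \<in> args dirichlet_algebra n" "i < n" "\<And>m. m \<le> N \<Longrightarrow> b i m = 0" for n b i
  proof (cases "\<Phi> n = (\<lambda>a. 0)")
    case False
    then have "M n \<le> N" unfolding N_def using fin by (intro member_le_sum) auto
    then have "\<forall>m\<le>M n. b i m = 0" using that by auto
    then show ?thesis using M[of n] that(1,2) unfolding Q_def by blast
  qed simp
  define f where "f = (\<lambda>w. if 0 \<in> set w then 0 else \<Phi> (length w) (word_args w))"
  have letters: "set w \<subseteq> {..N}" if "f w \<noteq> 0" for w
  proof (rule ccontr)
    assume "\<not> set w \<subseteq> {..N}"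
    then obtain x where "x \<in> set w" "x > N" using not_le by blast
    then obtain i where i: "i < length w" "w ! i > N" by (auto simp: in_set_conv_nth)
    have w0: "0 \<notin> set w" using that f_def by metis
    have "\<Phi> (length w) (word_args w) = 0"
      by (rule Q[OF word_args_in_args[OF w0] i(1)]) (use i in \<open>auto simp: word_args_def indicator_at_def\<close>)
    then show False using that w0 by (simp add: f_def)
  qed
  have f: "f \<in> word_cochains"
  proof (rule word_cochainsI)
    have "{w. f w \<noteq> 0} \<subseteq> (\<Union>n\<in>{n. \<Phi> n \<noteq> (\<lambda>a. 0)}. {w. set w \<subseteq> {..N} \<and> length w = n})"
    proof
      fix w assume w: "w \<in> {w. f w \<noteq> 0}"
      then have "\<Phi> (length w) \<noteq> (\<lambda>a. 0)" unfolding f_def by (auto split: if_splits)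
      then show "w \<in> (\<Union>n\<in>{n. \<Phi> n \<noteq> (\<lambda>a. 0)}. {w. set w \<subseteq> {..N} \<and> length w = n})"
        using letters w by auto
    qed
    then show "finite {w. f w \<noteq> 0}"
      by (rule finite_subset) (use fin in \<open>auto intro: finite_lists_length_eq\<close>)
    show "0 \<notin> set w" if "f w \<noteq> 0" for w using that f_def by metis
  qed
  let ?m = "\<lambda>n w a i. if i < length w then indicator_at (w ! i) else a i"
  have expand: "\<Phi> n (?m n w a) = word_pairing N d (\<lambda>v. f (w @ v)) (\<lambda>i. a (i + length w))"
    if "a \<in> args dirichlet_algebra n" "0 \<notin> set w" "length w + d = n" for n a w d
    using that
  proof (induction d arbitrary: w)
    case 0
    have "?m n w a = word_args w"
    proof
      fix i show "?m n w a i = word_args w i"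
        using 0 unfolding args_dirichlet word_args_def by (auto simp: PiE_iff extensional_def)
    qed
    then show ?case using 0 by (simp add: f_def)
  next
    case (Suc d)
    let ?b = "?m n w a"
    have b: "?b \<in> args dirichlet_algebra n"
      unfolding args_dirichlet
    proof (rule PiE_I)
      fix i assume i: "i \<in> {..<n}"
      show "?b i \<in> {f. f 0 = 0}"
        using args_zero[OF Suc.prems(1), of i] i Suc.prems(2) by (auto simp: indicator_at_def in_set_conv_nth)
    next
      fix i assume i: "i \<notin> {..<n}"
      then show "?b i = undefined"
        using Suc.prems unfolding args_dirichlet by (auto simp: PiE_iff extensional_def)
    qed
    have l: "length w < n" using Suc.prems by simp
    have t: "\<Phi> n (?b(length w := tail_above N (?b (length w)))) = 0"
      by (rule Q[OF args_upd[OF b l] l]) (auto simp: tail_above_def)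
    have "\<Phi> n ?b = (\<Sum>m\<in>{1..N}. a (length w) m * \<Phi> n (?b(length w := indicator_at m)))"
      using multilinear_expand_slot[OF ml b l, of N] unfolding t by simp
    also have "\<dots> = (\<Sum>m\<in>{1..N}. a (length w) m * word_pairing N d (\<lambda>v. f (w @ m # v)) (\<lambda>i. a (Suc i + length w)))"
    proof (rule sum.cong)
      fix m assume m: "m \<in> {1..N}"
      have "?b(length w := indicator_at m) = ?m n (w @ [m]) a"
        by (auto simp: fun_eq_iff nth_append)
      moreover have "\<Phi> n (?m n (w @ [m]) a) = word_pairing N d (\<lambda>v. f ((w @ [m]) @ v)) (\<lambda>i. a (i + length (w @ [m])))"
        by (rule Suc.IH) (use Suc.prems m in auto)
      ultimately show "a (length w) m * \<Phi> n (?b(length w := indicator_at m))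
         = a (length w) m * word_pairing N d (\<lambda>v. f (w @ m # v)) (\<lambda>i. a (Suc i + length w))" by simp
    qed simp
    also have "\<dots> = (\<Sum>m\<le>N. a (length w) m * word_pairing N d (\<lambda>v. f (w @ m # v)) (\<lambda>i. a (Suc i + length w)))"
    proof (rule sum.mono_neutral_left)
      show "\<forall>m\<in>{..N} - {1..N}. a (length w) m * word_pairing N d (\<lambda>v. f (w @ m # v)) (\<lambda>i. a (Suc i + length w)) = 0"
        using args_zero[OF Suc.prems(1) l] by (auto simp: not_less_eq_eq)
    qed auto
    finally show ?case by simp
  qed
  obtain K where "supported K f" "1 \<le> K" using f by (rule word_cochains_supported)
  then have K: "supported (max N K) f" by (auto intro: supported_mono)
  have "\<Phi> n a = cochain_of f n a" for n a
  proof (cases "a \<in> args dirichlet_algebra n")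
    case True
    have "\<Phi> n a = word_pairing N n f a" using expand[OF True, of "[]" n] by simp
    also have "\<dots> = word_pairing (max N K) n f a" by (rule word_pairing_enlarge[symmetric]) (auto dest: letters)
    finally show ?thesis using True by (simp add: cochain_of_eq[OF K] on_args_def)
  next
    case False
    then show ?thesis using cts[of n] by (simp add: cochain_of_eq[OF K] on_args_def cts_cochains_def)
  qed
  then show ?thesis using that f by (metis ext)
qed

section \<open>Cocycles, boundaries and their grading\<close>

definition cocycles :: "(nat list \<Rightarrow> 'k::field) set" where
  "cocycles = {f \<in> word_cochains. \<forall>w. cobar f w = 0}"

definition boundaries :: "(nat list \<Rightarrow> 'k::field) set" where
  "boundaries = cobar ` word_cochains"

lemma cocyclesD: "f \<in> cocycles \<Longrightarrow> f \<in> word_cochains" "f \<in> cocycles \<Longrightarrow> cobar f = (\<lambda>w. 0)"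
  unfolding cocycles_def by auto

lemma boundaries_cocycles: "f \<in> boundaries \<Longrightarrow> f \<in> cocycles"
  unfolding boundaries_def cocycles_def by (auto simp: word_cochains_cobar cobar_cobar)

lemma cocycles_add: "f \<in> cocycles \<Longrightarrow> g \<in> cocycles \<Longrightarrow> (\<lambda>w. f w + g w) \<in> cocycles"
  unfolding cocycles_def by (simp add: word_cochains_add cobar_add)

lemma cocycles_scale: "f \<in> cocycles \<Longrightarrow> (\<lambda>w. c * f w) \<in> cocycles"
  unfolding cocycles_def by (simp add: word_cochains_scale cobar_scale)

lemma cocycles_diff: "f \<in> cocycles \<Longrightarrow> g \<in> cocycles \<Longrightarrow> (\<lambda>w. f w - g w) \<in> cocycles"
  unfolding cocycles_def by (simp add: word_cochains_diff cobar_diff)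

lemma cocycles_zero: "(\<lambda>w. 0) \<in> cocycles"
  unfolding cocycles_def by (simp add: word_cochains_zero)

lemma cocycles_sum: "(\<And>i. i \<in> S \<Longrightarrow> F i \<in> cocycles) \<Longrightarrow> (\<lambda>w. \<Sum>i\<in>S. F i w) \<in> cocycles"
  by (induction S rule: infinite_finite_induct) (simp_all add: cocycles_zero cocycles_add)

lemma cocycles_unit: "unit_word_fun \<in> cocycles"
proof -
  have "cobar unit_word_fun w = (0::'a)" for w
    by (cases w rule: mergeable.cases) (simp_all add: unit_word_fun_def)
  then show ?thesis unfolding cocycles_def using word_cochains_unit by blast
qed

text \<open>
  By the Leibniz rule cocycles form a subalgebra, in which boundaries are an ideal by the next lemmas.
\<close>

lemma cocycles_conv:
  assumes "f \<in> cocycles" "g \<in> cocycles" shows "conv f g \<in> cocycles"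
proof -
  have "cobar (conv f g) w = 0" for w
    unfolding cobar_conv cocyclesD(2)[OF assms(1)] cocyclesD(2)[OF assms(2)] by simp
  then show ?thesis unfolding cocycles_def using assms word_cochains_conv cocyclesD(1) by blast
qed

lemma boundaries_add:
  assumes "f \<in> boundaries" "g \<in> boundaries" shows "(\<lambda>w. f w + g w) \<in> boundaries"
proof -
  obtain f' g' where f: "f = cobar f'" "g = cobar g'" "f' \<in> word_cochains" "g' \<in> word_cochains"
    using assms unfolding boundaries_def by blast
  have "(\<lambda>w. f w + g w) = cobar (\<lambda>w. f' w + g' w)" unfolding f by (simp add: fun_eq_iff cobar_add)
  then show ?thesis unfolding boundaries_def using f word_cochains_add by blast
qed

lemma boundaries_scale:
  assumes "f \<in> boundaries" shows "(\<lambda>w. c * f w) \<in> boundaries"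
proof -
  obtain f' where f: "f = cobar f'" "f' \<in> word_cochains"
    using assms unfolding boundaries_def by blast
  have "(\<lambda>w. c * f w) = cobar (\<lambda>w. c * f' w)" unfolding f by (simp add: fun_eq_iff cobar_scale)
  then show ?thesis unfolding boundaries_def using f word_cochains_scale by blast
qed

lemma boundaries_diff:
  assumes "f \<in> boundaries" "g \<in> boundaries" shows "(\<lambda>w. f w - g w) \<in> boundaries"
  using boundaries_add[OF assms(1) boundaries_scale[OF assms(2), of "-1"]] by simp

lemma boundaries_zero: "(\<lambda>w. 0) \<in> boundaries"
  unfolding boundaries_def using word_cochains_zero by (auto intro!: image_eqI[of _ _ "\<lambda>w. 0"])

lemma boundaries_sum: "(\<And>i. i \<in> S \<Longrightarrow> F i \<in> boundaries) \<Longrightarrow> (\<lambda>w. \<Sum>i\<in>S. F i w) \<in> boundaries"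
  by (induction S rule: infinite_finite_induct) (simp_all add: boundaries_zero boundaries_add)

lemma boundaries_conv_left:
  assumes "f \<in> boundaries" "g \<in> cocycles" shows "conv f g \<in> boundaries"
proof -
  obtain h where h: "f = cobar h" "h \<in> word_cochains" using assms(1) unfolding boundaries_def by blast
  have "conv f g = cobar (conv h g)"
    unfolding h by (rule ext) (simp only: cobar_conv cocyclesD(2)[OF assms(2)] conv_zero_right add.right_neutral)
  then show ?thesis
    unfolding boundaries_def using word_cochains_conv[OF h(2) cocyclesD(1)[OF assms(2)]] by blast
qed

lemma word_cochains_sign_twist: "f \<in> word_cochains \<Longrightarrow> sign_twist f \<in> word_cochains"
proof -
  assume f: "f \<in> word_cochains"
  have "f w \<noteq> 0" if "sign_twist f w \<noteq> 0" for w using that by (auto simp: sign_twist_def)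
  then show ?thesis
    by (intro word_cochainsI finite_subset[OF _ word_cochains_finite[OF f]]) (auto dest: word_cochains_pos[OF f])
qed

lemma cobar_sign_twist: "cobar (sign_twist f) w = - sign_twist (cobar f) w"
proof (induction f w rule: cobar.induct)
  case (3 f x y r)
  show ?case
    unfolding cobar.simps sign_twist_Cons cobar_scale "3" by (simp add: sign_twist_def algebra_simps)
qed (simp_all add: sign_twist_def)

lemma sign_twist_twist: "sign_twist (sign_twist f) = f"
  by (auto simp: sign_twist_def fun_eq_iff power_mult_distrib[symmetric])

lemma boundaries_conv_right:
  assumes "f \<in> cocycles" "g \<in> boundaries" shows "conv f g \<in> boundaries"
proof -
  obtain h where h: "g = cobar h" "h \<in> word_cochains" using assms(2) unfolding boundaries_def by blast
  have c0: "cobar (sign_twist f) = (\<lambda>w. 0)"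
    by (rule ext) (simp add: cobar_sign_twist cocyclesD(2)[OF assms(1)] sign_twist_def)
  have "conv f g = cobar (conv (sign_twist f) h)"
    unfolding h by (rule ext) (simp add: cobar_conv c0 sign_twist_twist)
  then show ?thesis
    unfolding boundaries_def
    using word_cochains_conv[OF word_cochains_sign_twist[OF cocyclesD(1)[OF assms(1)]] h(2)] by blast
qed

definition component :: "nat \<Rightarrow> (nat list \<Rightarrow> 'k::comm_ring_1) \<Rightarrow> nat list \<Rightarrow> 'k" where
  "component n f w = of_bool (length w = n) * f w"

lemma word_cochains_component: "f \<in> word_cochains \<Longrightarrow> component n f \<in> word_cochains"
  unfolding word_cochains_def supported_def component_def by auto

text \<open>
  The differential raises the length of words by exactly one.
\<close>

lemma cobar_component_Suc: "cobar (component n f) w = component (Suc n) (cobar f) w"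
proof (cases "length w = Suc n")
  case False
  have "cobar (component n f) w = 0"
  proof (rule ccontr)
    assume "cobar (component n f) w \<noteq> 0"
    from cobar_support[OF this] show False using False by (auto simp: component_def)
  qed
  then show ?thesis using False by (simp add: component_def)
next
  case True
  have "cobar f w = cobar (component n f) w" using True
  proof (induction f w arbitrary: n rule: cobar.induct)
    case (3 f x y r)
    have "cobar (\<lambda>w. f (x # w)) (y # r) = cobar (component (length r) (\<lambda>w. f (x # w))) (y # r)"
      by (rule "3.IH") simp
    also have "component (length r) (\<lambda>w. f (x # w)) = (\<lambda>w. component n f (x # w))"
      using "3.prems" by (auto simp: component_def fun_eq_iff)
    finally show ?case using "3.prems" by (simp add: component_def)
  qed auto
  then show ?thesis using True by (simp add: component_def)
qed

lemma cocycles_component: "f \<in> cocycles \<Longrightarrow> component n f \<in> cocycles"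
  unfolding cocycles_def by (simp add: word_cochains_component cobar_component_Suc component_def)

lemma boundaries_component:
  assumes "f \<in> boundaries" shows "component n f \<in> boundaries"
proof -
  obtain h where h: "f = cobar h" "h \<in> word_cochains" using assms(1) unfolding boundaries_def by blast
  show ?thesis
  proof (cases n)
    case 0
    then have "component n f = (\<lambda>w. 0)" by (auto simp: component_def h fun_eq_iff)
    then show ?thesis by (simp add: boundaries_zero)
  next
    case (Suc m)
    have "component n f = cobar (component m h)"
      unfolding h Suc by (rule ext) (simp add: cobar_component_Suc)
    then show ?thesis unfolding boundaries_def using word_cochains_component[OF h(2)] by blast
  qed
qed

definition homogeneous :: "nat \<Rightarrow> (nat list \<Rightarrow> 'k::field) set" where
  "homogeneous n = {f \<in> cocycles. \<forall>w. f w \<noteq> 0 \<longrightarrow> length w = n}"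

lemma homogeneous_cocycles: "f \<in> homogeneous n \<Longrightarrow> f \<in> cocycles"
  unfolding homogeneous_def by simp

lemma component_homogeneous: "f \<in> cocycles \<Longrightarrow> component n f \<in> homogeneous n"
  unfolding homogeneous_def by (auto simp: cocycles_component) (simp add: component_def)

lemma sum_components:
  assumes "supported N f" shows "f w = (\<Sum>n\<le>N. component n f w)"
proof (cases "f w = 0")
  case False
  then have "length w \<le> N" using assms unfolding supported_def pos_words_def by blast
  then show ?thesis by (simp add: component_def)
qed (simp add: component_def)

lemma homogeneous_conv:
  assumes "f \<in> homogeneous p" "g \<in> homogeneous q" shows "conv f g \<in> homogeneous (p + q)"
proof -
  have "length w = p + q" if "conv f g w \<noteq> 0" for w
    using conv_support[OF that] assms unfolding homogeneous_def by auto
  then show ?thesis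
    using cocycles_conv assms unfolding homogeneous_def by blast
qed

definition prime_words :: "nat list set" where
  "prime_words = {w. \<forall>x\<in>set w. is_prime x}"

text \<open>
  A product of two positive integers is a prime only if one of them is \<open>1\<close>, and the faces with a factor \<open>1\<close> cancel;
  so each letter that is a prime is primitive.
\<close>

lemma cobar_prime_words:
  assumes "\<And>w. f w \<noteq> 0 \<Longrightarrow> w \<in> prime_words" shows "cobar f w = 0"
proof -
  have "is_prime x" if "x \<in> set w" "w \<in> prime_words" for x w using that unfolding prime_words_def by blast
  then have entry: "f w = 0" if "x \<in> set w" "\<not> is_prime x" for x w using that assms by blast
  show ?thesis using entry
  proof (induction f w rule: cobar.induct)
    case (3 f x y r)
    have IH: "cobar (\<lambda>w. f (x # w)) (y # r) = 0"
      by (rule "3.IH") (rule "3.prems", auto)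
    have 1: "f (1 # v) = 0" for v by (rule "3.prems"[of 1]) auto
    show ?case
    proof (cases "x = 1 \<or> y = 1")
      case True then show ?thesis using IH 1 "3.prems" by (auto simp: cobar_zero 1[simplified])
    next
      case False
      then have "\<not> is_prime (x * y)" using prime_product by auto
      then have "f (x * y # r) = 0" by (intro "3.prems") auto
      then show ?thesis using False IH by simp
    qed
  qed auto
qed

lemma prime_words_pos: "w \<in> prime_words \<Longrightarrow> 0 \<notin> set w"
  unfolding prime_words_def by auto

lemma word_fun_cocycle:
  assumes "w \<in> prime_words" shows "word_fun w \<in> cocycles"
  unfolding cocycles_def
  using cobar_prime_words[of "word_fun w"] word_cochains_word_fun[OF prime_words_pos[OF assms]] assms
  by (auto simp: word_fun_def)

lemma conv_word_fun: "conv (word_fun u) (word_fun v) = word_fun (u @ v)"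
proof
  fix w show "conv (word_fun u) (word_fun v) w = (word_fun (u @ v) w :: 'a)"
  proof (induction w arbitrary: u)
    case (Cons x w)
    show ?case
    proof (cases u)
      case Nil then show ?thesis by (simp add: word_fun_def)
    next
      case (Cons y u')
      have "(\<lambda>w. word_fun u (x # w)) = (\<lambda>w. of_bool (x = y) * (word_fun u' w :: 'a))"
        unfolding Cons by (auto simp: word_fun_def fun_eq_iff)
      moreover have "word_fun u [] = (0 :: 'a)" using Cons by (simp add: word_fun_def)
      ultimately have "conv (word_fun u) (word_fun v) (x # w)
        = of_bool (x = y) * (conv (word_fun u') (word_fun v) w :: 'a)"
        by (simp only: conv.simps conv_scale_left mult_zero_left add_0)
      moreover have "word_fun (u @ v) (x # w) = of_bool (x = y) * (word_fun (u' @ v) w :: 'a)"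
        unfolding Cons by (simp add: word_fun_def)
      ultimately show ?thesis using Cons.IH[of u'] by (simp only:)
    qed
  qed (auto simp: word_fun_def)
qed

text \<open>
  The factorisations of \<open>p * q\<close> into two factors are \<open>1 * pq\<close>, \<open>pq * 1\<close>, \<open>p * q\<close> and \<open>q * p\<close>.  In the
  differential of the word \<open>[p * q]\<close> the first two are cancelled by the unit terms.  If \<open>p = q\<close> the last
  two coincide and must be counted twice.
\<close>

lemma prime_letters_anticommute:
  assumes p: "is_prime p" and q: "is_prime q"
  shows "(\<lambda>w. word_fun [p, q] w + word_fun [q, p] w) \<in> boundaries"
proof -
  \<comment> \<open>for \<open>p = q\<close> the two words in the sum are the same\<close>
  define c where "c = (if p = q then -2 else -1 :: 'a)"
  have ne: "p \<noteq> 1" "q \<noteq> 1" "p \<noteq> 0" "q \<noteq> 0" using p q by auto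
  have "(\<lambda>w. word_fun [p, q] w + word_fun [q, p] w) = (\<lambda>w. c * cobar (word_fun [p * q]) w)"
  proof
    fix w
    show "word_fun [p, q] w + word_fun [q, p] w = c * cobar (word_fun [p * q]) w"
    proof (cases "length w = 2")
      case False
      then have "cobar (word_fun [p * q]) w = (0::'a)"
        using cobar_support[of "word_fun [p * q] :: _ \<Rightarrow> 'a" w] by (auto simp: word_fun_def)
      moreover have "w \<noteq> [p, q]" "w \<noteq> [q, p]" using False by auto
      ultimately show ?thesis by (simp add: word_fun_def)
    next
      case True
      then obtain x y where w: "w = [x, y]" by (auto simp: length_Suc_conv numeral_2_eq_2)
      have *: "x * y = p * q \<longleftrightarrow> x = 1 \<and> y = p * q \<or> y = 1 \<and> x = p * q \<or> x = p \<and> y = q \<or> x = q \<and> y = p"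
      proof
        assume xy: "x * y = p * q"
        then have "p dvd x \<or> p dvd y" using p prime_dvd_mult_iff by (metis dvd_triv_left)
        then show "x = 1 \<and> y = p * q \<or> y = 1 \<and> x = p * q \<or> x = p \<and> y = q \<or> x = q \<and> y = p"
        proof
          assume "p dvd x"
          then obtain k where k: "x = p * k" by blast
          then have "k * y = q" using xy ne by (simp add: mult.assoc)
          then show ?thesis using prime_product[of k y] q k by auto
        next
          assume "p dvd y"
          then obtain k where k: "y = p * k" by blast
          then have "x * k = q" using xy ne by (simp add: mult.left_commute)
          then show ?thesis using prime_product[of x k] q k by auto
        qed
      qed auto
      have "cobar (word_fun [p * q]) w
        = of_bool (x = 1 \<and> y = p * q) + of_bool (y = 1 \<and> x = p * q) - (of_bool (x * y = p * q) :: 'a)"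
        unfolding w by (auto simp: word_fun_def)
      also have "\<dots> = - of_bool (x = p \<and> y = q \<or> x = q \<and> y = p)"
        unfolding * using ne by auto
      finally show ?thesis unfolding w c_def by (auto simp: word_fun_def)
    qed
  qed
  moreover have "word_fun [p * q] \<in> word_cochains" using ne by (intro word_cochains_word_fun) auto
  ultimately show ?thesis
    using boundaries_scale[of "cobar (word_fun [p * q])" c] unfolding boundaries_def by auto
qed

lemma adjacent_swap:
  assumes "is_prime p" "is_prime q" "v \<in> prime_words"
  shows "(\<lambda>w. word_fun (p # q # v) w + word_fun (q # p # v) w :: 'k::field) \<in> boundaries"
proof -
  have "conv (\<lambda>w. word_fun [p, q] w + word_fun [q, p] w :: 'k) (word_fun v) \<in> boundaries"
    by (rule boundaries_conv_left[OF prime_letters_anticommute word_fun_cocycle]) (rule assms)+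
  moreover have "conv (\<lambda>w. word_fun [p, q] w + word_fun [q, p] w :: 'k) (word_fun v)
     = (\<lambda>w. word_fun (p # q # v) w + word_fun (q # p # v) w)"
    by (rule ext) (simp add: conv_add_left conv_word_fun)
  ultimately show ?thesis by simp
qed

lemma prime_words_Cons: "x # w \<in> prime_words \<longleftrightarrow> is_prime x \<and> w \<in> prime_words"
  and prime_words_append: "u @ v \<in> prime_words \<longleftrightarrow> u \<in> prime_words \<and> v \<in> prime_words"
  and prime_words_Nil: "[] \<in> prime_words"
  unfolding prime_words_def by auto

lemma prefix_letter_boundary:
  assumes "is_prime p" "f \<in> boundaries" shows "conv (word_fun [p]) f \<in> boundaries"
  by (intro boundaries_conv_right word_fun_cocycle assms)
    (simp add: prime_words_Cons prime_words_Nil assms)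

lemma letter_past_word:
  assumes "is_prime p" "v \<in> prime_words"
  shows "(\<lambda>w. word_fun (p # v) w - (-1) ^ length v * word_fun (v @ [p]) w) \<in> boundaries"
  using assms(2)
proof (induction v)
  case Nil then show ?case by (simp add: boundaries_zero)
next
  case (Cons q v)
  then have q: "is_prime q" and v: "v \<in> prime_words" by (auto simp: prime_words_Cons)
  let ?s = "(-1) ^ length v :: 'a"
  have "conv (word_fun [q]) (\<lambda>w. word_fun (p # v) w - ?s * word_fun (v @ [p]) w) \<in> boundaries"
    by (rule prefix_letter_boundary[OF q Cons.IH[OF v]])
  also have "conv (word_fun [q]) (\<lambda>w. word_fun (p # v) w - ?s * word_fun (v @ [p]) w)
    = (\<lambda>w. word_fun (q # p # v) w - ?s * word_fun (q # v @ [p]) w)"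
    by (rule ext) (simp add: conv_diff_right conv_scale_right conv_word_fun)
  finally have "(\<lambda>w. (word_fun (p # q # v) w + word_fun (q # p # v) w)
      - (word_fun (q # p # v) w - ?s * word_fun (q # v @ [p]) w)) \<in> boundaries"
    by (rule boundaries_diff[OF adjacent_swap[OF assms(1) q v]])
  then show ?case by (simp add: algebra_simps)
qed

text \<open>
  The sign rule for words of odd letters, obtained from adjacent swaps.
\<close>

lemma word_past_word:
  assumes "u \<in> prime_words" "v \<in> prime_words"
  shows "(\<lambda>w. word_fun (u @ v) w - (-1) ^ (length u * length v) * word_fun (v @ u) w) \<in> boundaries"
  using assms(1)
proof (induction u)
  case Nil then show ?case by (simp add: boundaries_zero)
next
  case (Cons p u)
  then have p: "is_prime p" and u: "u \<in> prime_words" by (auto simp: prime_words_Cons)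
  let ?s = "(-1) ^ (length u * length v) :: 'a" let ?t = "(-1) ^ length v :: 'a"
  have "conv (word_fun [p]) (\<lambda>w. word_fun (u @ v) w - ?s * word_fun (v @ u) w) \<in> boundaries"
    by (rule prefix_letter_boundary[OF p Cons.IH[OF u]])
  also have "conv (word_fun [p]) (\<lambda>w. word_fun (u @ v) w - ?s * word_fun (v @ u) w)
    = (\<lambda>w. word_fun (p # u @ v) w - ?s * word_fun (p # v @ u) w)"
    by (rule ext) (simp add: conv_diff_right conv_scale_right conv_word_fun)
  finally have 1: "(\<lambda>w. word_fun (p # u @ v) w - ?s * word_fun (p # v @ u) w) \<in> boundaries" .
  have "conv (\<lambda>w. word_fun (p # v) w - ?t * word_fun (v @ [p]) w) (word_fun u) \<in> boundaries"
    by (rule boundaries_conv_left[OF letter_past_word[OF p assms(2)] word_fun_cocycle[OF u]])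
  also have "conv (\<lambda>w. word_fun (p # v) w - ?t * word_fun (v @ [p]) w) (word_fun u)
    = (\<lambda>w. word_fun (p # v @ u) w - ?t * word_fun (v @ p # u) w)"
    by (rule ext) (simp add: conv_diff_left conv_scale_left conv_word_fun)
  finally have "(\<lambda>w. (word_fun (p # u @ v) w - ?s * word_fun (p # v @ u) w)
      + ?s * (word_fun (p # v @ u) w - ?t * word_fun (v @ p # u) w)) \<in> boundaries"
    by (intro boundaries_add boundaries_scale 1)
  then show ?case by (simp add: algebra_simps power_add)
qed

lemma word_cochains_expand:
  assumes "f \<in> word_cochains" shows "f w = (\<Sum>v | f v \<noteq> 0. f v * word_fun v w)"
proof -
  have "(\<Sum>v | f v \<noteq> 0. f v * word_fun v w) = (\<Sum>v | f v \<noteq> 0. if v = w then f w else 0)"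
    by (rule sum.cong) (auto simp: word_fun_def)
  also have "\<dots> = f w" using word_cochains_finite[OF assms] by simp
  finally show ?thesis by simp
qed

lemma conv_sum_left: "conv (\<lambda>w. \<Sum>i\<in>S. F i w) g w = (\<Sum>i\<in>S. conv (F i) g w)"
  by (induction S rule: infinite_finite_induct) (simp_all add: conv_add_left)
lemma conv_sum_right: "conv g (\<lambda>w. \<Sum>i\<in>S. F i w) w = (\<Sum>i\<in>S. conv g (F i) w)"
  by (induction S rule: infinite_finite_induct) (simp_all add: conv_add_right)

lemma conv_expand:
  assumes "f \<in> word_cochains" "g \<in> word_cochains"
  shows "conv f g w = (\<Sum>u | f u \<noteq> 0. \<Sum>v | g v \<noteq> 0. f u * g v * word_fun (u @ v) w)"
proof -
  have f: "f = (\<lambda>w. \<Sum>v | f v \<noteq> 0. f v * word_fun v w)" using word_cochains_expand[OF assms(1)] by blast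
  have g: "g = (\<lambda>w. \<Sum>v | g v \<noteq> 0. g v * word_fun v w)" using word_cochains_expand[OF assms(2)] by blast
  have "conv f g w = conv (\<lambda>w. \<Sum>v | f v \<noteq> 0. f v * word_fun v w) (\<lambda>w. \<Sum>v | g v \<noteq> 0. g v * word_fun v w) w"
    using f g by metis
  then show ?thesis
    by (simp add: conv_sum_left conv_sum_right conv_scale_left conv_scale_right conv_word_fun
        sum_distrib_left mult.assoc)
qed

lemma prime_words_graded_commute:
  assumes f: "f \<in> homogeneous p" "\<And>w. f w \<noteq> 0 \<Longrightarrow> w \<in> prime_words"
    and g: "g \<in> homogeneous q" "\<And>w. g w \<noteq> 0 \<Longrightarrow> w \<in> prime_words"
  shows "(\<lambda>w. conv f g w - (-1) ^ (p * q) * conv g f w) \<in> boundaries"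
proof -
  have F: "f \<in> word_cochains" "g \<in> word_cochains" using f g cocyclesD homogeneous_cocycles by blast+
  let ?A = "{u. f u \<noteq> 0}" let ?B = "{v. g v \<noteq> 0}"
  have "(\<lambda>w. \<Sum>u\<in>?A. \<Sum>v\<in>?B. f u * g v * (word_fun (u @ v) w - (-1) ^ (p * q) * word_fun (v @ u) w)) \<in> boundaries"
  proof (intro boundaries_sum boundaries_scale)
    fix u v assume uv: "u \<in> ?A" "v \<in> ?B"
    have "length u = p" "length v = q" using uv f g unfolding homogeneous_def by auto
    then show "(\<lambda>w. word_fun (u @ v) w - (-1) ^ (p * q) * word_fun (v @ u) w) \<in> boundaries"
      using word_past_word[of u v] uv f(2) g(2) by auto
  qed
  moreover have "(\<Sum>u\<in>?A. \<Sum>v\<in>?B. f u * g v * (word_fun (u @ v) w - (-1) ^ (p * q) * word_fun (v @ u) w))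
     = conv f g w - (-1) ^ (p * q) * conv g f w" for w
    unfolding conv_expand[OF F] conv_expand[OF F(2,1)]
    by (subst sum.swap[of _ ?B ?A]) (simp add: sum_distrib_left sum_subtractf algebra_simps, rule sum.swap)
  ultimately show ?thesis by simp
qed

text \<open>
  The degree \<open>p\<close> part of a representative in prime words is again a representative.
\<close>

lemma homogeneous_prime_representative:
  assumes "f \<in> homogeneous p"
  obtains f' where "f' \<in> homogeneous p" "\<And>w. f' w \<noteq> 0 \<Longrightarrow> w \<in> prime_words" "(\<lambda>w. f w - f' w) \<in> boundaries"
proof -
  have f: "f \<in> cocycles" using assms by (rule homogeneous_cocycles)
  obtain h where h: "h \<in> word_cochains" "\<And>w. f w - cobar h w \<noteq> 0 \<Longrightarrow> \<forall>x\<in>set w. is_prime x"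
    using cocycle_prime_words[of f] f unfolding cocycles_def by blast
  have hb: "cobar h \<in> boundaries" unfolding boundaries_def using h by blast
  let ?g = "\<lambda>w. f w - cobar h w"
  have "(\<lambda>w. f w - component p ?g w) = component p (cobar h)"
    using assms by (auto simp: fun_eq_iff component_def homogeneous_def)
  then have "(\<lambda>w. f w - component p ?g w) \<in> boundaries" using boundaries_component[OF hb] by simp
  moreover have "component p ?g \<in> homogeneous p"
    by (intro component_homogeneous cocycles_diff f boundaries_cocycles hb)
  moreover have "w \<in> prime_words" if "component p ?g w \<noteq> 0" for w
    using that h(2)[of w] unfolding component_def prime_words_def by auto
  ultimately show ?thesis using that by blast
qed

theorem homogeneous_graded_commute:
  assumes f: "f \<in> homogeneous p" and g: "g \<in> homogeneous q"
  shows "(\<lambda>w. conv f g w - (-1) ^ (p * q) * conv g f w) \<in> boundaries"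
proof -
  obtain f' where f': "f' \<in> homogeneous p" "\<And>w. f' w \<noteq> 0 \<Longrightarrow> w \<in> prime_words" "(\<lambda>w. f w - f' w) \<in> boundaries"
    using homogeneous_prime_representative[OF f] by metis
  obtain g' where g': "g' \<in> homogeneous q" "\<And>w. g' w \<noteq> 0 \<Longrightarrow> w \<in> prime_words" "(\<lambda>w. g w - g' w) \<in> boundaries"
    using homogeneous_prime_representative[OF g] by metis
  note c = homogeneous_cocycles
  have conv_change: "(\<lambda>w. conv a b w - conv a' b' w) \<in> boundaries"
    if "(\<lambda>w. a w - a' w) \<in> boundaries" "(\<lambda>w. b w - b' w) \<in> boundaries" "b \<in> cocycles" "a' \<in> cocycles" for a a' b b'
  proof -
    have "(\<lambda>w. conv (\<lambda>w. a w - a' w) b w + conv a' (\<lambda>w. b w - b' w) w) \<in> boundaries"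
      by (intro boundaries_add boundaries_conv_left[OF that(1,3)] boundaries_conv_right[OF that(4,2)])
    then show ?thesis by (simp add: conv_diff_left conv_diff_right)
  qed
  have "(\<lambda>w. (conv f g w - conv f' g' w) + ((conv f' g' w - (-1) ^ (p * q) * conv g' f' w)
     - (-1) ^ (p * q) * (conv g f w - conv g' f' w))) \<in> boundaries"
    by (intro boundaries_add boundaries_diff boundaries_scale conv_change prime_words_graded_commute
        f' g' c[OF f] c[OF g] c[OF f'(1)] c[OF g'(1)])
  then show ?thesis by (simp add: algebra_simps)
qed

section \<open>The cohomology algebra in coordinates\<close>

abbreviation cocycle_ring :: "('k::field, nat \<Rightarrow> (nat \<Rightarrow> nat \<Rightarrow> 'k) \<Rightarrow> 'k) module" where
  "cocycle_ring \<equiv> cocycle_algebra dirichlet_algebra dirichlet_topology dirichlet_augmentation"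

abbreviation coboundary_ideal :: "(nat \<Rightarrow> (nat \<Rightarrow> nat \<Rightarrow> 'k::field) \<Rightarrow> 'k) set" where
  "coboundary_ideal \<equiv> coboundaries dirichlet_algebra dirichlet_topology dirichlet_augmentation"

abbreviation dirichlet_HH :: "('k::field, (nat \<Rightarrow> (nat \<Rightarrow> nat \<Rightarrow> 'k) \<Rightarrow> 'k) set) module" where
  "dirichlet_HH \<equiv> HH_cts dirichlet_algebra dirichlet_topology dirichlet_augmentation"

abbreviation dirichlet_HH_degree :: "nat \<Rightarrow> (nat \<Rightarrow> (nat \<Rightarrow> nat \<Rightarrow> 'k::field) \<Rightarrow> 'k) set set" where
  "dirichlet_HH_degree \<equiv> HH_cts_degree dirichlet_algebra dirichlet_topology dirichlet_augmentation"

lemma cochain_of_zero: "cochain_of (\<lambda>w. 0) = (\<lambda>n a. 0)"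
  using cochain_of_scale[OF word_cochains_zero, of 0] by simp

lemma carrier_cochains: "carrier (cochain_algebra dirichlet_algebra dirichlet_topology) = cochain_of ` word_cochains"
  using cochain_of_carrier cochain_of_surj by blast

lemma carrier_cocycle_ring: "carrier cocycle_ring = cochain_of ` cocycles"
proof -
  have "total_d dirichlet_algebra dirichlet_augmentation (cochain_of f) = (\<lambda>n a. 0) \<longleftrightarrow> f \<in> cocycles"
    if f: "f \<in> word_cochains" for f :: "nat list \<Rightarrow> 'a"
  proof -
    have "cochain_of (cobar f) = cochain_of (\<lambda>w. 0) \<longleftrightarrow> cobar f = (\<lambda>w. 0)"
      using inj_on_eq_iff[OF cochain_of_inj word_cochains_cobar[OF f] word_cochains_zero] .
    then show ?thesis
      unfolding total_d_cochain_of[OF f] cochain_of_zero cocycles_def using f by (auto simp: fun_eq_iff)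
  qed
  then show ?thesis
    unfolding cocycle_algebra_def using cocyclesD(1) by (auto simp: carrier_cochains)
qed

lemma coboundary_ideal_eq: "coboundary_ideal = cochain_of ` boundaries"
  unfolding coboundaries_def boundaries_def carrier_cochains image_image
  by (rule image_cong) (simp_all add: total_d_cochain_of)

lemma cocycle_ring_simps:
  "f \<in> cocycles \<Longrightarrow> g \<in> cocycles \<Longrightarrow> cochain_of f \<oplus>\<^bsub>cocycle_ring\<^esub> cochain_of g = cochain_of (\<lambda>w. f w + g w)"
  "f \<in> cocycles \<Longrightarrow> g \<in> cocycles \<Longrightarrow> cochain_of f \<otimes>\<^bsub>cocycle_ring\<^esub> cochain_of g = cochain_of (conv f g)"
  "f \<in> cocycles \<Longrightarrow> c \<odot>\<^bsub>cocycle_ring\<^esub> cochain_of f = cochain_of (\<lambda>w. c * f w)"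
  "\<one>\<^bsub>cocycle_ring\<^esub> = cochain_of unit_word_fun"
  "\<zero>\<^bsub>cocycle_ring\<^esub> = cochain_of (\<lambda>w. 0)"
  by (simp_all add: cocycle_algebra_def cocyclesD cochain_of_add cochain_of_conv cochain_of_scale
      cochain_of_unit cochain_of_zero cochain_algebra_simps)

lemma conv_assoc_fun: "conv (conv f g) h = conv f (conv g h)"
  by (rule ext) (rule conv_assoc)

lemma conv_add_fun:
  "conv (\<lambda>w. f w + g w) h = (\<lambda>w. conv f h w + conv g h w)"
  "conv h (\<lambda>w. f w + g w) = (\<lambda>w. conv h f w + conv h g w)"
  by (rule ext, rule conv_add_left, rule ext, rule conv_add_right)

lemma ring_cocycle_ring: "ring (cocycle_ring :: ('k::field, nat \<Rightarrow> (nat \<Rightarrow> nat \<Rightarrow> 'k) \<Rightarrow> 'k) module)"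
proof (rule ringI)
  show "abelian_group (cocycle_ring :: ('k, nat \<Rightarrow> (nat \<Rightarrow> nat \<Rightarrow> 'k) \<Rightarrow> 'k) module)"
  proof (rule abelian_groupI)
    fix x :: "nat \<Rightarrow> (nat \<Rightarrow> nat \<Rightarrow> 'k) \<Rightarrow> 'k" assume "x \<in> carrier cocycle_ring"
    then obtain f where f: "f \<in> cocycles" "x = cochain_of f" by (auto simp: carrier_cocycle_ring)
    have "cochain_of (\<lambda>w. - 1 * f w) \<oplus>\<^bsub>cocycle_ring\<^esub> x = \<zero>\<^bsub>cocycle_ring\<^esub>"
      unfolding f(2) by (subst cocycle_ring_simps(1)[OF cocycles_scale[OF f(1)] f(1)]) (simp add: cocycle_ring_simps)
    then show "\<exists>y\<in>carrier cocycle_ring. y \<oplus>\<^bsub>cocycle_ring\<^esub> x = \<zero>\<^bsub>cocycle_ring\<^esub>"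
      using cocycles_scale[OF f(1), of "-1"] unfolding carrier_cocycle_ring by blast
  qed (auto simp: carrier_cocycle_ring cocycle_ring_simps cocycles_add cocycles_zero add_ac)
  show "monoid (cocycle_ring :: ('k, nat \<Rightarrow> (nat \<Rightarrow> nat \<Rightarrow> 'k) \<Rightarrow> 'k) module)"
    by (rule monoidI)
      (auto simp: carrier_cocycle_ring cocycle_ring_simps cocycles_conv cocycles_unit conv_assoc_fun
        conv_unit_left[abs_def] conv_unit_right[abs_def])
qed (auto simp: carrier_cocycle_ring cocycle_ring_simps cocycles_conv cocycles_add conv_add_fun)

lemma minus_cocycle_ring: "f \<in> cocycles \<Longrightarrow> \<ominus>\<^bsub>cocycle_ring\<^esub> cochain_of f = cochain_of (\<lambda>w. - 1 * f w)"
proof -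
  assume f: "f \<in> cocycles"
  interpret ring "cocycle_ring :: ('a, nat \<Rightarrow> (nat \<Rightarrow> nat \<Rightarrow> 'a) \<Rightarrow> 'a) module" by (rule ring_cocycle_ring)
  have "cochain_of (\<lambda>w. - 1 * f w) \<oplus>\<^bsub>cocycle_ring\<^esub> cochain_of f = \<zero>\<^bsub>cocycle_ring\<^esub>"
    by (subst cocycle_ring_simps(1)[OF cocycles_scale[OF f] f]) (simp add: cocycle_ring_simps)
  then show ?thesis
    by (rule minus_equality) (use f cocycles_scale[OF f, of "-1"] in \<open>auto simp: carrier_cocycle_ring\<close>)
qed

lemma ideal_coboundary_ideal: "ideal coboundary_ideal (cocycle_ring :: ('k::field, nat \<Rightarrow> (nat \<Rightarrow> nat \<Rightarrow> 'k) \<Rightarrow> 'k) module)"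
proof (rule idealI[OF ring_cocycle_ring])
  interpret ring "cocycle_ring :: ('k, nat \<Rightarrow> (nat \<Rightarrow> nat \<Rightarrow> 'k) \<Rightarrow> 'k) module" by (rule ring_cocycle_ring)
  show "subgroup coboundary_ideal (add_monoid (cocycle_ring :: ('k, nat \<Rightarrow> (nat \<Rightarrow> nat \<Rightarrow> 'k) \<Rightarrow> 'k) module))"
  proof (rule add.subgroupI)
    show "coboundary_ideal \<subseteq> carrier cocycle_ring" using boundaries_cocycles by (auto simp: coboundary_ideal_eq carrier_cocycle_ring)
    show "coboundary_ideal \<noteq> {}" using boundaries_zero by (auto simp: coboundary_ideal_eq)
    fix a :: "nat \<Rightarrow> (nat \<Rightarrow> nat \<Rightarrow> 'k) \<Rightarrow> 'k" assume "a \<in> coboundary_ideal"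
    then obtain f where f: "f \<in> boundaries" "a = cochain_of f" by (auto simp: coboundary_ideal_eq)
    show "\<ominus>\<^bsub>cocycle_ring\<^esub> a \<in> coboundary_ideal"
      unfolding f(2) minus_cocycle_ring[OF boundaries_cocycles[OF f(1)]] coboundary_ideal_eq
      using boundaries_scale[OF f(1)] by (rule imageI)
    fix b :: "nat \<Rightarrow> (nat \<Rightarrow> nat \<Rightarrow> 'k) \<Rightarrow> 'k" assume "b \<in> coboundary_ideal"
    then obtain g where g: "g \<in> boundaries" "b = cochain_of g" by (auto simp: coboundary_ideal_eq)
    show "a \<oplus>\<^bsub>cocycle_ring\<^esub> b \<in> coboundary_ideal"
      unfolding f(2) g(2) cocycle_ring_simps(1)[OF boundaries_cocycles[OF f(1)] boundaries_cocycles[OF g(1)]] coboundary_ideal_eq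
      using boundaries_add[OF f(1) g(1)] by (rule imageI)
  qed
qed (auto simp: coboundary_ideal_eq carrier_cocycle_ring cocycle_ring_simps boundaries_cocycles boundaries_conv_left boundaries_conv_right)

definition cohomology_class :: "(nat list \<Rightarrow> 'k::field) \<Rightarrow> (nat \<Rightarrow> (nat \<Rightarrow> nat \<Rightarrow> 'k) \<Rightarrow> 'k) set" where
  "cohomology_class f = coboundary_ideal +>\<^bsub>cocycle_ring\<^esub> cochain_of f"

lemma dirichlet_HH_simps:
  "carrier dirichlet_HH = a_rcosets\<^bsub>cocycle_ring\<^esub> coboundary_ideal"
  "x \<oplus>\<^bsub>dirichlet_HH\<^esub> y = x <+>\<^bsub>cocycle_ring\<^esub> y"
  "x \<otimes>\<^bsub>dirichlet_HH\<^esub> y = rcoset_mult cocycle_ring coboundary_ideal x y"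
  "\<one>\<^bsub>dirichlet_HH\<^esub> = coboundary_ideal +>\<^bsub>cocycle_ring\<^esub> \<one>\<^bsub>cocycle_ring\<^esub>"
  "\<zero>\<^bsub>dirichlet_HH\<^esub> = coboundary_ideal"
  "c \<odot>\<^bsub>dirichlet_HH\<^esub> x = (\<Union>\<Phi>\<in>x. coboundary_ideal +>\<^bsub>cocycle_ring\<^esub> (c \<odot>\<^bsub>cocycle_ring\<^esub> \<Phi>))"
  by (simp_all add: HH_cts_def Let_def ring.defs module.defs FactRing_def)

lemma carrier_dirichlet_HH: "carrier dirichlet_HH = cohomology_class ` cocycles"
  unfolding dirichlet_HH_simps A_RCOSETS_def' carrier_cocycle_ring cohomology_class_def by auto

text \<open>
  This and the following rules reduce all statements on the cohomology algebra to statements on functions on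
  words modulo \<open>boundaries\<close>.
\<close>

lemma cohomology_class_eq_iff:
  assumes "f \<in> cocycles" "g \<in> cocycles"
  shows "cohomology_class f = cohomology_class g \<longleftrightarrow> (\<lambda>w. f w - g w) \<in> boundaries"
proof -
  interpret ring "cocycle_ring :: ('a, nat \<Rightarrow> (nat \<Rightarrow> nat \<Rightarrow> 'a) \<Rightarrow> 'a) module" by (rule ring_cocycle_ring)
  have "cohomology_class f = cohomology_class g \<longleftrightarrow> cochain_of f \<ominus>\<^bsub>cocycle_ring\<^esub> cochain_of g \<in> coboundary_ideal"
    unfolding cohomology_class_def by (rule quotient_eq_iff_same_a_r_cos[symmetric, OF ideal_coboundary_ideal]) (use assms in \<open>auto simp: carrier_cocycle_ring\<close>)
  also have "cochain_of f \<ominus>\<^bsub>cocycle_ring\<^esub> cochain_of g = cochain_of (\<lambda>w. f w - g w)"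
    unfolding a_minus_def minus_cocycle_ring[OF assms(2)] cocycle_ring_simps(1)[OF assms(1) cocycles_scale[OF assms(2)]] by simp
  also have "\<dots> \<in> coboundary_ideal \<longleftrightarrow> (\<lambda>w. f w - g w) \<in> boundaries"
    unfolding coboundary_ideal_eq
    by (rule inj_on_image_mem_iff[OF cochain_of_inj])
      (use assms cocycles_diff cocyclesD(1) boundaries_cocycles in blast)+
  finally show ?thesis .
qed

lemma cohomology_class_ops:
  assumes "f \<in> cocycles"
  shows "g \<in> cocycles \<Longrightarrow> cohomology_class f \<oplus>\<^bsub>dirichlet_HH\<^esub> cohomology_class g = cohomology_class (\<lambda>w. f w + g w)"
    "g \<in> cocycles \<Longrightarrow> cohomology_class f \<otimes>\<^bsub>dirichlet_HH\<^esub> cohomology_class g = cohomology_class (conv f g)"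
    "c \<odot>\<^bsub>dirichlet_HH\<^esub> cohomology_class f = cohomology_class (\<lambda>w. c * f w)"
proof -
  interpret I: ideal coboundary_ideal "cocycle_ring :: ('a, nat \<Rightarrow> (nat \<Rightarrow> nat \<Rightarrow> 'a) \<Rightarrow> 'a) module" by (rule ideal_coboundary_ideal)
  have f: "cochain_of f \<in> carrier cocycle_ring" using assms by (auto simp: carrier_cocycle_ring)
  show "cohomology_class f \<oplus>\<^bsub>dirichlet_HH\<^esub> cohomology_class g = cohomology_class (\<lambda>w. f w + g w)" if g: "g \<in> cocycles"
    unfolding cohomology_class_def dirichlet_HH_simps cocycle_ring_simps(1)[OF assms g, symmetric]
    by (rule I.a_rcos_sum[OF f]) (use g in \<open>auto simp: carrier_cocycle_ring\<close>)
  show "cohomology_class f \<otimes>\<^bsub>dirichlet_HH\<^esub> cohomology_class g = cohomology_class (conv f g)" if g: "g \<in> cocycles"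
    unfolding cohomology_class_def dirichlet_HH_simps cocycle_ring_simps(2)[OF assms g, symmetric]
    by (rule I.rcoset_mult_add[OF f]) (use g in \<open>auto simp: carrier_cocycle_ring\<close>)
  have "coboundary_ideal +>\<^bsub>cocycle_ring\<^esub> (c \<odot>\<^bsub>cocycle_ring\<^esub> \<Phi>) = cohomology_class (\<lambda>w. c * f w)" if \<Phi>: "\<Phi> \<in> cohomology_class f" for \<Phi>
  proof -
    obtain h where h: "h \<in> boundaries" "\<Phi> = cochain_of h \<oplus>\<^bsub>cocycle_ring\<^esub> cochain_of f"
      using \<Phi> unfolding cohomology_class_def a_r_coset_def' coboundary_ideal_eq by auto
    note hc = boundaries_cocycles[OF h(1)]
    have "\<Phi> = cochain_of (\<lambda>w. h w + f w)" unfolding h(2) by (rule cocycle_ring_simps(1)[OF hc assms])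
    then have "coboundary_ideal +>\<^bsub>cocycle_ring\<^esub> (c \<odot>\<^bsub>cocycle_ring\<^esub> \<Phi>) = cohomology_class (\<lambda>w. c * (h w + f w))"
      using cocycle_ring_simps(3)[OF cocycles_add[OF hc assms], of c] unfolding cohomology_class_def by simp
    also have "\<dots> = cohomology_class (\<lambda>w. c * f w)"
      using boundaries_scale[OF h(1), of c]
      by (subst cohomology_class_eq_iff) (simp_all add: cocycles_scale cocycles_add hc assms algebra_simps)
    finally show ?thesis .
  qed
  moreover have "cohomology_class f \<noteq> {}" using I.a_rcos_self[OF f] unfolding cohomology_class_def by auto
  ultimately show "c \<odot>\<^bsub>dirichlet_HH\<^esub> cohomology_class f = cohomology_class (\<lambda>w. c * f w)" unfolding dirichlet_HH_simps by auto
qed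

lemma one_dirichlet_HH: "\<one>\<^bsub>dirichlet_HH\<^esub> = cohomology_class unit_word_fun"
  unfolding dirichlet_HH_simps cocycle_ring_simps cohomology_class_def ..

lemma zero_dirichlet_HH: "\<zero>\<^bsub>dirichlet_HH\<^esub> = cohomology_class (\<lambda>w. 0)"
proof -
  interpret I: ideal coboundary_ideal "cocycle_ring :: ('a, nat \<Rightarrow> (nat \<Rightarrow> nat \<Rightarrow> 'a) \<Rightarrow> 'a) module" by (rule ideal_coboundary_ideal)
  have "coboundary_ideal +>\<^bsub>cocycle_ring\<^esub> \<zero>\<^bsub>cocycle_ring\<^esub> = (coboundary_ideal :: (nat \<Rightarrow> (nat \<Rightarrow> nat \<Rightarrow> 'a) \<Rightarrow> 'a) set)" by (rule I.a_coset_add_zero[OF I.a_subset])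
  then show ?thesis unfolding dirichlet_HH_simps cohomology_class_def cocycle_ring_simps by simp
qed

lemma dirichlet_HH_degree_eq: "dirichlet_HH_degree n = cohomology_class ` homogeneous n"
proof -
  have "(\<forall>m. m \<noteq> n \<longrightarrow> cochain_of f m = (\<lambda>a. 0)) \<longleftrightarrow> f \<in> homogeneous n" if f: "f \<in> cocycles" for f :: "nat list \<Rightarrow> 'a"
  proof
    assume *: "\<forall>m. m \<noteq> n \<longrightarrow> cochain_of f m = (\<lambda>a. 0)"
    have "length w = n" if "f w \<noteq> 0" for w
      using cochain_of_word_args[OF cocyclesD(1)[OF f] word_cochains_pos[OF cocyclesD(1)[OF f] that]] * that
      by metis
    then show "f \<in> homogeneous n" using f unfolding homogeneous_def by blast
  next
    assume *: "f \<in> homogeneous n"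
    show "\<forall>m. m \<noteq> n \<longrightarrow> cochain_of f m = (\<lambda>a. 0)"
    proof (intro allI impI ext)
      fix m a assume "m \<noteq> n"
      then have "word_pairing N m f a = word_pairing N m (\<lambda>w. 0) a" for N
        using * unfolding homogeneous_def by (intro word_pairing_cong_fun) auto
      then show "cochain_of f m a = 0" by (simp add: cochain_of_def on_args_def)
    qed
  qed
  then show ?thesis
    unfolding HH_cts_degree_def Let_def carrier_cocycle_ring cohomology_class_def using homogeneous_cocycles by blast
qed

lemma ring_dirichlet_HH: "ring (dirichlet_HH :: ('k::field, (nat \<Rightarrow> (nat \<Rightarrow> nat \<Rightarrow> 'k) \<Rightarrow> 'k) set) module)"
proof (rule ringI)
  show "abelian_group (dirichlet_HH :: ('k, (nat \<Rightarrow> (nat \<Rightarrow> nat \<Rightarrow> 'k) \<Rightarrow> 'k) set) module)"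
  proof (rule abelian_groupI)
    fix x :: "(nat \<Rightarrow> (nat \<Rightarrow> nat \<Rightarrow> 'k) \<Rightarrow> 'k) set" assume "x \<in> carrier dirichlet_HH"
    then obtain f where f: "f \<in> cocycles" "x = cohomology_class f" by (auto simp: carrier_dirichlet_HH)
    have "cohomology_class (\<lambda>w. - 1 * f w) \<oplus>\<^bsub>dirichlet_HH\<^esub> x = \<zero>\<^bsub>dirichlet_HH\<^esub>"
      unfolding f(2) by (subst cohomology_class_ops(1)[OF cocycles_scale[OF f(1)] f(1)]) (simp add: zero_dirichlet_HH)
    then show "\<exists>y\<in>carrier dirichlet_HH. y \<oplus>\<^bsub>dirichlet_HH\<^esub> x = \<zero>\<^bsub>dirichlet_HH\<^esub>"
      using cocycles_scale[OF f(1), of "-1"] unfolding carrier_dirichlet_HH by blast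
  qed (auto simp: carrier_dirichlet_HH cohomology_class_ops zero_dirichlet_HH cocycles_add cocycles_zero add_ac)
  show "monoid (dirichlet_HH :: ('k, (nat \<Rightarrow> (nat \<Rightarrow> nat \<Rightarrow> 'k) \<Rightarrow> 'k) set) module)"
    by (rule monoidI)
      (auto simp: carrier_dirichlet_HH cohomology_class_ops one_dirichlet_HH cocycles_conv cocycles_unit conv_assoc_fun
        conv_unit_left[abs_def] conv_unit_right[abs_def])
qed (auto simp: carrier_dirichlet_HH cohomology_class_ops cocycles_conv cocycles_add conv_add_fun)

section \<open>The graded algebra structure and its generators\<close>

lemma minus_dirichlet_HH: "f \<in> cocycles \<Longrightarrow> \<ominus>\<^bsub>dirichlet_HH\<^esub> cohomology_class f = cohomology_class (\<lambda>w. - 1 * f w)"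
proof -
  assume f: "f \<in> cocycles"
  interpret ring "dirichlet_HH :: ('a, (nat \<Rightarrow> (nat \<Rightarrow> nat \<Rightarrow> 'a) \<Rightarrow> 'a) set) module" by (rule ring_dirichlet_HH)
  have "cohomology_class (\<lambda>w. - 1 * f w) \<oplus>\<^bsub>dirichlet_HH\<^esub> cohomology_class f = \<zero>\<^bsub>dirichlet_HH\<^esub>"
    by (subst cohomology_class_ops(1)[OF cocycles_scale[OF f] f]) (simp add: zero_dirichlet_HH)
  then show ?thesis
    by (rule minus_equality) (use f cocycles_scale[OF f, of "-1"] in \<open>auto simp: carrier_dirichlet_HH\<close>)
qed

lemma scalars_simps:
  "carrier (scalars :: 'k::field ring) = UNIV" "x \<oplus>\<^bsub>scalars\<^esub> y = (x + y :: 'k)"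
  "x \<otimes>\<^bsub>scalars\<^esub> y = (x * y :: 'k)" "\<one>\<^bsub>scalars\<^esub> = (1 :: 'k)"
  by (simp_all add: ring_of_type_algebra_def)

lemma module_dirichlet_HH: "Module.module scalars (dirichlet_HH :: ('k::field, (nat \<Rightarrow> (nat \<Rightarrow> nat \<Rightarrow> 'k) \<Rightarrow> 'k) set) module)"
proof (rule moduleI)
  show "cring (scalars :: 'k ring)" by (rule cring_from_type_algebra)
  show "abelian_group (dirichlet_HH :: ('k, (nat \<Rightarrow> (nat \<Rightarrow> nat \<Rightarrow> 'k) \<Rightarrow> 'k) set) module)"
    using ring_dirichlet_HH by (rule ring.is_abelian_group)
qed (auto simp: scalars_simps carrier_dirichlet_HH cohomology_class_ops cocycles_scale cocycles_add distrib_left distrib_right mult.assoc)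

lemma submodule_cohomology_class_image:
  fixes S :: "(nat list \<Rightarrow> 'k::field) set"
  assumes "S \<subseteq> cocycles" "(\<lambda>w. 0) \<in> S" "\<And>f g. f \<in> S \<Longrightarrow> g \<in> S \<Longrightarrow> (\<lambda>w. f w + g w) \<in> S"
    "\<And>c f. f \<in> S \<Longrightarrow> (\<lambda>w. c * f w) \<in> S"
  shows "submodule (cohomology_class ` S) scalars dirichlet_HH"
proof -
  interpret M: Module.module scalars "dirichlet_HH :: ('k, (nat \<Rightarrow> (nat \<Rightarrow> nat \<Rightarrow> 'k) \<Rightarrow> 'k) set) module" by (rule module_dirichlet_HH)
  show ?thesis
  proof (rule M.submoduleI)
    show "cohomology_class ` S \<subseteq> carrier dirichlet_HH" unfolding carrier_dirichlet_HH using assms(1) by blast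
    show "\<zero>\<^bsub>dirichlet_HH\<^esub> \<in> cohomology_class ` S" unfolding zero_dirichlet_HH using assms(2) by blast
    show "\<ominus>\<^bsub>dirichlet_HH\<^esub> a \<in> cohomology_class ` S" if "a \<in> cohomology_class ` S" for a
    proof -
      from that obtain f where f: "f \<in> S" "a = cohomology_class f" by blast
      show ?thesis unfolding f(2) using minus_dirichlet_HH[of f] assms(1) assms(4)[OF f(1), of "-1"] f(1) by auto
    qed
    show "a \<oplus>\<^bsub>dirichlet_HH\<^esub> b \<in> cohomology_class ` S" if "a \<in> cohomology_class ` S" "b \<in> cohomology_class ` S" for a b
    proof -
      from that obtain f g where f: "f \<in> S" "a = cohomology_class f" "g \<in> S" "b = cohomology_class g" by blast
      then have "f \<in> cocycles" "g \<in> cocycles" using assms(1) by auto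
      then have "a \<oplus>\<^bsub>dirichlet_HH\<^esub> b = cohomology_class (\<lambda>w. f w + g w)" unfolding f by (rule cohomology_class_ops(1))
      then show ?thesis using assms(3) f by blast
    qed
    show "c \<odot>\<^bsub>dirichlet_HH\<^esub> a \<in> cohomology_class ` S" if "a \<in> cohomology_class ` S" for c a
    proof -
      from that obtain f where f: "f \<in> S" "a = cohomology_class f" by blast
      then have "c \<odot>\<^bsub>dirichlet_HH\<^esub> a = cohomology_class (\<lambda>w. c * f w)" using assms(1) by (auto simp: cohomology_class_ops)
      then show ?thesis using assms(4) f by blast
    qed
  qed
qed

lemma submodule_dirichlet_HH_degree: "submodule (dirichlet_HH_degree n) scalars (dirichlet_HH :: ('k::field, _) module)"
  unfolding dirichlet_HH_degree_eq
proof (rule submodule_cohomology_class_image)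
  fix f g :: "nat list \<Rightarrow> 'k" and c
  assume f: "f \<in> homogeneous n"
  show "(\<lambda>w. c * f w) \<in> homogeneous n"
    using f cocycles_scale unfolding homogeneous_def by auto
  assume g: "g \<in> homogeneous n"
  show "(\<lambda>w. f w + g w) \<in> homogeneous n"
    using f g cocycles_add unfolding homogeneous_def by (auto, metis add_0)
qed (auto simp: homogeneous_def cocycles_zero)

lemma finsum_cohomology_class:
  fixes F :: "nat \<Rightarrow> nat list \<Rightarrow> 'k::field"
  assumes "finite S" "\<And>n. n \<in> S \<Longrightarrow> F n \<in> cocycles"
  shows "finsum dirichlet_HH (\<lambda>n. cohomology_class (F n)) S = cohomology_class (\<lambda>w. \<Sum>n\<in>S. F n w)"
proof -
  interpret ring "dirichlet_HH :: ('k, (nat \<Rightarrow> (nat \<Rightarrow> nat \<Rightarrow> 'k) \<Rightarrow> 'k) set) module" by (rule ring_dirichlet_HH)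
  show ?thesis using assms
  proof (induction S)
    case (insert n S)
    have "finsum dirichlet_HH (\<lambda>n. cohomology_class (F n)) (insert n S) = cohomology_class (F n) \<oplus>\<^bsub>dirichlet_HH\<^esub> finsum dirichlet_HH (\<lambda>n. cohomology_class (F n)) S"
      by (rule finsum_insert) (use insert in \<open>auto simp: carrier_dirichlet_HH\<close>)
    also have "\<dots> = cohomology_class (F n) \<oplus>\<^bsub>dirichlet_HH\<^esub> cohomology_class (\<lambda>w. \<Sum>n\<in>S. F n w)" using insert by simp
    also have "\<dots> = cohomology_class (\<lambda>w. F n w + (\<Sum>n\<in>S. F n w))"
      by (rule cohomology_class_ops(1)) (use insert.prems in \<open>auto intro: cocycles_sum\<close>)
    finally show ?case using insert by simp
  qed (simp add: zero_dirichlet_HH)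
qed

lemma boundary_iff_cohomology_class_zero: "f \<in> cocycles \<Longrightarrow> cohomology_class f = \<zero>\<^bsub>dirichlet_HH\<^esub> \<longleftrightarrow> f \<in> boundaries"
  unfolding zero_dirichlet_HH by (subst cohomology_class_eq_iff) (simp_all add: cocycles_zero)

text \<open>
  Cocycles and boundaries are closed under taking the part supported on words of a given length.
  So the degree \<open>n\<close> part of a class can only be the class of the part of length \<open>n\<close> of a representative.
\<close>

lemma unique_decomposition:
  assumes x: "x \<in> carrier (dirichlet_HH :: ('k::field, (nat \<Rightarrow> (nat \<Rightarrow> nat \<Rightarrow> 'k) \<Rightarrow> 'k) set) module)"
  shows "\<exists>!h. (\<forall>n. h n \<in> dirichlet_HH_degree n) \<and> finite {n. h n \<noteq> \<zero>\<^bsub>dirichlet_HH\<^esub>} \<and> x = finsum dirichlet_HH h {n. h n \<noteq> \<zero>\<^bsub>dirichlet_HH\<^esub>}"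
proof -
  obtain f where f: "f \<in> cocycles" "x = cohomology_class f" using x by (auto simp: carrier_dirichlet_HH)
  note cf = cocycles_component[OF f(1)]
  let ?P = "\<lambda>h. (\<forall>n. h n \<in> dirichlet_HH_degree n) \<and> finite {n. h n \<noteq> \<zero>\<^bsub>dirichlet_HH\<^esub>} \<and> x = finsum dirichlet_HH h {n. h n \<noteq> \<zero>\<^bsub>dirichlet_HH\<^esub>}"
  show ?thesis
  proof (rule ex1I[of ?P "\<lambda>n. cohomology_class (component n f)"])
    let ?T = "{n. cohomology_class (component n f) \<noteq> \<zero>\<^bsub>dirichlet_HH\<^esub>}"
    obtain N where N: "supported N f" using cocyclesD(1)[OF f(1)] unfolding word_cochains_def by blast
    have T: "?T \<subseteq> {..N}"
    proof
      fix n assume n: "n \<in> ?T"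
      have "component n f \<noteq> (\<lambda>w. 0)" using n unfolding zero_dirichlet_HH by auto
      then obtain w where "length w = n" "f w \<noteq> 0" unfolding component_def by (auto simp: fun_eq_iff)
      then show "n \<in> {..N}" using N unfolding supported_def pos_words_def by auto
    qed
    then have fin: "finite ?T" by (rule finite_subset) simp
    have "x = cohomology_class (\<lambda>w. \<Sum>n\<in>?T. component n f w)"
    proof -
      have "(\<lambda>w. \<Sum>n\<in>{..N} - ?T. component n f w) \<in> boundaries"
      proof (rule boundaries_sum)
        fix n assume "n \<in> {..N} - ?T"
        then show "component n f \<in> boundaries" using boundary_iff_cohomology_class_zero[OF cf, of n] by simp
      qed
      moreover have "(\<Sum>n\<in>{..N} - ?T. component n f w) = f w - (\<Sum>n\<in>?T. component n f w)" for w
        unfolding sum_components[OF N, of w] by (rule sum_diff) (use T in auto)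
      ultimately have "(\<lambda>w. f w - (\<Sum>n\<in>?T. component n f w)) \<in> boundaries" by (simp only:)
      moreover have "(\<lambda>w. \<Sum>n\<in>?T. component n f w) \<in> cocycles" by (rule cocycles_sum) (rule cf)
      ultimately show ?thesis unfolding f(2) using cohomology_class_eq_iff[OF f(1)] by blast
    qed
    also have "\<dots> = finsum dirichlet_HH (\<lambda>n. cohomology_class (component n f)) ?T" by (rule finsum_cohomology_class[symmetric, OF fin cf])
    finally show "?P (\<lambda>n. cohomology_class (component n f))"
      using fin component_homogeneous[OF f(1)] by (auto simp: dirichlet_HH_degree_eq)
  next
    fix h assume h: "?P h"
    let ?T = "{n. h n \<noteq> \<zero>\<^bsub>dirichlet_HH\<^esub>}"
    have "\<forall>n. \<exists>F. F \<in> homogeneous n \<and> h n = cohomology_class F" using h unfolding dirichlet_HH_degree_eq by blast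
    then have "\<exists>F. \<forall>n. F n \<in> homogeneous n \<and> h n = cohomology_class (F n)" by (rule choice)
    then obtain F where F: "\<And>n. F n \<in> homogeneous n" "\<And>n. h n = cohomology_class (F n)" by blast
    note Fc = homogeneous_cocycles[OF F(1)]
    have hF: "h = (\<lambda>n. cohomology_class (F n))" using F(2) by (rule ext)
    have fin: "finite ?T" using h by blast
    have xs: "x = cohomology_class (\<lambda>w. \<Sum>n\<in>?T. F n w)"
      using h finsum_cohomology_class[OF fin Fc] unfolding hF by simp
    moreover have "(\<lambda>w. \<Sum>n\<in>?T. F n w) \<in> cocycles" by (rule cocycles_sum) (rule Fc)
    ultimately have bd: "(\<lambda>w. f w - (\<Sum>n\<in>?T. F n w)) \<in> boundaries"
      using f(2) cohomology_class_eq_iff[OF f(1)] by blast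
    show "h = (\<lambda>n. cohomology_class (component n f))"
    proof
      fix m
      have "component m (\<lambda>w. f w - (\<Sum>n\<in>?T. F n w)) = (\<lambda>w. component m f w - (if m \<in> ?T then F m w else 0))"
      proof
        fix w
        have "(\<Sum>n\<in>?T. of_bool (length w = m) * F n w) = (\<Sum>n\<in>?T. if n = m then F m w else 0)"
        proof (rule sum.cong)
          fix n
          show "of_bool (length w = m) * F n w = (if n = m then F m w else 0)"
            using F(1)[of n] unfolding homogeneous_def by (cases "F n w = 0") auto
        qed simp
        then show "component m (\<lambda>w. f w - (\<Sum>n\<in>?T. F n w)) w = component m f w - (if m \<in> ?T then F m w else 0)"
          using fin by (simp add: component_def right_diff_distrib sum_distrib_left)
      qed
      then have *: "(\<lambda>w. component m f w - (if m \<in> ?T then F m w else 0)) \<in> boundaries"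
        using boundaries_component[OF bd, of m] by simp
      show "h m = cohomology_class (component m f)"
      proof (cases "m \<in> ?T")
        case True
        then have "cohomology_class (component m f) = cohomology_class (F m)" using * by (subst cohomology_class_eq_iff[OF cf Fc]) simp
        then show ?thesis using F(2) by simp
      next
        case False
        then have "component m f \<in> boundaries" using * by simp
        then have "cohomology_class (component m f) = \<zero>\<^bsub>dirichlet_HH\<^esub>" using boundary_iff_cohomology_class_zero[OF cf] by blast
        then show ?thesis using False by simp
      qed
    qed
  qed
qed

lemma graded_algebra_dirichlet_HH: "graded_algebra (dirichlet_HH :: ('k::field, (nat \<Rightarrow> (nat \<Rightarrow> nat \<Rightarrow> 'k) \<Rightarrow> 'k) set) module) dirichlet_HH_degree"
proof -
  have scale_fun: "conv (\<lambda>w. c * f w) g = (\<lambda>w. c * conv f g w)" "conv f (\<lambda>w. c * g w) = (\<lambda>w. c * conv f g w)"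
    for c :: 'k and f g by (rule ext, rule conv_scale_left, rule ext, rule conv_scale_right)
  have "unit_word_fun \<in> homogeneous 0"
    unfolding homogeneous_def using cocycles_unit by (auto simp: unit_word_fun_def)
  then have one: "\<one>\<^bsub>dirichlet_HH\<^esub> \<in> (dirichlet_HH_degree 0 :: (nat \<Rightarrow> (nat \<Rightarrow> nat \<Rightarrow> 'k) \<Rightarrow> 'k) set set)" unfolding dirichlet_HH_degree_eq one_dirichlet_HH by blast
  have mult: "x \<otimes>\<^bsub>dirichlet_HH\<^esub> y \<in> dirichlet_HH_degree (p + q)" if "x \<in> dirichlet_HH_degree p" "y \<in> dirichlet_HH_degree q"
    for p q and x y :: "(nat \<Rightarrow> (nat \<Rightarrow> nat \<Rightarrow> 'k) \<Rightarrow> 'k) set"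
  proof -
    obtain f g where f: "f \<in> homogeneous p" "x = cohomology_class f" "g \<in> homogeneous q" "y = cohomology_class g"
      using \<open>x \<in> dirichlet_HH_degree p\<close> \<open>y \<in> dirichlet_HH_degree q\<close> unfolding dirichlet_HH_degree_eq by blast
    have "x \<otimes>\<^bsub>dirichlet_HH\<^esub> y = cohomology_class (conv f g)"
      unfolding f(2) f(4) by (rule cohomology_class_ops(2)) (rule homogeneous_cocycles, rule f)+
    then show ?thesis unfolding dirichlet_HH_degree_eq using homogeneous_conv[OF f(1,3)] by blast
  qed
  have smult: "(c \<odot>\<^bsub>dirichlet_HH\<^esub> x) \<otimes>\<^bsub>dirichlet_HH\<^esub> y = c \<odot>\<^bsub>dirichlet_HH\<^esub> (x \<otimes>\<^bsub>dirichlet_HH\<^esub> y) \<and>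
        x \<otimes>\<^bsub>dirichlet_HH\<^esub> (c \<odot>\<^bsub>dirichlet_HH\<^esub> y) = c \<odot>\<^bsub>dirichlet_HH\<^esub> (x \<otimes>\<^bsub>dirichlet_HH\<^esub> y)" if "x \<in> carrier dirichlet_HH" "y \<in> carrier dirichlet_HH"
    for c :: 'k and x y
  proof -
    obtain f g where f: "f \<in> cocycles" "x = cohomology_class f" "g \<in> cocycles" "y = cohomology_class g"
      using \<open>x \<in> carrier dirichlet_HH\<close> \<open>y \<in> carrier dirichlet_HH\<close> unfolding carrier_dirichlet_HH by blast
    then show ?thesis by (simp add: cohomology_class_ops cocycles_scale cocycles_conv scale_fun)
  qed
  show ?thesis
    unfolding graded_algebra_def
    by (intro conjI allI ballI)
      (fact ring_dirichlet_HH module_dirichlet_HH submodule_dirichlet_HH_degree | rule unique_decomposition one mult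
        conjunct1[OF smult] conjunct2[OF smult] | assumption)+
qed

lemma minus_one_pow: "(\<ominus>\<^bsub>dirichlet_HH\<^esub> \<one>\<^bsub>dirichlet_HH\<^esub>) [^]\<^bsub>dirichlet_HH\<^esub> (n::nat) = cohomology_class (\<lambda>w. (-1) ^ n * unit_word_fun w :: 'k::field)"
proof -
  interpret ring "dirichlet_HH :: ('k, (nat \<Rightarrow> (nat \<Rightarrow> nat \<Rightarrow> 'k) \<Rightarrow> 'k) set) module" by (rule ring_dirichlet_HH)
  show ?thesis
  proof (induction n)
    case 0 show ?case by (simp add: one_dirichlet_HH)
  next
    case (Suc n)
    have "(\<ominus>\<^bsub>dirichlet_HH\<^esub> \<one>\<^bsub>dirichlet_HH\<^esub>) [^]\<^bsub>dirichlet_HH\<^esub> Suc n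
       = cohomology_class (\<lambda>w. (-1) ^ n * unit_word_fun w :: 'k) \<otimes>\<^bsub>dirichlet_HH\<^esub> cohomology_class (\<lambda>w. - 1 * unit_word_fun w)"
      by (simp only: nat_pow_Suc Suc) (simp only: one_dirichlet_HH minus_dirichlet_HH[OF cocycles_unit])
    also have "\<dots> = cohomology_class (conv (\<lambda>w. (-1) ^ n * unit_word_fun w) (\<lambda>w. - 1 * unit_word_fun w))"
      by (rule cohomology_class_ops(2)) (rule cocycles_scale[OF cocycles_unit])+
    also have "conv (\<lambda>w. (-1) ^ n * unit_word_fun w) (\<lambda>w. - 1 * unit_word_fun w)
        = (\<lambda>w. (-1) ^ Suc n * unit_word_fun w :: 'k)"
      by (rule ext) (simp only: conv_scale_left conv_scale_right conv_unit_left, simp)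
    finally show ?case .
  qed
qed

lemma graded_commutative_dirichlet_HH:
  "graded_commutative (dirichlet_HH :: ('k::field, (nat \<Rightarrow> (nat \<Rightarrow> nat \<Rightarrow> 'k) \<Rightarrow> 'k) set) module) dirichlet_HH_degree"
  unfolding graded_commutative_def
proof (intro allI ballI)
  fix p q and x y :: "(nat \<Rightarrow> (nat \<Rightarrow> nat \<Rightarrow> 'k) \<Rightarrow> 'k) set" assume "x \<in> dirichlet_HH_degree p" "y \<in> dirichlet_HH_degree q"
  then obtain f g where f: "f \<in> homogeneous p" "x = cohomology_class f" and g: "g \<in> homogeneous q" "y = cohomology_class g"
    unfolding dirichlet_HH_degree_eq by blast
  note fc = homogeneous_cocycles[OF f(1)] and gc = homogeneous_cocycles[OF g(1)]
  let ?s = "(-1) ^ (p * q) :: 'k"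
  have "x \<otimes>\<^bsub>dirichlet_HH\<^esub> y = cohomology_class (conv f g)" unfolding f(2) g(2) by (rule cohomology_class_ops(2)[OF fc gc])
  also have "\<dots> = cohomology_class (\<lambda>w. ?s * conv g f w)"
    using homogeneous_graded_commute[OF f(1) g(1)]
    by (subst cohomology_class_eq_iff[OF cocycles_conv[OF fc gc] cocycles_scale[OF cocycles_conv[OF gc fc]]])
  also have "\<dots> = cohomology_class (conv (\<lambda>w. ?s * unit_word_fun w) (conv g f))"
    by (simp add: conv_scale_left conv_unit_left conv_scale_left[abs_def])
  also have "\<dots> = cohomology_class (\<lambda>w. ?s * unit_word_fun w) \<otimes>\<^bsub>dirichlet_HH\<^esub> cohomology_class (conv g f)"
    by (rule cohomology_class_ops(2)[symmetric, OF cocycles_scale[OF cocycles_unit] cocycles_conv[OF gc fc]])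
  also have "\<dots> = (\<ominus>\<^bsub>dirichlet_HH\<^esub> \<one>\<^bsub>dirichlet_HH\<^esub>) [^]\<^bsub>dirichlet_HH\<^esub> (p * q) \<otimes>\<^bsub>dirichlet_HH\<^esub> (y \<otimes>\<^bsub>dirichlet_HH\<^esub> x)"
    unfolding minus_one_pow f(2) g(2) cohomology_class_ops(2)[OF gc fc] ..
  finally show "x \<otimes>\<^bsub>dirichlet_HH\<^esub> y = (\<ominus>\<^bsub>dirichlet_HH\<^esub> \<one>\<^bsub>dirichlet_HH\<^esub>) [^]\<^bsub>dirichlet_HH\<^esub> (p * q) \<otimes>\<^bsub>dirichlet_HH\<^esub> (y \<otimes>\<^bsub>dirichlet_HH\<^esub> x)" .
qed

definition prime_class :: "nat \<Rightarrow> (nat \<Rightarrow> (nat \<Rightarrow> nat \<Rightarrow> 'k::field) \<Rightarrow> 'k) set" where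
  "prime_class p = cohomology_class (word_fun [p])"

lemma letter_cocycle: "is_prime p \<Longrightarrow> word_fun [p] \<in> cocycles"
  by (rule word_fun_cocycle) (simp add: prime_words_def)

lemma boundary_letter: "f \<in> boundaries \<Longrightarrow> f [p] = 0"
  unfolding boundaries_def by auto

text \<open>
  A word in primes is the product of its letters, and every class is a linear combination of classes of
  such words.
\<close>

lemma generates_prime_classes:
  "generates_algebra (dirichlet_HH :: ('k::field, (nat \<Rightarrow> (nat \<Rightarrow> nat \<Rightarrow> 'k) \<Rightarrow> 'k) set) module) (prime_class ` {p. is_prime p})"
  unfolding generates_algebra_def
proof (intro conjI allI impI)
  show "prime_class ` {p. is_prime p} \<subseteq> carrier (dirichlet_HH :: ('k, (nat \<Rightarrow> (nat \<Rightarrow> nat \<Rightarrow> 'k) \<Rightarrow> 'k) set) module)"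
    unfolding carrier_dirichlet_HH prime_class_def using letter_cocycle by blast
  fix A assume "subring A (dirichlet_HH :: ('k, (nat \<Rightarrow> (nat \<Rightarrow> nat \<Rightarrow> 'k) \<Rightarrow> 'k) set) module)
    \<and> submodule A scalars dirichlet_HH \<and> prime_class ` {p. is_prime p} \<subseteq> A"
  then have sr: "subring A dirichlet_HH" and sm: "submodule A scalars dirichlet_HH" and gen: "prime_class ` {p. is_prime p} \<subseteq> A" by auto
  have word: "cohomology_class (word_fun w) \<in> A" if "w \<in> prime_words" for w
    using that
  proof (induction w)
    case Nil
    have nil: "word_fun [] = (unit_word_fun :: nat list \<Rightarrow> 'k)" by (auto simp: word_fun_def unit_word_fun_def)
    show ?case unfolding nil one_dirichlet_HH[symmetric] by (rule subringE(3)[OF sr])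
  next
    case (Cons p w)
    then have p: "is_prime p" and w: "w \<in> prime_words" by (auto simp: prime_words_Cons)
    have "cohomology_class (word_fun (p # w)) = prime_class p \<otimes>\<^bsub>dirichlet_HH\<^esub> cohomology_class (word_fun w :: nat list \<Rightarrow> 'k)"
      unfolding prime_class_def cohomology_class_ops(2)[OF letter_cocycle[OF p] word_fun_cocycle[OF w]] conv_word_fun by simp
    then show ?case using subringE(6)[OF sr, of "prime_class p" "cohomology_class (word_fun w)"] gen p Cons.IH[OF w] by auto
  qed
  have sum: "cohomology_class (\<lambda>w. \<Sum>v\<in>S. c v * word_fun v w) \<in> A" if "finite S" "S \<subseteq> prime_words" for S and c :: "nat list \<Rightarrow> 'k"
    using that
  proof (induction S)
    case empty
    show ?case using subringE(2)[OF sr] unfolding zero_dirichlet_HH by simp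
  next
    case (insert u S)
    have u: "word_fun u \<in> cocycles" using insert.prems by (auto intro: word_fun_cocycle)
    have S: "(\<lambda>w. \<Sum>v\<in>S. c v * word_fun v w) \<in> cocycles"
      using insert.prems by (intro cocycles_sum cocycles_scale word_fun_cocycle) auto
    have "cohomology_class (\<lambda>w. \<Sum>v\<in>insert u S. c v * word_fun v w)
        = (c u \<odot>\<^bsub>dirichlet_HH\<^esub> cohomology_class (word_fun u)) \<oplus>\<^bsub>dirichlet_HH\<^esub> cohomology_class (\<lambda>w. \<Sum>v\<in>S. c v * word_fun v w)"
      unfolding cohomology_class_ops(3)[OF u] cohomology_class_ops(1)[OF cocycles_scale[OF u] S] using insert.hyps by simp
    moreover have "c u \<odot>\<^bsub>dirichlet_HH\<^esub> cohomology_class (word_fun u) \<in> A"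
      using submodule.smult_closed[OF sm] word insert.prems by (simp add: scalars_simps)
    ultimately show ?case using subringE(7)[OF sr] insert by auto
  qed
  have "cohomology_class f \<in> A" if f: "f \<in> cocycles" for f
  proof -
    obtain h where h: "h \<in> word_cochains" "\<And>w. f w - cobar h w \<noteq> 0 \<Longrightarrow> \<forall>x\<in>set w. is_prime x"
      using cocycle_prime_words[of f] f unfolding cocycles_def by blast
    let ?g = "\<lambda>w. f w - cobar h w"
    have hb: "cobar h \<in> boundaries" unfolding boundaries_def using h by blast
    have g: "?g \<in> cocycles" by (intro cocycles_diff f boundaries_cocycles hb)
    have "cohomology_class f = cohomology_class ?g" using hb by (subst cohomology_class_eq_iff[OF f g]) simp
    also have "?g = (\<lambda>w. \<Sum>v | ?g v \<noteq> 0. ?g v * word_fun v w)"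
      by (rule ext) (rule word_cochains_expand[OF cocyclesD(1)[OF g]])
    also have "cohomology_class \<dots> \<in> A"
      by (rule sum) (use word_cochains_finite[OF cocyclesD(1)[OF g]] h(2) in \<open>auto simp: prime_words_def\<close>)
    finally show ?thesis .
  qed
  then show "A = carrier dirichlet_HH" using subringE(1)[OF sr] unfolding carrier_dirichlet_HH by blast
qed

text \<open>
  The classes whose representatives have coefficient \<open>0\<close> at \<open>[p]\<close> form a subalgebra, because a product
  has coefficient \<open>f [] * g [p] + f [p] * g []\<close> there.  It contains all \<open>prime_class q\<close> with \<open>q \<noteq> p\<close>, but not
  \<open>prime_class p\<close>, as boundaries vanish at \<open>[p]\<close>.
\<close>

lemma prime_class_needed:
  fixes S :: "(nat \<Rightarrow> (nat \<Rightarrow> nat \<Rightarrow> 'k::field) \<Rightarrow> 'k) set set"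
  assumes p: "is_prime p" and S: "S \<subseteq> prime_class ` {q. is_prime q}" "prime_class p \<notin> S"
  shows "\<not> generates_algebra dirichlet_HH S"
proof
  assume gen: "generates_algebra dirichlet_HH S"
  let ?K = "{f \<in> cocycles. f [p] = (0 :: 'k)}"
  let ?A = "cohomology_class ` ?K"
  interpret ring "dirichlet_HH :: ('k, (nat \<Rightarrow> (nat \<Rightarrow> nat \<Rightarrow> 'k) \<Rightarrow> 'k) set) module" by (rule ring_dirichlet_HH)
  have sm: "submodule ?A scalars dirichlet_HH"
    by (rule submodule_cohomology_class_image) (auto simp: cocycles_zero cocycles_add cocycles_scale)
  have "subring ?A dirichlet_HH"
  proof (rule subringI)
    show "?A \<subseteq> carrier dirichlet_HH" unfolding carrier_dirichlet_HH by blast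
    show "\<one>\<^bsub>dirichlet_HH\<^esub> \<in> ?A" unfolding one_dirichlet_HH using cocycles_unit by (auto simp: unit_word_fun_def)
    show "\<ominus>\<^bsub>dirichlet_HH\<^esub> h \<in> ?A" if "h \<in> ?A" for h
      using that subgroup.m_inv_closed[OF submodule.axioms(1)[OF sm], of h] by (simp add: a_inv_def)
    show "h1 \<otimes>\<^bsub>dirichlet_HH\<^esub> h2 \<in> ?A" if h: "h1 \<in> ?A" "h2 \<in> ?A" for h1 h2
    proof -
      obtain f g where f: "f \<in> ?K" "h1 = cohomology_class f" and g: "g \<in> ?K" "h2 = cohomology_class g" using h by blast
      have "h1 \<otimes>\<^bsub>dirichlet_HH\<^esub> h2 = cohomology_class (conv f g)" using f g by (simp add: cohomology_class_ops)
      moreover have "conv f g \<in> ?K" using f g by (simp add: cocycles_conv)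
      ultimately show ?thesis by blast
    qed
    show "h1 \<oplus>\<^bsub>dirichlet_HH\<^esub> h2 \<in> ?A" if "h1 \<in> ?A" "h2 \<in> ?A" for h1 h2
      using that subgroup.m_closed[OF submodule.axioms(1)[OF sm], of h1 h2] by simp
  qed
  moreover have "S \<subseteq> ?A"
  proof
    fix x assume x: "x \<in> S"
    then obtain q where q: "is_prime q" "x = prime_class q" "q \<noteq> p" using S by blast
    then have "word_fun [q] \<in> ?K" using letter_cocycle by (auto simp: word_fun_def)
    then show "x \<in> ?A" unfolding q(2) prime_class_def by blast
  qed
  ultimately have "?A = carrier dirichlet_HH" using gen sm unfolding generates_algebra_def by blast
  then have "prime_class p \<in> ?A" unfolding carrier_dirichlet_HH prime_class_def using letter_cocycle[OF p] by blast
  then obtain f where f: "f \<in> ?K" "prime_class p = cohomology_class f" by blast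
  then have "(\<lambda>w. word_fun [p] w - f w) \<in> boundaries"
    using cohomology_class_eq_iff[OF letter_cocycle[OF p], of f] unfolding prime_class_def by simp
  from boundary_letter[OF this, of p] show False using f by (simp add: word_fun_def)
qed

lemma prime_class_inj: "inj_on prime_class {p. is_prime p}"
proof (rule inj_onI)
  fix p q assume pq: "p \<in> {p. is_prime p}" "q \<in> {p. is_prime p}"
    "prime_class p = (prime_class q :: (nat \<Rightarrow> (nat \<Rightarrow> nat \<Rightarrow> 'a) \<Rightarrow> 'a) set)"
  then have "(\<lambda>w. word_fun [p] w - word_fun [q] w :: 'a) \<in> boundaries"
    using cohomology_class_eq_iff[OF letter_cocycle letter_cocycle] unfolding prime_class_def by blast
  from boundary_letter[OF this, of p] show "p = q" by (auto simp: word_fun_def)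
qed

lemma countably_many_generators_dirichlet_HH:
  "countably_many_generators (dirichlet_HH :: ('k::field, (nat \<Rightarrow> (nat \<Rightarrow> nat \<Rightarrow> 'k) \<Rightarrow> 'k) set) module) dirichlet_HH_degree"
  unfolding countably_many_generators_def
proof (intro exI conjI allI impI)
  let ?S = "prime_class ` {p. is_prime p} :: (nat \<Rightarrow> (nat \<Rightarrow> nat \<Rightarrow> 'k) \<Rightarrow> 'k) set set"
  show "countable ?S" by simp
  show "infinite ?S" using primes_infinite prime_class_inj finite_image_iff by blast
  have "word_fun [p] \<in> homogeneous 1" if "is_prime p" for p
    using letter_cocycle[OF that] unfolding homogeneous_def by (auto simp: word_fun_def)
  then show "?S \<subseteq> (\<Union>n. dirichlet_HH_degree n)" unfolding dirichlet_HH_degree_eq prime_class_def by blast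
  show "generates_algebra dirichlet_HH ?S" by (rule generates_prime_classes)
  fix S' assume "S' \<subset> ?S"
  then obtain p where "is_prime p" "prime_class p \<notin> S'" "S' \<subseteq> ?S" by blast
  then show "\<not> generates_algebra dirichlet_HH S'" by (intro prime_class_needed)
qed

theorem theorem5p5:
  fixes H :: "('k::field_char_0, (nat \<Rightarrow> (nat \<Rightarrow> nat \<Rightarrow> 'k) \<Rightarrow> 'k) set) module"
    and G :: "nat \<Rightarrow> (nat \<Rightarrow> (nat \<Rightarrow> nat \<Rightarrow> 'k) \<Rightarrow> 'k) set set"
  defines "H \<equiv> HH_cts dirichlet_algebra dirichlet_topology dirichlet_augmentation"
    and "G \<equiv> HH_cts_degree dirichlet_algebra dirichlet_topology dirichlet_augmentation"
  shows "graded_algebra H G \<and> graded_commutative H G \<and> countably_many_generators H G"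
  unfolding H_def G_def
  by (intro conjI graded_algebra_dirichlet_HH graded_commutative_dirichlet_HH
      countably_many_generators_dirichlet_HH)

end
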